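(* Let $d\geq1$, $1\leq p,q\leq\infty$ such that $1/p + 1/q = 1$ and $s > d/p$. Given an $N$-point set $X_N$ on $\mathbb{S}^d$ and an ordered $X_N$-avoiding packing on $\mathbb{S}^d$ with spherical cap radii $\rho_1 \geq \rho_2 \geq \rho_3 \geq \cdots$, then for every index $n$ of the packing $$\rho_n \leq c_{s,d} \, n^{-1 / ( q s + d )} \, \left[ \operatorname{wce}( Q[X_N]; \mathbb{W}_p^s(\mathbb{S}^d) ) \right]^{1 / ( s + d/q )},$$ where the constant $c_{s,d}$ depends on $s$ and $d$ but not on $p$ or $q$ or the packing. (For $q=\infty$ the exponent $-1/(qs+d)$ is read as $0$.)
   Context: $\mathbb{S}^d$ is the unit sphere in $\mathbb{R}^{d+1}$, $\sigma_d$ its normalized surface area measure, and $\mathbb{L}_p(\mathbb{S}^d)$ the real $L_p$ space with respect to $\sigma_d$, with norm $\|\cdot\|_p$. Convention: $1/\infty = 0$. Sobolev space: for $f \in \mathbb{L}_1(\mathbb{S}^d)$ let $Y_\ell[f]$ be the projection of $f$ onto the spherical harmonics of exact degree $\ell$ on $\mathbb{S}^d$ (defined by integrating $f$ against the zonal reproducing kernel of that space), and let $\lambda_\ell = \ell(\ell+d-1)$ be the corresponding eigenvalue of the negative Laplace–Beltrami operator $-\Delta_d^*$. For $s \geq 0$, $1 \leq p \leq \infty$, $\mathbb{W}_p^s(\mathbb{S}^d)$ is the set of $f \in \mathbb{L}_p(\mathbb{S}^d)$ for which $(1-\Delta_d^* )^{s/2} f = \sum_{\ell\ge 0} (1+\lambda_\ell)^{s/2}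 Y_\ell[f]$ is in $\mathbb{L}_p(\mathbb{S}^d)$ (i.e. there is $g\in \mathbb{L}_p(\mathbb{S}^d)$ with $Y_\ell[g] = (1+\lambda_\ell)^{s/2} Y_\ell[f]$ for all $\ell$), with norm $\|f\|_{\mathbb{W}_p^s(\mathbb{S}^d)} = \|(1-\Delta_d^* )^{s/2} f\|_p$. For $s > d/p$ this space embeds continuously into $C(\mathbb{S}^d)$, and its elements are identified with their continuous representatives. Worst-case error: for $X_N = \{\mathbf{x}_1,\dots,\mathbf{x}_N\}\subset \mathbb{S}^d$, $Q[X_N](f) = \frac1N \sum_{k=1}^N f(\mathbf{x}_k)$, $I(f) = \int_{\mathbb{S}^d} f\, d\sigma_d$, and for $s>d/p$ $$\operatorname{wce}(Q[X_N]; \mathbb{W}_p^s(\mathbb{S}^d)) = \sup\{ |Q[X_N](f) - I(f)| : f \in \mathbb{W}_p^s(\mathbb{S}^d),\ \|f\|_{\mathbb{W}_p^s(\mathbb{S}^d)} \leq 1\}.$$ Ordered $X_N$-avoiding packing: a (finite or infinite) sequence $(S_n)_{n\ge1}$ of open, pairwise disjoint spherical caps on $\mathbb{S}^d$ with (geodesic) cap radii $\rho_1 \geq \rho_2 \geq \rho_3 \geq \cdots$ such that no $S_n$ contains points of $X_N$. *)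

theory Defs
  imports "HOL-Analysis.Analysis" "HOL-Probability.Essential_Supremum"
begin

text \<open>
  Throughout, the sphere \<open>S\<^sup>d\<close> is \<^term>\<open>sphere (0::'a::euclidean_space) 1\<close> with
  \<open>DIM('a) = d + 1\<close>. Functions on the sphere are functions on the ambient type; only
  their values on the sphere enter the notions below.
\<close>

text \<open>
  Normalized surface area measure, as the normalized cone measure: the measure of \<open>A\<close> is
  the Lebesgue measure of \<open>{t x | x \<in> A, 0 < t < 1}\<close> divided by that of the unit ball.
  Recall \<open>sgn x = x /\<^sub>R norm x\<close>; the origin, which \<open>sgn\<close> sends outside the sphere, is a
  null set.
\<close>

definition sphere_measure :: "'a::euclidean_space measure" where
  "sphere_measure =
     restrict_space (distr (uniform_measure lborel (ball 0 1)) borel sgn) (sphere 0 1)"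

definition Lp_space :: "ereal \<Rightarrow> 'a measure \<Rightarrow> ('a \<Rightarrow> real) set" where
  "Lp_space p M = {f \<in> borel_measurable M.
     if p = \<infinity> then esssup M (\<lambda>x. ereal \<bar>f x\<bar>) < \<infinity>
     else integrable M (\<lambda>x. \<bar>f x\<bar> powr real_of_ereal p)}"

definition Lp_norm :: "ereal \<Rightarrow> 'a measure \<Rightarrow> ('a \<Rightarrow> real) \<Rightarrow> real" where
  "Lp_norm p M f =
     (if p = \<infinity> then real_of_ereal (esssup M (\<lambda>x. ereal \<bar>f x\<bar>))
      else (\<integral>x. \<bar>f x\<bar> powr real_of_ereal p \<partial>M) powr (1 / real_of_ereal p))"

definition laplacian :: "('a::euclidean_space \<Rightarrow> real) \<Rightarrow> 'a \<Rightarrow> real" where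
  "laplacian f x = (\<Sum>b\<in>Basis. (deriv ^^ 2) (\<lambda>t. f (x + t *\<^sub>R b)) 0)"

definition solid_harmonics :: "nat \<Rightarrow> ('a::euclidean_space \<Rightarrow> real) set" where
  "solid_harmonics l = {P. real_polynomial_function P \<and>
     (\<forall>t x. P (t *\<^sub>R x) = t ^ l * P x) \<and> (\<forall>x. laplacian P x = 0)}"

definition spherical_harmonics :: "nat \<Rightarrow> ('a::euclidean_space \<Rightarrow> real) set" where
  "spherical_harmonics l = (\<lambda>P. restrict P (sphere 0 1)) ` solid_harmonics l"

text \<open>
  \<open>zonal_kernel l x\<close> is the reproducing kernel of the finite-dimensional space
  \<open>spherical_harmonics l\<close>, with respect to the \<open>L\<^sub>2\<close> inner product, at the point \<open>x\<close> of
  the sphere. It is unique because elements of \<open>spherical_harmonics l\<close> are extensional.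
\<close>

definition zonal_kernel :: "nat \<Rightarrow> 'a::euclidean_space \<Rightarrow> 'a \<Rightarrow> real" where
  "zonal_kernel l x = (THE k. k \<in> spherical_harmonics l \<and>
     (\<forall>h\<in>spherical_harmonics l. (\<integral>y. k y * h y \<partial>sphere_measure) = h x))"

definition harmonic_proj :: "nat \<Rightarrow> ('a::euclidean_space \<Rightarrow> real) \<Rightarrow> 'a \<Rightarrow> real" where
  "harmonic_proj l f x = (\<integral>y. zonal_kernel l x y * f y \<partial>sphere_measure)"

definition lb_eigenvalue :: "nat \<Rightarrow> nat \<Rightarrow> real" where
  "lb_eigenvalue d l = real l * (real l + real d - 1)"

text \<open>\<open>g = (1 - \<Delta>\<^sup>*)\<^sup>s\<^sup>/\<^sup>2 f\<close>, in the sense of spherical harmonic coefficients.\<close>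

definition bessel_image ::
    "real \<Rightarrow> ('a::euclidean_space \<Rightarrow> real) \<Rightarrow> ('a \<Rightarrow> real) \<Rightarrow> bool" where
  "bessel_image s f g \<longleftrightarrow> (\<forall>l. \<forall>x\<in>sphere 0 1.
     harmonic_proj l g x =
       (1 + lb_eigenvalue (DIM('a) - 1) l) powr (s / 2) * harmonic_proj l f x)"

definition sobolev_space :: "real \<Rightarrow> ereal \<Rightarrow> ('a::euclidean_space \<Rightarrow> real) set" where
  "sobolev_space s p = {f \<in> Lp_space p sphere_measure.
     \<exists>g\<in>Lp_space p sphere_measure. bessel_image s f g}"

text \<open>The function \<open>g\<close> chosen here is unique up to null sets.\<close>

definition sobolev_norm :: "real \<Rightarrow> ereal \<Rightarrow> ('a::euclidean_space \<Rightarrow> real) \<Rightarrow> real" where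
  "sobolev_norm s p f = Lp_norm p sphere_measure
     (SOME g. g \<in> Lp_space p sphere_measure \<and> bessel_image s f g)"

definition quadrature :: "'a set \<Rightarrow> ('a \<Rightarrow> real) \<Rightarrow> real" where
  "quadrature X f = (\<Sum>x\<in>X. f x) / real (card X)"

text \<open>
  The identification of Sobolev functions with their continuous representatives is made by
  letting the supremum range over continuous functions on the sphere. The supremum is taken
  in \<open>[0, \<infinity>]\<close>, so that it is meaningful without appeal to the Sobolev embedding theorem.
\<close>

definition wce :: "'a::euclidean_space set \<Rightarrow> real \<Rightarrow> ereal \<Rightarrow> ennreal" where
  "wce X s p =
     (SUP f \<in> {f \<in> sobolev_space s p. continuous_on (sphere 0 1) f \<and> sobolev_norm s p f \<le> 1}.
        ennreal \<bar>quadrature X f - (\<integral>x. f x \<partial>sphere_measure)\<bar>)"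

text \<open>Powers on \<open>[0, \<infinity>]\<close> with a positive real exponent.\<close>

definition ennreal_powr :: "ennreal \<Rightarrow> real \<Rightarrow> ennreal" where
  "ennreal_powr w a = (if w = \<infinity> then \<infinity> else ennreal (enn2real w powr a))"

definition spherical_cap :: "'a::euclidean_space \<Rightarrow> real \<Rightarrow> 'a set" where
  "spherical_cap z r = {y \<in> sphere 0 1. arccos (z \<bullet> y) < r}"

text \<open>
  A packing is given by the centres \<open>z n\<close> and radii \<open>\<rho> n\<close> of its caps; \<open>J\<close> is the index
  set of the finite or infinite sequence, starting at 1.
\<close>

definition ordered_avoiding_packing ::
    "'a::euclidean_space set \<Rightarrow> nat set \<Rightarrow> (nat \<Rightarrow> 'a) \<Rightarrow> (nat \<Rightarrow> real) \<Rightarrow> bool" where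
  "ordered_avoiding_packing X J z \<rho> \<longleftrightarrow>
     (J = {1..} \<or> (\<exists>m. J = {1..m})) \<and>
     (\<forall>n\<in>J. z n \<in> sphere 0 1 \<and> 0 < \<rho> n \<and> \<rho> n \<le> pi) \<and>
     disjoint_family_on (\<lambda>n. spherical_cap (z n) (\<rho> n)) J \<and>
     (\<forall>m\<in>J. \<forall>n\<in>J. m \<le> n \<longrightarrow> \<rho> n \<le> \<rho> m) \<and>
     (\<forall>n\<in>J. spherical_cap (z n) (\<rho> n) \<inter> X = {})"

end

theory Submission
  imports Defs "HOL-Probability.Probability_Measure"
begin

text \<open>
  The quadrature rule is tested on the sum \<open>f\<close> of the zonal bumps
  \<open>(max 0 (x \<bullet> z\<^sub>k - cos \<rho>) / (1 - cos \<rho>))\<^sup>M\<close>, \<open>k \<le> n\<close>, where \<open>\<rho> = \<rho>\<^sub>n\<close> and \<open>z\<^sub>k\<close> are the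
  centres of the first \<open>n\<close> caps. Since \<open>f\<close> vanishes on \<open>X\<close>, the worst-case error is at least
  \<open>I(f) / \<parallel>f\<parallel>\<close>. Write \<open>A = 1 - \<Delta>\<^sup>*\<close>. As \<open>\<Delta>\<^sup>*\<close> maps powers of a bump to combinations of such
  powers and the supports are disjoint, \<open>A\<^sup>j f\<close> is of order \<open>\<rho>\<^sup>-\<^sup>2\<^sup>j\<close> in the supremum norm and of
  order \<open>n \<rho>\<^sup>d\<^sup>-\<^sup>2\<^sup>j\<close> in \<open>L\<^sub>1\<close>. Between consecutive integer powers one interpolates with
  Balakrishnan's formula \<open>A\<^sup>\<alpha> = c \<integral> t\<^sup>\<alpha>\<^sup>-\<^sup>1 A (t + A)\<^sup>-\<^sup>1 dt\<close>, split at \<open>t\<close> of order \<open>\<rho>\<^sup>-\<^sup>2\<close>; the bound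
  \<open>\<parallel>(t + A)\<^sup>-\<^sup>1\<parallel> \<le> 1 / (1 + t)\<close> is the maximum principle in the supremum norm, and follows by
  duality in \<open>L\<^sub>1\<close>. The two endpoint bounds on \<open>A\<^sup>s\<^sup>/\<^sup>2 f\<close> bound its \<open>L\<^sub>p\<close> norms with constants
  independent of \<open>p\<close>, so that the worst-case error is at least a multiple of
  \<open>n\<^sup>1\<^sup>/\<^sup>q \<rho>\<^sup>s\<^sup>+\<^sup>d\<^sup>/\<^sup>q\<close>.
\<close>

subsection \<open>Homogeneous and harmonic polynomials\<close>

text \<open>When \<open>s / 2\<close> is not an integer, the power A^(s/2) is nonlocal and destroys
  the disjointness of the supports. Supports are therefore used only for the integer powers
  \<open>j = nat \<lfloor>s / 2\<rfloor>\<close> and \<open>j + 1\<close>; the remaining exponent is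
  handled by operator norms alone. This is why the resolvent bounds have to hold at both endpoints.
  Splitting Balakrishnan's integral at T bounds A^\<alpha> U by T^\<alpha> |U| + T^(\<alpha>-1) |A
  U|. The bound on A U is larger than that on U by a factor of order \<rho>^-2, so T of this order
  makes both terms equally large. Caps are measured by their height h = 1 - cos \<rho>, of order
  \<rho>^2, because inside its cap a bump is a polynomial in x . z. The first n caps are shrunk to
  the common radius \<rho>_n, so that one profile serves all of them; here the ordering of the radii
  enters. Independence of p has two sources: if |g| is at most \<Lambda> and its integral at most
  \<Lambda> v, then its L_p norm is at most \<Lambda> v^(1/p) with no further constant; and the
  final root 1 / (s + d/q) never exceeds 1/s.\<close>

lemmas rpf_linear = real_polynomial_function.intros(1)
  and rpf_const = real_polynomial_function.intros(2)
  and rpf_add = real_polynomial_function.intros(3)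
  and rpf_mult = real_polynomial_function.intros(4)

text \<open>Written with \<open>deriv\<close> along a line so that iterating it along a basis vector
  gives the second derivative that occurs in \<open>laplacian\<close>.\<close>

definition pd :: "'a \<Rightarrow> ('a::euclidean_space \<Rightarrow> real) \<Rightarrow> 'a \<Rightarrow> real" where
  "pd v f x = deriv (\<lambda>t. f (x + t *\<^sub>R v)) 0"

lemma pd_eqI:
  assumes "(f has_derivative F) (at x)"
  shows "pd v f x = F v"
proof -
  have "((\<lambda>t. x + t *\<^sub>R v) has_derivative (\<lambda>t. t *\<^sub>R v)) (at (0::real))"
    by (auto intro!: derivative_eq_intros)
  then have "((\<lambda>t. f (x + t *\<^sub>R v)) has_derivative (\<lambda>t. F (t *\<^sub>R v))) (at (0::real))"
    using has_derivative_compose[of "\<lambda>t. x + t *\<^sub>R v" _ "0::real" UNIV f F] assms by simp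
  moreover have "F (t *\<^sub>R v) = F v * t" for t
    using linear_cmul[OF has_derivative_linear[OF assms]] by simp
  ultimately have "((\<lambda>t. f (x + t *\<^sub>R v)) has_real_derivative F v) (at 0)"
    by (simp add: has_field_derivative_def)
  then show ?thesis
    unfolding pd_def by (rule DERIV_imp_deriv)
qed

lemma poly_derivatives:
  fixes f :: "'a::euclidean_space \<Rightarrow> real"
  assumes "real_polynomial_function f"
  shows "\<exists>f'. (\<forall>v. real_polynomial_function (f' v)) \<and>
           (\<forall>x. (f has_derivative (\<lambda>v. f' v x)) (at x))"
  using assms
proof induction
  case (linear f)
  then show ?case
    by (intro exI[of _ "\<lambda>v x. f v"]) (auto intro: bounded_linear_imp_has_derivative)
next
  case (const c)
  then show ?case
    by (intro exI[of _ "\<lambda>v x. 0"]) auto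
next
  case (add f g)
  then obtain f' g' where "\<forall>v. real_polynomial_function (f' v)"
      "\<forall>v. real_polynomial_function (g' v)"
    "\<forall>x. (f has_derivative (\<lambda>v. f' v x)) (at x)" "\<forall>x. (g has_derivative (\<lambda>v. g' v x)) (at x)"
    by blast
  then show ?case
    by (intro exI[of _ "\<lambda>v x. f' v x + g' v x"]) (auto intro: has_derivative_add)
next
  case (mult f g)
  then obtain f' g' where "\<forall>v. real_polynomial_function (f' v)"
      "\<forall>v. real_polynomial_function (g' v)"
    "\<forall>x. (f has_derivative (\<lambda>v. f' v x)) (at x)" "\<forall>x. (g has_derivative (\<lambda>v. g' v x)) (at x)"
    by blast
  with mult.hyps show ?case
    by (intro exI[of _ "\<lambda>v x. f x * g' v x + f' v x * g x"])
      (auto intro!: has_derivative_mult rpf_add rpf_mult)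
qed

lemma
  fixes f :: "'a::euclidean_space \<Rightarrow> real"
  assumes "real_polynomial_function f"
  shows poly_has_derivative: "(f has_derivative (\<lambda>v. pd v f x)) (at x)"
    and poly_pd [simp, intro]: "real_polynomial_function (pd v f)"
proof -
  obtain f' where f': "\<And>v. real_polynomial_function (f' v)"
    "\<And>x. (f has_derivative (\<lambda>v. f' v x)) (at x)"
    using poly_derivatives[OF assms] by blast
  have eq: "pd v f = f' v" for v
    using pd_eqI[OF f'(2)] by auto
  show "(f has_derivative (\<lambda>v. pd v f x)) (at x)" "real_polynomial_function (pd v f)"
    using f' by (simp_all add: eq)
qed

lemma poly_continuous:
  fixes f :: "'a::euclidean_space \<Rightarrow> real"
  shows "real_polynomial_function f \<Longrightarrow> continuous_on S f"
  by (intro continuous_at_imp_continuous_on ballI has_derivative_continuous[OF poly_has_derivative])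

lemma poly_inner [simp, intro]: "real_polynomial_function (\<lambda>x::'a::euclidean_space. x \<bullet> u)"
  by (intro rpf_linear bounded_linear_inner_left)

lemma poly_inner_self [simp, intro]: "real_polynomial_function (\<lambda>x::'a::euclidean_space. x \<bullet> x)"
proof -
  have "(\<lambda>x::'a. x \<bullet> x) = (\<lambda>x. \<Sum>b\<in>Basis. (x \<bullet> b) * (x \<bullet> b))"
    using euclidean_inner by blast
  moreover have "real_polynomial_function (\<lambda>x::'a. \<Sum>b\<in>Basis. (x \<bullet> b) * (x \<bullet> b))"
    by (intro real_polynomial_function_sum rpf_mult poly_inner) auto
  ultimately show ?thesis by simp
qed

lemma poly_cmult [simp, intro]:
  "real_polynomial_function f \<Longrightarrow> real_polynomial_function (\<lambda>x. c * f x)"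
  by (intro rpf_mult rpf_const)

lemma pd_const [simp]: "pd v (\<lambda>x. c) x = 0"
  by (rule pd_eqI[where F="\<lambda>_. 0", simplified]) auto

lemma pd_const_fun [simp]: "pd v (\<lambda>x. c) = (\<lambda>x. 0)"
  by (simp add: fun_eq_iff)

lemma pd_inner [simp]: "pd v (\<lambda>x. x \<bullet> u) x = v \<bullet> u"
  by (rule pd_eqI[where F="\<lambda>v. v \<bullet> u"]) (auto intro!: derivative_eq_intros)

lemma pd_inner_self [simp]: "pd v (\<lambda>x. x \<bullet> x) x = 2 * (v \<bullet> x)"
  by (rule pd_eqI[where F="\<lambda>v. 2 * (v \<bullet> x)"])
     (auto intro!: derivative_eq_intros simp: inner_commute)

lemma pd_add:
  assumes "real_polynomial_function f" "real_polynomial_function g"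
  shows "pd v (\<lambda>x. f x + g x) x = pd v f x + pd v g x"
  by (intro pd_eqI[where F="\<lambda>v. pd v f x + pd v g x"] has_derivative_add
      poly_has_derivative assms)

lemma pd_diff:
  assumes "real_polynomial_function f" "real_polynomial_function g"
  shows "pd v (\<lambda>x. f x - g x) x = pd v f x - pd v g x"
  by (intro pd_eqI[where F="\<lambda>v. pd v f x - pd v g x"] has_derivative_diff
      poly_has_derivative assms)

lemma pd_mult:
  assumes "real_polynomial_function f" "real_polynomial_function g"
  shows "pd v (\<lambda>x. f x * g x) x = f x * pd v g x + pd v f x * g x"
  by (intro pd_eqI[where F="\<lambda>v. f x * pd v g x + pd v f x * g x"] has_derivative_mult
      poly_has_derivative assms)

lemma pd_cmult:
  assumes "real_polynomial_function f"
  shows "pd v (\<lambda>x. c * f x) x = c * pd v f x"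
  using pd_mult[of "\<lambda>x. c" f] assms by (simp add: rpf_const)

lemma pd_expand:
  fixes f :: "'a::euclidean_space \<Rightarrow> real"
  assumes "real_polynomial_function f"
  shows "pd v f x = (\<Sum>b\<in>Basis. (v \<bullet> b) * pd b f x)"
proof -
  have lin: "linear (\<lambda>v. pd v f x)"
    using poly_has_derivative[OF assms] by (rule has_derivative_linear)
  have "pd v f x = pd (\<Sum>b\<in>Basis. (v \<bullet> b) *\<^sub>R b) f x"
    by (simp add: euclidean_representation)
  also have "\<dots> = (\<Sum>b\<in>Basis. (v \<bullet> b) * pd b f x)"
    unfolding linear_sum[OF lin] linear_cmul[OF lin] by simp
  finally show ?thesis .
qed

lemma laplacian_eq_pd:
  assumes "real_polynomial_function f"
  shows "laplacian f x = (\<Sum>b\<in>Basis. pd b (pd b f) x)"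
proof -
  have *: "deriv (\<lambda>t. f (x + t *\<^sub>R b)) = (\<lambda>t. pd b f (x + t *\<^sub>R b))" for b
  proof
    fix t
    have "((\<lambda>s. f (x + s *\<^sub>R b)) has_derivative (\<lambda>s. pd (s *\<^sub>R b) f (x + t *\<^sub>R b))) (at t)"
      by (rule has_derivative_compose[of "\<lambda>s. x + s *\<^sub>R b", OF _ poly_has_derivative[OF assms]])
        (auto intro!: derivative_eq_intros)
    moreover have "pd (s *\<^sub>R b) f (x + t *\<^sub>R b) = pd b f (x + t *\<^sub>R b) * s" for s
      using linear_cmul[OF has_derivative_linear[OF poly_has_derivative[OF assms]]] by simp
    ultimately show "deriv (\<lambda>t. f (x + t *\<^sub>R b)) t = pd b f (x + t *\<^sub>R b)"
      by (intro DERIV_imp_deriv) (simp add: has_field_derivative_def)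
  qed
  show ?thesis
    unfolding laplacian_def numeral_2_eq_2 by (simp add: * pd_def[of _ "pd _ f"])
qed

lemma poly_laplacian [intro]:
  assumes "real_polynomial_function f"
  shows "real_polynomial_function (laplacian f)"
proof -
  have "laplacian f = (\<lambda>x. \<Sum>b\<in>Basis. pd b (pd b f) x)"
    using laplacian_eq_pd[OF assms] by blast
  moreover have "real_polynomial_function (\<lambda>x. \<Sum>b\<in>Basis. pd b (pd b f) x)"
    using assms by (intro real_polynomial_function_sum) auto
  ultimately show ?thesis by simp
qed

lemma pd_fun:
  assumes "real_polynomial_function f" "real_polynomial_function g"
  shows "pd v (\<lambda>x. f x + g x) = (\<lambda>x. pd v f x + pd v g x)"
    "pd v (\<lambda>x. c * f x) = (\<lambda>x. c * pd v f x)"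
  using assms by (auto simp: pd_add pd_cmult)

lemma laplacian_add:
  assumes "real_polynomial_function f" "real_polynomial_function g"
  shows "laplacian (\<lambda>x. f x + g x) x = laplacian f x + laplacian g x"
  using assms
  by (simp add: laplacian_eq_pd rpf_add pd_fun pd_add sum.distrib)

lemma laplacian_cmult:
  assumes "real_polynomial_function f"
  shows "laplacian (\<lambda>x. c * f x) x = c * laplacian f x"
  using assms by (simp add: laplacian_eq_pd pd_fun pd_cmult sum_distrib_left)

lemma laplacian_sum:
  assumes "finite I" "\<And>i. i \<in> I \<Longrightarrow> real_polynomial_function (f i)"
  shows "laplacian (\<lambda>x. \<Sum>i\<in>I. f i x) x = (\<Sum>i\<in>I. laplacian (f i) x)"
  using assms
proof (induction I rule: finite_induct)
  case empty
  then show ?case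
    by (simp add: laplacian_eq_pd rpf_const
        pd_const[THEN ext, unfolded fun_eq_iff] pd_def)
next
  case (insert i I)
  have "real_polynomial_function (\<lambda>x. \<Sum>i\<in>I. f i x)"
    using insert by (intro real_polynomial_function_sum) auto
  then show ?case
    using insert by (simp add: laplacian_add)
qed

section \<open>Homogeneous polynomials and their harmonic components\<close>

definition hom_poly :: "nat \<Rightarrow> ('a::euclidean_space \<Rightarrow> real) \<Rightarrow> bool" where
  "hom_poly k P \<longleftrightarrow> real_polynomial_function P \<and> (\<forall>t x. P (t *\<^sub>R x) = t ^ k * P x)"

lemma hom_polyD [simp]: "hom_poly k P \<Longrightarrow> real_polynomial_function P"
  by (simp add: hom_poly_def)

lemma solid_harmonics_iff:
  "P \<in> solid_harmonics l \<longleftrightarrow> hom_poly l P \<and> (\<forall>x. laplacian P x = 0)"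
  by (auto simp: solid_harmonics_def hom_poly_def)

text \<open>Used to cancel a factor \<open>t\<close> in an identity along a ray: division settles
  \<open>t \<noteq> 0\<close>, and continuity supplies the remaining value.\<close>

lemma continuous_zero_at_zero:
  fixes f :: "real \<Rightarrow> real"
  assumes "continuous_on UNIV f" "\<And>t. t \<noteq> 0 \<Longrightarrow> f t = 0"
  shows "f t = 0"
proof (cases "t = 0")
  case True
  have "(f \<longlongrightarrow> f 0) (at 0)"
    using assms(1) by (simp add: continuous_on_eq_continuous_at continuous_at)
  moreover have "(f \<longlongrightarrow> 0) (at 0)"
    by (rule tendsto_eventually) (auto simp: eventually_at_filter assms(2))
  ultimately have "f 0 = 0"
    by (rule LIM_unique)
  with True show ?thesis by simp
qed (use assms in auto)

lemma pd_scale: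
  assumes "hom_poly k P"
  shows "t * pd v P (t *\<^sub>R x) = t ^ k * pd v P x"
proof -
  have P: "real_polynomial_function P" and hom: "P (t *\<^sub>R x) = t ^ k * P x" for t x
    using assms by (auto simp: hom_poly_def)
  have "((\<lambda>x. P (t *\<^sub>R x)) has_derivative (\<lambda>v. pd (t *\<^sub>R v) P (t *\<^sub>R x))) (at x)"
    by (rule has_derivative_compose[of "\<lambda>x. t *\<^sub>R x", OF _ poly_has_derivative[OF P]])
      (auto intro!: derivative_eq_intros)
  from pd_eqI[OF this, of v] have "pd v (\<lambda>x. t ^ k * P x) x = pd (t *\<^sub>R v) P (t *\<^sub>R x)"
    by (simp add: hom)
  moreover have "pd (t *\<^sub>R v) P (t *\<^sub>R x) = t * pd v P (t *\<^sub>R x)"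
    using linear_cmul[OF has_derivative_linear[OF poly_has_derivative[OF P]]] by simp
  ultimately show ?thesis
    by (simp add: pd_cmult P)
qed

lemma poly_continuous_ray:
  fixes P :: "'a::euclidean_space \<Rightarrow> real"
  assumes "real_polynomial_function P"
  shows "continuous_on A (\<lambda>t::real. P (t *\<^sub>R x))"
  by (rule continuous_on_compose2[OF poly_continuous[OF assms, of UNIV]])
     (auto intro!: continuous_intros)

lemma hom_poly_pd:
  assumes "hom_poly (Suc k) P"
  shows "hom_poly k (pd v P)"
proof -
  have "pd v P (t *\<^sub>R x) - t ^ k * pd v P x = 0" for t x
  proof (rule continuous_zero_at_zero[of "\<lambda>t. pd v P (t *\<^sub>R x) - t ^ k * pd v P x"])
    show "continuous_on UNIV (\<lambda>t. pd v P (t *\<^sub>R x) - t ^ k * pd v P x)"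
      using assms by (intro continuous_intros poly_continuous_ray) auto
    show "pd v P (t *\<^sub>R x) - t ^ k * pd v P x = 0" if "t \<noteq> 0" for t
      using pd_scale[OF assms, of t v x] that by simp
  qed
  then show ?thesis
    using assms by (auto simp: hom_poly_def)
qed

lemma euler:
  assumes "hom_poly k P"
  shows "(\<Sum>b\<in>Basis. (x \<bullet> b) * pd b P x) = k * P x"
proof -
  have "((\<lambda>t. P (x + t *\<^sub>R x)) has_real_derivative real k * P x) (at 0)"
  proof -
    have "P (x + t *\<^sub>R x) = (1 + t) ^ k * P x" for t
      using assms unfolding hom_poly_def by (metis scaleR_left_distrib scaleR_one)
    then show ?thesis
      by (auto intro!: derivative_eq_intros)
  qed
  then have "pd x P x = k * P x"
    unfolding pd_def by (rule DERIV_imp_deriv)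
  then show ?thesis
    using pd_expand[of P x x] assms by simp
qed

text \<open>A derivative of \<open>P\<close> is homogeneous of degree one less, so Euler's identity
  applies to it. For \<open>k = 0\<close> the factor is -1, which is harmless because
  \<open>P\<close> is constant and both sides vanish.\<close>

lemma euler2:
  fixes P :: "'a::euclidean_space \<Rightarrow> real"
  assumes "hom_poly k P"
  shows "(\<Sum>b\<in>Basis. (x \<bullet> b) * pd b (pd v P) x) = (real k - 1) * pd v P x"
proof (cases k)
  case 0
  have "P y = P 0" for y
    using assms 0 unfolding hom_poly_def by (metis power_0 mult_1 scaleR_zero_left)
  then have "P = (\<lambda>y. P 0)"
    by blast
  then have "pd v P = (\<lambda>x. 0)" for v
    by (metis pd_const)
  then show ?thesis
    by simp
next
  case (Suc m)
  then show ?thesis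
    using euler[OF hom_poly_pd, of m P x v] assms by simp
qed

lemma hom_poly_laplacian:
  assumes "hom_poly (Suc (Suc k)) P"
  shows "hom_poly k (laplacian P)"
proof -
  have "hom_poly k (pd b (pd b P))" for b
    using assms by (intro hom_poly_pd)
  then show ?thesis
    using assms poly_laplacian[of P] unfolding hom_poly_def
    by (simp add: laplacian_eq_pd sum_distrib_left)
qed

lemma laplacian_hom_le_1:
  assumes "hom_poly k P" "k \<le> 1"
  shows "laplacian P x = 0"
proof -
  have "pd v (pd b P) = (\<lambda>x. 0)" for v b
  proof (cases k)
    case 0
    have "P y = P 0" for y
      using assms 0 unfolding hom_poly_def by (metis power_0 mult_1 scaleR_zero_left)
    then have "P = (\<lambda>y. P 0)"
      by blast
    then have "pd v P = (\<lambda>x. 0)" for v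
      by (metis pd_const)
    then show ?thesis by simp
  next
    case (Suc m)
    then have "hom_poly 0 (pd b P)"
      using assms by (intro hom_poly_pd) auto
    then have "pd b P y = pd b P 0" for y
      unfolding hom_poly_def by (metis power_0 mult_1 scaleR_zero_left)
    then have "pd b P = (\<lambda>y. pd b P 0)"
      by blast
    then show ?thesis
      by (metis pd_const)
  qed
  then show ?thesis
    using assms(1) by (simp add: laplacian_eq_pd)
qed

text \<open>The product rule leaves the cross term 4 (x . grad P), which Euler's identity turns into
  \<open>4 * k * P\<close>.\<close>

lemma laplacian_norm2_mult:
  fixes P :: "'a::euclidean_space \<Rightarrow> real"
  assumes "hom_poly k P"
  shows "laplacian (\<lambda>x. (x \<bullet> x) * P x) x =
    (x \<bullet> x) * laplacian P x + (4 * k + 2 * DIM('a)) * P x"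
proof -
  have P [simp]: "real_polynomial_function P"
    using assms by simp
  have 1: "pd b (\<lambda>x. (x \<bullet> x) * P x) = (\<lambda>x. (x \<bullet> x) * pd b P x + 2 * ((x \<bullet> b) * P x))" for b
    by (simp add: fun_eq_iff pd_mult inner_commute mult_ac)
  have 2: "pd b (\<lambda>x. (x \<bullet> x) * pd b P x + 2 * ((x \<bullet> b) * P x)) x =
     (x \<bullet> x) * pd b (pd b P) x + 4 * ((x \<bullet> b) * pd b P x) + 2 * P x" if "b \<in> Basis" for b x
  proof -
    have "pd b (\<lambda>x. (x \<bullet> x) * pd b P x) x = (x \<bullet> x) * pd b (pd b P) x + 2 * (x \<bullet> b) * pd b P x"
      by (simp add: pd_mult inner_commute)
    moreover have "pd b (\<lambda>x. (x \<bullet> b) * P x) x = (x \<bullet> b) * pd b P x + P x"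
      using that by (simp add: pd_mult)
    ultimately show ?thesis
      by (simp add: pd_add pd_cmult rpf_mult)
  qed
  have "laplacian (\<lambda>x. (x \<bullet> x) * P x) x =
     (x \<bullet> x) * laplacian P x + 4 * (\<Sum>b\<in>Basis. (x \<bullet> b) * pd b P x) + 2 * DIM('a) * P x"
    by (simp add: laplacian_eq_pd rpf_mult 1 2 sum.distrib sum_distrib_left)
  then show ?thesis
    using euler[OF assms] by (simp add: algebra_simps)
qed

lemma hom_poly_norm2_mult:
  assumes "hom_poly k P"
  shows "hom_poly (k + 2 * i) (\<lambda>x. (x \<bullet> x) ^ i * P x)"
  using assms unfolding hom_poly_def
  by (auto simp: power_add power_mult power2_eq_square power_mult_distrib
      intro!: rpf_mult real_polynomial_function_power)

text \<open>Each further factor \<open>x \<bullet> x\<close> adds a nonnegative number to the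
  constant. Positivity of \<open>c\<close> permits the division by which the decomposition below
  inverts the Laplacian term by term.\<close>

lemma laplacian_norm_power_mult:
  fixes G :: "'a::euclidean_space \<Rightarrow> real"
  assumes "G \<in> solid_harmonics l"
  shows "\<exists>c>0. \<forall>x. laplacian (\<lambda>x. (x \<bullet> x) ^ Suc i * G x) x = c * ((x \<bullet> x) ^ i * G x)"
proof (induction i)
  case 0
  show ?case
    using assms laplacian_norm2_mult[of l G]
    by (intro exI[of _ "4 * real l + 2 * DIM('a)"]) (auto
        simp: solid_harmonics_iff DIM_positive add_nonneg_pos)
next
  case (Suc i)
  then obtain c where c: "c > 0"
    "\<And>x. laplacian (\<lambda>x. (x \<bullet> x) ^ Suc i * G x) x = c * ((x \<bullet> x) ^ i * G x)"
    by blast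
  have "hom_poly (l + 2 * Suc i) (\<lambda>x. (x \<bullet> x) ^ Suc i * G x)"
    using assms by (intro hom_poly_norm2_mult) (auto simp: solid_harmonics_iff)
  from laplacian_norm2_mult[OF this] c
  show ?case
    by (intro exI[of _ "c + (4 * real (l + 2 * Suc i) + 2 * DIM('a))"])
       (auto simp: mult_ac algebra_simps intro!: add_pos_nonneg)
qed

lemma hom_poly_add: "hom_poly k f \<Longrightarrow> hom_poly k g \<Longrightarrow> hom_poly k (\<lambda>x. f x + g x)"
  by (auto simp: hom_poly_def algebra_simps)

lemma hom_poly_cmult: "hom_poly k f \<Longrightarrow> hom_poly k (\<lambda>x. c * f x)"
  by (auto simp: hom_poly_def)

lemma hom_poly_sum:
  "finite I \<Longrightarrow> (\<And>i. i \<in> I \<Longrightarrow> hom_poly k (f i)) \<Longrightarrow> hom_poly k (\<lambda>x. \<Sum>i\<in>I. f i x)"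
  by (auto simp: hom_poly_def sum_distrib_left intro!: real_polynomial_function_sum)

lemma solid_harmonics_add:
  "f \<in> solid_harmonics l \<Longrightarrow> g \<in> solid_harmonics l \<Longrightarrow> (\<lambda>x. f x + g x) \<in> solid_harmonics l"
  by (auto simp: solid_harmonics_iff hom_poly_add laplacian_add)

lemma solid_harmonics_cmult:
  "f \<in> solid_harmonics l \<Longrightarrow> (\<lambda>x. c * f x) \<in> solid_harmonics l"
  by (auto simp: solid_harmonics_iff hom_poly_cmult laplacian_cmult)

lemma solid_harmonics_0: "(\<lambda>x. 0) \<in> solid_harmonics l"
  by (auto simp: solid_harmonics_iff hom_poly_def rpf_const laplacian_eq_pd
      pd_def)

lemma solid_harmonics_sum:
  "finite I \<Longrightarrow> (\<And>i. i \<in> I \<Longrightarrow> f i \<in> solid_harmonics l) \<Longrightarrow>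
   (\<lambda>x. \<Sum>i\<in>I. f i x) \<in> solid_harmonics l"
  unfolding solid_harmonics_iff
  by (subst laplacian_sum) (auto intro: hom_poly_sum dest: hom_polyD)

text \<open>
  Subtract from \<open>P\<close> a multiple of each term \<open>|x|\<^sup>2\<^sup>j\<^sup>+\<^sup>2 G\<^sub>j\<close> where \<open>\<Sum> |x|\<^sup>2\<^sup>j G\<^sub>j\<close> is the
  decomposition of \<open>\<Delta>P\<close>.
\<close>

lemma harmonic_decomposition:
  fixes P :: "'a::euclidean_space \<Rightarrow> real"
  assumes "hom_poly k P"
  shows "\<exists>G. (\<forall>j\<le>k div 2. G j \<in> solid_harmonics (k - 2 * j)) \<and>
             (\<forall>x. P x = (\<Sum>j\<le>k div 2. (x \<bullet> x) ^ j * G j x))"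
  using assms
proof (induction k arbitrary: P rule: less_induct)
  case (less k)
  show ?case
  proof (cases "k \<le> 1")
    case True
    then have "P \<in> solid_harmonics k" "k div 2 = 0"
      using less.prems laplacian_hom_le_1 by (auto simp: solid_harmonics_iff)
    then show ?thesis
      by (intro exI[of _ "\<lambda>_. P"]) auto
  next
    case False
    then obtain m where k: "k = Suc (Suc m)"
      using that[of "k - 2"] by simp
    obtain G where G: "\<And>j. j \<le> m div 2 \<Longrightarrow> G j \<in> solid_harmonics (m - 2 * j)"
      "\<And>x. laplacian P x = (\<Sum>j\<le>m div 2. (x \<bullet> x) ^ j * G j x)"
      using less.IH[of m "laplacian P"] hom_poly_laplacian[of m P] less.prems k by force
    have "\<forall>j. \<exists>c. j \<le> m div 2 \<longrightarrow> c > 0 \<and> (\<forall>x. laplacian (\<lambda>x. (x \<bullet> x) ^ Suc j * G j x) x =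
        c * ((x \<bullet> x) ^ j * G j x))"
      using laplacian_norm_power_mult[OF G(1)] by blast
    then obtain c where c: "\<And>j. j \<le> m div 2 \<Longrightarrow> c j > 0"
      "\<And>j x. j \<le> m div 2 \<Longrightarrow>
        laplacian (\<lambda>x. (x \<bullet> x) ^ Suc j * G j x) x = c j * ((x \<bullet> x) ^ j * G j x)"
      unfolding choice_iff by blast
    define T where "T j = (\<lambda>x. (- 1 / c j) * ((x \<bullet> x) ^ Suc j * G j x))" for j
    have homT: "hom_poly k (T j)" if "j \<le> m div 2" for j
    proof -
      have "hom_poly (m - 2 * j + 2 * Suc j) (\<lambda>x. (x \<bullet> x) ^ Suc j * G j x)"
        using G(1)[OF that] by (intro hom_poly_norm2_mult) (simp add: solid_harmonics_iff)
      moreover have "m - 2 * j + 2 * Suc j = k"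
        using that k by auto
      ultimately show ?thesis
        unfolding T_def by (intro hom_poly_cmult) simp
    qed
    have polyG: "real_polynomial_function (\<lambda>x. (x \<bullet> x) ^ Suc j * G j x)"
      if "j \<le> m div 2" for j
      using G(1)[OF that]
      by (intro rpf_mult[OF real_polynomial_function_power[OF poly_inner_self]])
        (auto simp: solid_harmonics_iff dest: hom_polyD)
    define H where "H = (\<lambda>x. P x + (\<Sum>j\<le>m div 2. T j x))"
    have "hom_poly k H"
      unfolding H_def using homT less.prems by (intro hom_poly_add hom_poly_sum) auto
    moreover have "laplacian H x = 0" for x
    proof -
      have "laplacian (T j) x = - ((x \<bullet> x) ^ j * G j x)" if "j \<le> m div 2" for j
        unfolding T_def laplacian_cmult[OF polyG[OF that]] using c[OF that] by simp
      moreover have "laplacian H x = laplacian P x + (\<Sum>j\<le>m div 2. laplacian (T j) x)"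
      proof -
        have "real_polynomial_function (T j)" if "j \<le> m div 2" for j
          using homT[OF that] by simp
        then show ?thesis
          unfolding H_def using less.prems laplacian_sum[of "{..m div 2}" T x]
          by (subst laplacian_add) (auto intro!: real_polynomial_function_sum)
      qed
      ultimately show ?thesis
        by (simp add: G(2) sum_negf)
    qed
    ultimately have H: "H \<in> solid_harmonics k"
      by (simp add: solid_harmonics_iff)
    \<comment> \<open>Component \<open>i\<close> of the Laplacian yields component
      \<open>i + 1\<close> of \<open>P\<close>, divided by the factor that the Laplacian produces;
      index 0 is the harmonic remainder.\<close>
    define G' where "G' j = (case j of 0 \<Rightarrow> H | Suc i \<Rightarrow> (\<lambda>x. (1 / c i) * G i x))" for j
    have kd: "k div 2 = Suc (m div 2)"
      using k by simp
    have "G' j \<in> solid_harmonics (k - 2 * j)" if "j \<le> k div 2" for j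
    proof (cases j)
      case 0
      then show ?thesis using H by (simp add: G'_def)
    next
      case (Suc i)
      then have "i \<le> m div 2"
        using that kd by simp
      from solid_harmonics_cmult[OF G(1)[OF this], of "1 / c i"]
      show ?thesis
        using Suc k by (simp add: G'_def)
    qed
    moreover have "P x = (\<Sum>j\<le>k div 2. (x \<bullet> x) ^ j * G' j x)" for x
      unfolding kd sum.atMost_Suc_shift
      by (simp add: G'_def H_def T_def sum_negf divide_inverse mult_ac)
    ultimately show ?thesis
      by blast
  qed
qed

text \<open>Inductive rather than an indexed sum: closure under products becomes a double induction,
  without any bookkeeping of degrees.\<close>

inductive hom_sum :: "('a::euclidean_space \<Rightarrow> real) \<Rightarrow> bool" where
  hom: "hom_poly k f \<Longrightarrow> hom_sum f"
| add: "hom_sum f \<Longrightarrow> hom_sum g \<Longrightarrow> hom_sum (\<lambda>x. f x + g x)"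

lemma hom_sum_mult:
  assumes "hom_sum f" "hom_sum g"
  shows "hom_sum (\<lambda>x. f x * g x)"
  using assms
proof (induction arbitrary: g)
  case (hom k f)
  show ?case
    using hom(2,1)
  proof (induction)
    case (hom m g)
    then have "hom_poly (k + m) (\<lambda>x. f x * g x)"
      by (auto simp: hom_poly_def power_add)
    then show ?case
      by (rule hom_sum.hom)
  next
    case (add g h)
    then show ?case
      using hom_sum.add[of "\<lambda>x. f x * g x" "\<lambda>x. f x * h x"] by (simp add: distrib_left)
  qed
next
  case (add f h)
  then show ?case
    using hom_sum.add[of "\<lambda>x. f x * g x" "\<lambda>x. h x * g x"] by (simp add: distrib_right)
qed

lemma poly_hom_sum:
  assumes "real_polynomial_function p"
  shows "hom_sum p"
  using assms
proof induction
  case (linear f)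
  then have "hom_poly 1 f"
    by (auto simp: hom_poly_def linear_simps rpf_linear)
  then show ?case
    by (rule hom)
next
  case (const c)
  have "hom_poly 0 (\<lambda>x. c)"
    by (auto simp: hom_poly_def)
  then show ?case
    by (rule hom)
next
  case (add f g)
  then show ?case
    by (intro hom_sum.add)
next
  case (mult f g)
  then show ?case
    by (intro hom_sum_mult)
qed

text \<open>Terms beyond \<open>L\<close> must vanish so that two sequences of different lengths can
  be added after passing to the larger one.\<close>

definition harmonic_seq :: "nat \<Rightarrow> (nat \<Rightarrow> 'a::euclidean_space \<Rightarrow> real) \<Rightarrow> bool" where
  "harmonic_seq L h \<longleftrightarrow> (\<forall>l. h l \<in> solid_harmonics l) \<and> (\<forall>l>L. h l = (\<lambda>x. 0))"

lemma harmonic_seq_single: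
  assumes "f \<in> solid_harmonics l"
  shows "harmonic_seq l (\<lambda>k. if k = l then f else (\<lambda>x. 0))"
    "(\<Sum>k\<le>l. (if k = l then f else (\<lambda>x. 0)) x) = f x"
  using assms
  by (auto simp: harmonic_seq_def solid_harmonics_0 if_distrib[of "\<lambda>f. f x"] cong: if_cong)

lemma harmonic_seq_add:
  assumes "harmonic_seq L g" "harmonic_seq M h"
  shows "harmonic_seq (max L M) (\<lambda>l x. g l x + h l x)"
    "(\<Sum>l\<le>max L M. g l x + h l x) = (\<Sum>l\<le>L. g l x) + (\<Sum>l\<le>M. h l x)"
proof -
  show "harmonic_seq (max L M) (\<lambda>l x. g l x + h l x)"
    using assms by (auto simp: harmonic_seq_def solid_harmonics_add)
  have "(\<Sum>l\<le>max L M. g l x) = (\<Sum>l\<le>L. g l x)"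
    using assms by (intro sum.mono_neutral_right) (auto simp: harmonic_seq_def)
  moreover have "(\<Sum>l\<le>max L M. h l x) = (\<Sum>l\<le>M. h l x)"
    using assms by (intro sum.mono_neutral_right) (auto simp: harmonic_seq_def)
  ultimately show "(\<Sum>l\<le>max L M. g l x + h l x) = (\<Sum>l\<le>L. g l x) + (\<Sum>l\<le>M. h l x)"
    by (simp add: sum.distrib)
qed

text \<open>On the unit sphere the factors \<open>(x \<bullet> x) ^ j\<close> of the harmonic
  decomposition equal 1, so only harmonics remain. The equality is confined to the sphere for this
  reason.\<close>

lemma poly_eq_harmonic_sum:
  fixes p :: "'a::euclidean_space \<Rightarrow> real"
  assumes "real_polynomial_function p"
  obtains L h where "harmonic_seq L h" "\<And>x. x \<in> sphere 0 1 \<Longrightarrow> p x = (\<Sum>l\<le>L. h l x)"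
proof -
  \<comment> \<open>The degrees \<open>m i\<close> come in arbitrary order and may repeat, so the
    components are merged one at a time.\<close>
  have fin: "\<exists>L h. harmonic_seq L h \<and> (\<forall>x. (\<Sum>i\<in>I. f i x) = (\<Sum>l\<le>L. h l x))"
    if "finite I" "\<And>i. i \<in> I \<Longrightarrow> f i \<in> solid_harmonics (m i)"
    for I :: "nat set" and f :: "nat \<Rightarrow> 'a \<Rightarrow> real" and m
    using that
  proof (induction I rule: finite_induct)
    case empty
    then show ?case
      by (intro exI[of _ 0] exI[of _ "\<lambda>l x. 0"]) (auto simp: harmonic_seq_def solid_harmonics_0)
  next
    case (insert i I)
    then obtain L h where h: "harmonic_seq L h" "\<And>x. (\<Sum>i\<in>I. f i x) = (\<Sum>l\<le>L. h l x)"
      by auto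
    have fi: "f i \<in> solid_harmonics (m i)"
      using insert.prems by simp
    note * = harmonic_seq_add[OF harmonic_seq_single(1)[OF fi] h(1)]
    have "(\<Sum>j\<in>insert i I. f j x) =
        (\<Sum>l\<le>max (m i) L. (if l = m i then f i else (\<lambda>x. 0)) x + h l x)" for x
      unfolding *(2) harmonic_seq_single(2)[OF fi] using insert.hyps h(2) by simp
    with *(1) show ?case
      by blast
  qed
  from poly_hom_sum[OF assms]
  have "\<exists>L h. harmonic_seq L h \<and> (\<forall>x\<in>sphere 0 1. p x = (\<Sum>l\<le>L. h l x))"
  proof induction
    case (hom k f)
    obtain G where G: "\<And>j. j \<le> k div 2 \<Longrightarrow> G j \<in> solid_harmonics (k - 2 * j)"
      "\<And>x. f x = (\<Sum>j\<le>k div 2. (x \<bullet> x) ^ j * G j x)"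
      using harmonic_decomposition[OF hom] by blast
    have "f x = (\<Sum>j\<le>k div 2. G j x)" if "x \<in> sphere 0 1" for x
      using that by (simp add: G(2) dot_square_norm)
    moreover obtain L h where "harmonic_seq L h"
      "\<And>x. (\<Sum>j\<le>k div 2. G j x) = (\<Sum>l\<le>L. h l x)"
      using fin[of "{..k div 2}" G "\<lambda>j. k - 2 * j"] G(1) by auto
    ultimately show ?case
      by (intro exI[of _ L] exI[of _ h]) simp
  next
    case (add f g)
    then obtain L h M k where "harmonic_seq L h" "harmonic_seq M k"
      "\<And>x. x \<in> sphere 0 1 \<Longrightarrow> f x = (\<Sum>l\<le>L. h l x)" "\<And>x. x \<in> sphere 0 1 \<Longrightarrow> g x = (\<Sum>l\<le>M. k l x)"
      by blast
    then show ?case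
      using harmonic_seq_add[of L h M k]
      by (intro exI[of _ "max L M"] exI[of _ "\<lambda>l x. h l x + k l x"]) auto
  qed
  then show thesis
    using that by blast
qed

section \<open>Linear spans of functions and finite dimension\<close>

inductive_set fspan :: "('a \<Rightarrow> real) set \<Rightarrow> ('a \<Rightarrow> real) set" for B where
  zero: "(\<lambda>x. 0) \<in> fspan B"
| step: "f \<in> fspan B \<Longrightarrow> m \<in> B \<Longrightarrow> (\<lambda>x. f x + c * m x) \<in> fspan B"

lemma fspan_add: "g \<in> fspan B \<Longrightarrow> f \<in> fspan B \<Longrightarrow> (\<lambda>x. f x + g x) \<in> fspan B"
proof (induction g rule: fspan.induct)
  case (step g m c)
  then show ?case
    using fspan.step[of "\<lambda>x. f x + g x" B m c] by (simp add: add.assoc)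
qed auto

lemma fspan_cmult: "f \<in> fspan B \<Longrightarrow> (\<lambda>x. c * f x) \<in> fspan B"
proof (induction f rule: fspan.induct)
  case (step g m a)
  then show ?case
    using fspan.step[of "\<lambda>x. c * g x" B m "c * a"] by (simp add: algebra_simps)
qed (auto intro: fspan.zero)

lemma fspan_sum: "finite I \<Longrightarrow> (\<And>i. i \<in> I \<Longrightarrow> f i \<in> fspan B) \<Longrightarrow> (\<lambda>x. \<Sum>i\<in>I. f i x) \<in> fspan B"
  by (induction I rule: finite_induct) (auto intro: fspan.zero fspan_add)

text \<open>Splits off the coordinate along \<open>m\<close>; the induction in the Gram-Schmidt
  argument removes one spanning function at a time in this way.\<close>

lemma fspan_insert:
  assumes "f \<in> fspan (insert m B)"
  shows "\<exists>c. (\<lambda>x. f x - c * m x) \<in> fspan B"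
  using assms
proof induction
  case zero
  then show ?case
    using fspan.zero by (intro exI[of _ 0]) simp
next
  case (step f m' a)
  then obtain c where c: "(\<lambda>x. f x - c * m x) \<in> fspan B"
    by blast
  show ?case
  proof (cases "m' = m")
    case True
    then show ?thesis
      using c by (intro exI[of _ "c + a"]) (simp add: algebra_simps)
  next
    case False
    then have "(\<lambda>x. (f x - c * m x) + a * m' x) \<in> fspan B"
      using step c by (intro fspan.step) auto
    then show ?thesis
      by (intro exI[of _ c]) (simp add: algebra_simps)
  qed
qed

text \<open>By Euler's identity a polynomial of degree \<open>l + 1\<close> is a combination of
  coordinates times its partial derivatives, so the products of coordinates with a spanning set of
  degree \<open>l\<close> suffice.\<close>

lemma hom_poly_finite_span: "\<exists>B. finite B \<and> {P. hom_poly l P} \<subseteq> fspan B"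
proof (induction l)
  case 0
  have "P \<in> fspan {\<lambda>x. 1}" if "hom_poly 0 P" for P :: "'a \<Rightarrow> real"
  proof -
    have "P y = P 0" for y
      using that unfolding hom_poly_def by (metis power_0 mult_1 scaleR_zero_left)
    then have "P = (\<lambda>y. 0 + P 0 * 1)"
      by auto
    also have "\<dots> \<in> fspan {\<lambda>x. 1}"
      using fspan.step[OF fspan.zero, of "\<lambda>x. 1" "{\<lambda>x. 1}" "P 0"] by simp
    finally show ?thesis .
  qed
  then show ?case
    by (intro exI[of _ "{\<lambda>x. 1}"]) auto
next
  case (Suc l)
  then obtain B :: "('a \<Rightarrow> real) set" where B: "finite B" "{P. hom_poly l P} \<subseteq> fspan B"
    by blast
  define B' where "B' = (\<Union>b\<in>Basis. (\<lambda>m x. (x \<bullet> b) * m x) ` B)"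
  have *: "(\<lambda>x. (x \<bullet> b) * f x) \<in> fspan B'" if "b \<in> Basis" "f \<in> fspan B" for b f
    using that(2)
  proof induction
    case zero
    then show ?case by (simp add: fspan.zero)
  next
    case (step f m c)
    have "(\<lambda>x. (x \<bullet> b) * f x + c * ((x \<bullet> b) * m x)) \<in> fspan B'"
      using that(1) step by (intro fspan.step) (auto simp: B'_def)
    then show ?case
      by (simp add: algebra_simps)
  qed
  have "P \<in> fspan B'" if P: "hom_poly (Suc l) P" for P
  proof -
    have "P = (\<lambda>x. (1 / real (Suc l)) * (\<Sum>b\<in>Basis. (x \<bullet> b) * pd b P x))"
      by (simp add: euler[OF P] fun_eq_iff)
    also have "\<dots> \<in> fspan B'"
      using hom_poly_pd[OF P] B(2) by (intro fspan_cmult fspan_sum *) auto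
    finally show ?thesis .
  qed
  then show ?case
    using B(1) by (intro exI[of _ B']) (auto simp: B'_def)
qed

subsection \<open>The surface measure\<close>

lemma ball_volume_pos: "0 < emeasure lborel (ball (0::'a::euclidean_space) 1)"
  using content_ball_pos[of 1 "0::'a"] by (simp add: measure_def enn2real_positive_iff)

lemma ball_volume_finite: "emeasure lborel (ball (0::'a::euclidean_space) 1) < \<infinity>"
  using emeasure_lborel_ball_finite[of 0 1] by simp

text \<open>
  A translation invariant measure is a multiple of \<^const>\<open>lborel\<close>, by Fubini; comparing
  the unit balls shows that the multiple is 1 for the image under an orthogonal map.
\<close>

lemma lborel_distr_orthogonal:
  fixes T :: "'a::euclidean_space \<Rightarrow> 'a"
  assumes T: "orthogonal_transformation T"
  shows "distr lborel borel T = lborel"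
proof -
  define M where "M = distr lborel borel T"
  have lin: "linear T"
    using T by (rule orthogonal_transformation_linear)
  have cont: "continuous_on UNIV T"
    using lin by (simp add: linear_continuous_on linear_linear)
  then have [measurable]: "T \<in> borel_measurable borel"
    by (rule borel_measurable_continuous_onI)
  have [measurable_cong, simp]: "sets M = sets borel"
    by (simp add: M_def)
  have [simp]: "space M = UNIV"
    by (simp add: M_def)
  have ball: "emeasure M (ball 0 1) = emeasure lborel (ball (0::'a) 1)"
    unfolding M_def using orthogonal_transformation_norm[OF T]
    by (subst emeasure_distr) (auto simp: vimage_def ball_def)
  have inv: "distr M borel ((+) c) = M" for c
  proof -
    obtain c' where c': "T c' = c"
      using orthogonal_transformation_surj[OF T] by (metis surjD)
    have "distr M borel ((+) c) = distr lborel borel (\<lambda>x. c + T x)"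
      unfolding M_def by (subst distr_distr) (auto simp: o_def)
    also have "\<dots> = distr (distr lborel borel ((+) c')) borel T"
      by (subst distr_distr) (auto simp: o_def linear_add[OF lin] c')
    finally show ?thesis
      unfolding lborel_distr_plus M_def .
  qed
  have fin: "emeasure M (ball 0 r) < \<infinity>" for r
  proof -
    have "T -` ball 0 r = ball 0 r"
      using orthogonal_transformation_norm[OF T] by auto
    then show ?thesis
      unfolding M_def using emeasure_lborel_ball_finite[of 0 r] by (subst emeasure_distr) auto
  qed
  interpret M: sigma_finite_measure M
  proof
    show "\<exists>A. countable A \<and> A \<subseteq> sets M \<and> \<Union> A = space M \<and> (\<forall>a\<in>A. emeasure M a \<noteq> \<infinity>)"
    proof (intro exI[of _ "range (\<lambda>n::nat. ball 0 (real n))"] conjI ballI)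
      have "\<exists>n::nat. norm x < real n" for x :: 'a
        by (rule reals_Archimedean2)
      then show "\<Union> (range (\<lambda>n. ball 0 (real n))) = space M"
        by auto
      show "emeasure M a \<noteq> \<infinity>" if "a \<in> range (\<lambda>n::nat. ball 0 (real n))" for a
        using that fin by (auto simp: less_top)
    qed auto
  qed
  interpret pair_sigma_finite M "lborel :: 'a measure" ..
  define B where "B = ball (0::'a) 1"
  have [measurable]: "B \<in> sets borel"
    by (simp add: B_def)
  have "emeasure M A = emeasure lborel A" if [measurable]: "A \<in> sets borel" for A
  proof -
    \<comment> \<open>The double integral of \<open>f\<close> is computed after two substitutions:
      \<open>x\<close> is shifted by \<open>y\<close> using invariance of \<open>M\<close>, then
      \<open>y\<close> by \<open>- x\<close> using invariance of Lebesgue measure. The outcome has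
      the two measures interchanged.\<close>
    define f where "f x y = (indicator A x * indicator B y :: ennreal)" for x y
    have "emeasure M A * emeasure lborel B = (\<integral>\<^sup>+ y. (\<integral>\<^sup>+ x. f x y \<partial>M) \<partial>lborel)"
      by (simp add: f_def nn_integral_multc nn_integral_cmult)
    also have "\<dots> = (\<integral>\<^sup>+ y. (\<integral>\<^sup>+ x. f (y + x) y \<partial>M) \<partial>lborel)"
    proof (rule nn_integral_cong)
      fix y
      have "(\<integral>\<^sup>+ x. f x y \<partial>M) = (\<integral>\<^sup>+ x. f x y \<partial>distr M borel ((+) y))"
        by (simp add: inv)
      also have "\<dots> = (\<integral>\<^sup>+ x. f (y + x) y \<partial>M)"
        unfolding f_def by (subst nn_integral_distr) auto
      finally show "(\<integral>\<^sup>+ x. f x y \<partial>M) = (\<integral>\<^sup>+ x. f (y + x) y \<partial>M)" .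
    qed
    also have "\<dots> = (\<integral>\<^sup>+ x. (\<integral>\<^sup>+ y. f (y + x) y \<partial>lborel) \<partial>M)"
      unfolding f_def by (intro Fubini') measurable
    also have "\<dots> = (\<integral>\<^sup>+ x. (\<integral>\<^sup>+ y. f y (y - x) \<partial>lborel) \<partial>M)"
    proof (rule nn_integral_cong)
      fix x
      have "(\<integral>\<^sup>+ y. f y (y - x) \<partial>lborel) = (\<integral>\<^sup>+ y. f y (y - x) \<partial>distr lborel borel ((+) x))"
        by (simp add: lborel_distr_plus)
      also have "\<dots> = (\<integral>\<^sup>+ y. f (y + x) y \<partial>lborel)"
        unfolding f_def by (subst nn_integral_distr) (auto simp: add.commute)
      finally show "(\<integral>\<^sup>+ y. f (y + x) y \<partial>lborel) = (\<integral>\<^sup>+ y. f y (y - x) \<partial>lborel)" ..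
    qed
    also have "\<dots> = (\<integral>\<^sup>+ y. (\<integral>\<^sup>+ x. f y (y - x) \<partial>M) \<partial>lborel)"
      unfolding f_def by (intro Fubini'[symmetric]) measurable
    also have "\<dots> = (\<integral>\<^sup>+ y. indicator A y * emeasure M B \<partial>lborel)"
    proof (rule nn_integral_cong)
      fix y
      have "(\<integral>\<^sup>+ x. f y (y - x) \<partial>M) = indicator A y * (\<integral>\<^sup>+ x. indicator B (y - x) \<partial>M)"
        by (simp add: f_def nn_integral_cmult)
      \<comment> \<open>Shifting \<open>x\<close> by \<open>y\<close> turns \<open>y - x\<close>
        into \<open>- x\<close>, and the ball \<open>B\<close> is symmetric about the
        origin.\<close>
      also have "(\<integral>\<^sup>+ x. indicator B (y - x) \<partial>M) = (\<integral>\<^sup>+ x. indicator B (y -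
          x) \<partial>distr M borel ((+) y))"
        by (simp add: inv)
      also have "\<dots> = (\<integral>\<^sup>+ x. indicator B x \<partial>M)"
        by (subst nn_integral_distr)
          (auto simp: B_def indicator_def of_bool_def intro!: nn_integral_cong
              simp del: nn_integral_indicator)
      also have "\<dots> = emeasure M B"
        by simp
      finally show "(\<integral>\<^sup>+ x. f y (y - x) \<partial>M) = indicator A y * emeasure M B"
        by simp
    qed
    also have "\<dots> = emeasure lborel A * emeasure lborel B"
      by (simp add: nn_integral_multc ball B_def)
    finally have "emeasure M A * emeasure lborel B = emeasure lborel A * emeasure lborel B" .
    moreover have "emeasure lborel B \<noteq> 0" "emeasure lborel B \<noteq> \<infinity>"
      using ball_volume_pos[where ?'a='a] ball_volume_finite[where ?'a='a]
      by (auto simp: B_def)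
    ultimately show ?thesis
      by (metis mult_divide_eq_ennreal infinity_ennreal_def)
  qed
  then show ?thesis
    unfolding M_def[symmetric] by (intro measure_eqI) auto
qed

lemma borel_measurable_orthogonal [measurable_dest]:
  fixes T :: "'a::euclidean_space \<Rightarrow> 'a"
  shows "orthogonal_transformation T \<Longrightarrow> T \<in> borel_measurable borel"
  by (intro borel_measurable_continuous_onI linear_continuous_on)
     (simp add: linear_linear orthogonal_transformation_linear)

lemma space_sphere_measure [simp]: "space sphere_measure = sphere 0 1"
  by (simp add: sphere_measure_def space_restrict_space)

lemma sets_sphere_measure [measurable_cong]:
  "sets (sphere_measure :: 'a::euclidean_space measure) = sets (restrict_space borel (sphere 0 1))"
  unfolding sphere_measure_def by (intro sets_restrict_space_cong) simp

lemma sets_sphere_measure_iff: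
  "A \<in> sets sphere_measure \<longleftrightarrow> A \<subseteq> sphere 0 1 \<and> A \<in> sets borel"
  by (simp add: sets_sphere_measure sets_restrict_space_iff)

lemma emeasure_sphere_measure:
  assumes "A \<in> sets (sphere_measure :: 'a::euclidean_space measure)"
  shows "emeasure sphere_measure A =
    emeasure lborel {y \<in> ball 0 1. sgn y \<in> A} / emeasure lborel (ball (0::'a) 1)"
proof -
  have A: "A \<subseteq> sphere 0 1" "A \<in> sets borel"
    using assms by (auto simp: sets_sphere_measure_iff)
  have "emeasure sphere_measure A = emeasure (uniform_measure lborel (ball (0::'a) 1)) (sgn -` A)"
    unfolding sphere_measure_def using A
    by (subst emeasure_restrict_space) (auto simp: emeasure_distr)
  also have "\<dots> = emeasure lborel (ball 0 1 \<inter> sgn -` A) / emeasure lborel (ball (0::'a) 1)"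
    using A measurable_sets[OF borel_measurable_sgn, of A]
    by (subst emeasure_uniform_measure) auto
  also have "ball 0 1 \<inter> sgn -` A = {y \<in> ball 0 1. sgn y \<in> A}"
    by auto
  finally show ?thesis .
qed

lemma prob_space_sphere_measure: "prob_space (sphere_measure :: 'a::euclidean_space measure)"
proof
  have "{y \<in> ball 0 1. sgn y \<in> sphere 0 (1::real)} = ball (0::'a) 1 - {0}"
    by (auto simp: norm_sgn)
  moreover have "emeasure lborel (ball (0::'a) 1 - {0}) = emeasure lborel (ball (0::'a) 1)"
    by (intro emeasure_Diff_null_set) auto
  moreover have "sphere 0 1 \<in> sets (sphere_measure :: 'a measure)"
    by (simp add: sets_sphere_measure_iff)
  ultimately show "emeasure sphere_measure (space (sphere_measure :: 'a measure)) = 1"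
    using ball_volume_pos[where ?'a='a] ball_volume_finite[where ?'a='a]
    by (simp add: emeasure_sphere_measure ennreal_divide_self less_top)
qed

interpretation sphere: prob_space "sphere_measure :: 'a::euclidean_space measure"
  by (rule prob_space_sphere_measure)

lemma measure_sphere [simp]: "measure sphere_measure (sphere (0::'a::euclidean_space) 1) = 1"
  using sphere.prob_space by simp

lemma sphere_borel_measurable_continuous:
  fixes f :: "'a::euclidean_space \<Rightarrow> 'b::topological_space"
  assumes "continuous_on (sphere 0 1) f"
  shows "f \<in> borel_measurable sphere_measure"
  using borel_measurable_continuous_on_restrict[OF assms]
  by (simp cong: measurable_cong_sets add: sets_sphere_measure)

lemma sphere_bounded_continuous:
  fixes f :: "'a::euclidean_space \<Rightarrow> real"
  assumes "continuous_on (sphere 0 1) f"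
  obtains B where "B > 0" "\<And>x. x \<in> sphere 0 1 \<Longrightarrow> \<bar>f x\<bar> \<le> B"
proof -
  have "bounded (f ` sphere 0 1)"
    by (intro compact_imp_bounded compact_continuous_image assms compact_sphere)
  then show ?thesis
    using that unfolding bounded_pos by auto
qed

lemma sphere_integrable_continuous:
  fixes f :: "'a::euclidean_space \<Rightarrow> real"
  assumes "continuous_on (sphere 0 1) f"
  shows "integrable sphere_measure f"
proof -
  obtain B where "\<And>x. x \<in> sphere 0 1 \<Longrightarrow> \<bar>f x\<bar> \<le> B"
    using sphere_bounded_continuous[OF assms] by blast
  then show ?thesis
    by (intro sphere.integrable_const_bound[of _ B] sphere_borel_measurable_continuous assms)
      (auto intro!: AE_I2)
qed

lemma sphere_integral_mono:
  fixes f g :: "'a::euclidean_space \<Rightarrow> real"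
  assumes "continuous_on (sphere 0 1) f" "continuous_on (sphere 0 1) g"
    "\<And>x. x \<in> sphere 0 1 \<Longrightarrow> f x \<le> g x"
  shows "(\<integral>x. f x \<partial>sphere_measure) \<le> (\<integral>x. g x \<partial>sphere_measure)"
  using assms by (intro integral_mono sphere_integrable_continuous) auto

lemma sphere_integral_cong:
  fixes f g :: "'a::euclidean_space \<Rightarrow> real"
  assumes "\<And>x. x \<in> sphere 0 1 \<Longrightarrow> f x = g x"
  shows "(\<integral>x. f x \<partial>sphere_measure) = (\<integral>x. g x \<partial>sphere_measure)"
  using assms by (intro Bochner_Integration.integral_cong) auto

section \<open>Rotation invariance of the surface measure\<close>

lemma sgn_orthogonal:
  assumes "orthogonal_transformation T"
  shows "sgn (T y) = T (sgn y)"
  using assms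
  by (simp add: sgn_div_norm orthogonal_transformation_norm orthogonal_transformation_scaleR)

text \<open>Since \<open>sgn\<close> commutes with \<open>T\<close>, the cone over the preimage of
  \<open>A\<close> is the preimage of the cone over \<open>A\<close>; invariance of Lebesgue measure
  then carries over.\<close>

lemma distr_sphere_orthogonal:
  fixes T :: "'a::euclidean_space \<Rightarrow> 'a"
  assumes T: "orthogonal_transformation T"
  shows "T \<in> measurable sphere_measure sphere_measure"
    and "distr sphere_measure sphere_measure T = sphere_measure"
proof -
  note [measurable] = borel_measurable_orthogonal[OF T]
  have "T \<in> measurable (restrict_space borel (sphere 0 1)) (restrict_space borel (sphere 0 1))"
    using orthogonal_transformation_norm[OF T]
    by (intro measurable_restrict_space3) auto
  then show meas: "T \<in> measurable sphere_measure sphere_measure"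
    by (simp cong: measurable_cong_sets add: sets_sphere_measure)
  show "distr sphere_measure sphere_measure T = sphere_measure"
  proof (rule measure_eqI)
    fix A :: "'a set"
    assume "A \<in> sets (distr sphere_measure sphere_measure T)"
    then have A: "A \<in> sets sphere_measure" "A \<subseteq> sphere 0 1" "A \<in> sets borel"
      by (auto simp: sets_sphere_measure_iff)
    note [measurable] = A(3)
    have "T -` A \<inter> sphere 0 1 \<in> sets sphere_measure"
      using measurable_sets[OF meas A(1)] by simp
    then have "emeasure (distr sphere_measure sphere_measure T) A =
      emeasure lborel {y \<in> ball 0 1. sgn y \<in> T -` A \<inter> sphere 0 1} / emeasure lborel (ball (0::'a)
          1)"
      using meas A(1) by (simp add: emeasure_distr emeasure_sphere_measure)
    also have "{y \<in> ball 0 1. sgn y \<in> T -` A \<inter> sphere 0 1} = T -` {y \<in> ball 0 1. sgn y \<in> A}"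
      using A(2) orthogonal_transformation_norm[OF T, of "sgn _"]
      by (auto simp: sgn_orthogonal[OF T] orthogonal_transformation_norm[OF T])
    also have "emeasure lborel (T -` {y \<in> ball 0 1. sgn y \<in> A}) =
        emeasure (distr lborel borel T) {y \<in> ball 0 1. sgn y \<in> A}"
      by (subst emeasure_distr) auto
    also have "\<dots> = emeasure lborel {y \<in> ball 0 1. sgn y \<in> A}"
      by (simp add: lborel_distr_orthogonal[OF T])
    finally show "emeasure (distr sphere_measure sphere_measure T) A = emeasure sphere_measure A"
      using A(1) by (simp add: emeasure_sphere_measure)
  qed simp
qed

lemma sphere_integral_orthogonal:
  fixes f :: "'a::euclidean_space \<Rightarrow> real" and T :: "'a \<Rightarrow> 'a"
  assumes "orthogonal_transformation T" "f \<in> borel_measurable sphere_measure"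
  shows "(\<integral>x. f (T x) \<partial>sphere_measure) = (\<integral>x. f x \<partial>sphere_measure)"
  using integral_distr[OF distr_sphere_orthogonal(1)[OF assms(1)] assms(2)]
    distr_sphere_orthogonal(2)[OF assms(1)] by simp

text \<open>The reflection in the hyperplane orthogonal to \<open>a - b\<close>. It serves to move
  an arbitrary cap to one centred at a basis vector.\<close>

lemma reflection_exists:
  fixes a b :: "'a::euclidean_space"
  assumes "norm a = norm b"
  obtains T where "orthogonal_transformation T" "T a = b"
proof (cases "a = b")
  case True
  then show ?thesis
    using that[of "\<lambda>x. x"] by simp
next
  case False
  define w where "w = a - b"
  have ab: "a \<bullet> a = b \<bullet> b"
    using assms by (simp add: dot_square_norm)
  have w: "w \<bullet> w \<noteq> 0"
    using False by (simp add: w_def)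
  define T where "T x = x - (2 * (x \<bullet> w) / (w \<bullet> w)) *\<^sub>R w" for x
  have "linear T"
    unfolding T_def by (rule linearI) (auto simp: algebra_simps inner_simps add_divide_distrib)
  moreover have "T v \<bullet> T u = v \<bullet> u" for u v
  proof -
    have "T v \<bullet> T u = v \<bullet> u - 2 * (u \<bullet> w) / (w \<bullet> w) * (v \<bullet> w)
        - 2 * (v \<bullet> w) / (w \<bullet> w) * (u \<bullet> w)
        + 2 * (v \<bullet> w) / (w \<bullet> w) * (2 * (u \<bullet> w) / (w \<bullet> w)) * (w \<bullet> w)"
      unfolding T_def by (simp add: inner_diff_left inner_diff_right inner_commute algebra_simps)
    also have "\<dots> = v \<bullet> u"
      using w by simp
    finally show ?thesis .
  qed
  ultimately have "orthogonal_transformation T"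
    by (simp add: orthogonal_transformation_def)
  moreover have "2 * (a \<bullet> w) = w \<bullet> w"
    unfolding w_def by (simp add: inner_simps ab inner_commute)
  then have "T a = b"
    using w by (simp add: T_def w_def)
  ultimately show ?thesis
    using that by blast
qed

text \<open>The parameter \<open>h\<close> is the height of the cap, so its angular radius is \<open>arccos (1 - h)\<close>.\<close>

definition cap :: "'a::euclidean_space \<Rightarrow> real \<Rightarrow> 'a set" where
  "cap z h = {x \<in> sphere 0 1. 1 - h < z \<bullet> x}"

lemma cap_sets [measurable]: "cap z h \<in> sets sphere_measure"
  unfolding cap_def sets_sphere_measure_iff by auto

lemma sqrt_power_powr: "x > 0 \<Longrightarrow> sqrt x ^ n = x powr (real n / 2)"
  by (simp add: powr_half_sqrt[symmetric] powr_realpow[symmetric] powr_powr)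

text \<open>
  The regions \<open>axial_cone b r \<tau>\<close> are linear images of one another, which yields the exact
  order of the measure of a cap.
\<close>

definition axial_cone :: "'a::euclidean_space \<Rightarrow> real \<Rightarrow> real \<Rightarrow> 'a set" where
  "axial_cone b r \<tau> = {y. 0 < y \<bullet> b \<and> y \<bullet> b < r \<and> y \<bullet> y - (y \<bullet> b)\<^sup>2 < \<tau>\<^sup>2 * (y \<bullet> b)\<^sup>2}"

lemma axial_cone_sets [measurable]: "axial_cone b r \<tau> \<in> sets borel"
  unfolding axial_cone_def by measurable

lemma emeasure_axial_cone:
  fixes b :: "'a::euclidean_space"
  assumes b: "b \<in> Basis" and "\<tau> > 0"
  shows "emeasure lborel (axial_cone b r \<tau>) =
      ennreal (\<tau> ^ (DIM('a) - 1)) * emeasure lborel (axial_cone b r 1)"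
proof -
  \<comment> \<open>Every coordinate except the one along \<open>b\<close> is stretched by
    \<open>\<tau>\<close>, so the determinant is \<open>\<tau>\<close> to the power
    \<open>DIM('a) - 1\<close>.\<close>
  define c where "c j = (if j = b then 1 else \<tau>)" for j :: 'a
  define T where "T x = 0 + (\<Sum>j\<in>Basis. (c j * (x \<bullet> j)) *\<^sub>R j)" for x :: 'a
  have T_eq: "T x = \<tau> *\<^sub>R x + ((1 - \<tau>) * (x \<bullet> b)) *\<^sub>R b" for x
    unfolding T_def
    by (rule euclidean_eqI) (use b in \<open>auto simp: inner_simps c_def inner_Basis algebra_simps\<close>)
  have [measurable]: "T \<in> borel_measurable borel"
    unfolding T_eq[abs_def] by measurable
  have vimage: "T -` axial_cone b r \<tau> = axial_cone b r 1"
  proof -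
    have 1: "T x \<bullet> b = x \<bullet> b" for x
      using b by (simp add: T_eq inner_simps algebra_simps)
    have "T x \<bullet> T x = \<tau>\<^sup>2 * (x \<bullet> x) + 2 * (\<tau> * (1 - \<tau>)) * (x \<bullet> b)\<^sup>2 + (1 - \<tau>)\<^sup>2 * (x \<bullet> b)\<^sup>2" for x
      using b by (simp add: T_eq inner_simps inner_commute power2_eq_square algebra_simps)
    then have 2: "T x \<bullet> T x - (T x \<bullet> b)\<^sup>2 = \<tau>\<^sup>2 * (x \<bullet> x - (x \<bullet> b)\<^sup>2)" for x
      unfolding 1 by (simp add: power2_eq_square algebra_simps)
    have "\<tau>\<^sup>2 * (x \<bullet> x - (x \<bullet> b)\<^sup>2) < \<tau>\<^sup>2 * (x \<bullet> b)\<^sup>2 \<longleftrightarrow> x \<bullet> x - (x \<bullet> b)\<^sup>2 < (x \<bullet> b)\<^sup>2" for x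
      using \<open>\<tau> > 0\<close> by simp
    then show ?thesis
      unfolding axial_cone_def vimage_def mem_Collect_eq 2 unfolding 1 by simp
  qed
  have prod: "(\<Prod>j\<in>Basis. \<bar>c j\<bar>) = \<tau> ^ (DIM('a) - 1)"
    using b \<open>\<tau> > 0\<close> by (subst prod.remove[of _ b]) (auto simp: c_def)
  have "lborel = density (distr lborel borel T) (\<lambda>_. (\<Prod>j\<in>Basis. \<bar>c j\<bar>))"
    using lborel_affine_euclidean[of c 0] \<open>\<tau> > 0\<close> by (simp add: c_def T_def[abs_def])
  then have "emeasure lborel (axial_cone b r \<tau>) =
      emeasure (density (distr lborel borel T) (\<lambda>_. ennreal (\<tau> ^ (DIM('a) - 1)))) (axial_cone b r
          \<tau>)"
    by (simp only: prod)
  also have "\<dots> = ennreal (\<tau> ^ (DIM('a) - 1)) * emeasure lborel (T -` axial_cone b r \<tau>)"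
    by (subst emeasure_density) (auto simp: nn_integral_cmult emeasure_distr)
  finally show ?thesis
    by (simp add: vimage)
qed

lemma measure_axial_cone:
  fixes b :: "'a::euclidean_space"
  assumes "b \<in> Basis" "\<tau> > 0"
  shows "measure lborel (axial_cone b r \<tau>) = \<tau> ^ (DIM('a) - 1) * measure lborel (axial_cone b r 1)"
  using emeasure_axial_cone[OF assms, of r] assms by (simp add: measure_def enn2real_mult)

lemma axial_cone_subset_ball:
  assumes "b \<in> Basis" "r > 0"
  shows "axial_cone b r 1 \<subseteq> ball 0 (2 * r)"
proof
  fix y assume "y \<in> axial_cone b r 1"
  then have y: "0 < y \<bullet> b" "y \<bullet> b < r" "y \<bullet> y < 2 * (y \<bullet> b)\<^sup>2"
    by (auto simp: axial_cone_def)
  have "(norm y)\<^sup>2 < 2 * r\<^sup>2"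
    using y(3) power_strict_mono[OF y(2), of 2] y(1) by (simp add: dot_square_norm)
  also have "\<dots> \<le> (2 * r)\<^sup>2"
    by (simp add: power_mult_distrib)
  finally show "y \<in> ball 0 (2 * r)"
    using \<open>r > 0\<close> power2_less_imp_less[of "norm y" "2 * r"] by simp
qed

lemma measure_axial_cone_pos:
  fixes b :: "'a::euclidean_space"
  assumes b: "b \<in> Basis" and "r > 0"
  shows "0 < measure lborel (axial_cone b r 1)"
    and "emeasure lborel (axial_cone b r 1) < \<infinity>"
proof -
  have "emeasure lborel (axial_cone b r 1) \<le> emeasure lborel (ball (0::'a) (2 * r))"
    using axial_cone_subset_ball[OF assms] by (intro emeasure_mono) auto
  then show fin: "emeasure lborel (axial_cone b r 1) < \<infinity>"
    using emeasure_lborel_ball_finite[of "0::'a" "2 * r"] by (simp add: le_less_trans)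
  have "open (axial_cone b r 1)"
    unfolding axial_cone_def by (intro open_Collect_conj open_Collect_less continuous_intros)
  moreover have "(r / 2) *\<^sub>R b \<in> axial_cone b r 1"
    using assms by (auto simp: axial_cone_def power2_eq_square)
  ultimately obtain e where e: "e > 0" "ball ((r / 2) *\<^sub>R b) e \<subseteq> axial_cone b r 1"
    by (meson open_contains_ball)
  have "0 < measure lborel (ball ((r / 2) *\<^sub>R b) e)"
    using content_ball_pos[of e "(r / 2) *\<^sub>R b"] e(1) by simp
  also have "\<dots> \<le> measure lborel (axial_cone b r 1)"
    using e(2) fin by (intro measure_mono_fmeasurable) (auto simp: fmeasurable_def)
  finally show "0 < measure lborel (axial_cone b r 1)" .
qed

lemma measure_sphere_measure:
  assumes "A \<in> sets (sphere_measure :: 'a::euclidean_space measure)"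
  shows "measure sphere_measure A =
    measure lborel {y \<in> ball 0 1. sgn y \<in> A} / measure lborel (ball (0::'a) 1)"
proof -
  have "emeasure lborel {y \<in> ball 0 1. sgn y \<in> A} \<le> emeasure lborel (ball (0::'a) 1)"
    by (intro emeasure_mono) auto
  then have "emeasure lborel {y \<in> ball 0 1. sgn y \<in> A} < \<infinity>"
    using ball_volume_finite[where ?'a='a] by (simp add: le_less_trans)
  then have "emeasure sphere_measure A =
      ennreal (measure lborel {y \<in> ball 0 1. sgn y \<in> A}) / ennreal (measure lborel (ball (0::'a)
          1))"
    using ball_volume_finite[where ?'a='a]
    by (simp add: emeasure_sphere_measure[OF assms] emeasure_eq_ennreal_measure less_top)
  also have "\<dots> =
      ennreal (measure lborel {y \<in> ball 0 1. sgn y \<in> A} / measure lborel (ball (0::'a) 1))"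
    using content_ball_pos[of 1 "0::'a"] by (intro divide_ennreal) auto
  finally show ?thesis
    by (simp add: measure_def)
qed

text \<open>A cone of tangent \<open>sqrt (h / 2)\<close> lies over the cap because (1 - h)^2 (1 +
  h/2) is at most 1 for \<open>h < 1\<close>. Height 1/2 keeps it inside the unit ball, since |y|^2
  is there at most twice the squared height.\<close>

lemma measure_cap_lower:
  fixes b :: "'a::euclidean_space"
  assumes b: "b \<in> Basis" and h: "0 < h" "h \<le> 2"
  shows "(sqrt (h / 2)) ^ (DIM('a) - 1) * measure lborel (axial_cone b (1/2) 1) / measure lborel
      (ball (0::'a) 1)
    \<le> measure sphere_measure (cap b h)"
proof -
  have sub: "axial_cone b (1/2) (sqrt (h / 2)) \<subseteq> {y \<in> ball 0 1. sgn y \<in> cap b h}"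
  proof
    fix y assume "y \<in> axial_cone b (1/2) (sqrt (h / 2))"
    then have y: "0 < y \<bullet> b" "y \<bullet> b < 1/2" "y \<bullet> y < (1 + h / 2) * (y \<bullet> b)\<^sup>2"
      using h by (auto simp: axial_cone_def algebra_simps)
    have y0: "y \<noteq> 0" "norm y > 0"
      using y(1) by auto
    have "(y \<bullet> b)\<^sup>2 < (1/2)\<^sup>2"
      using y by (intro power_strict_mono) auto
    have "(1 + h / 2) * (y \<bullet> b)\<^sup>2 \<le> 2 * (y \<bullet> b)\<^sup>2"
      using h by (intro mult_right_mono) auto
    also have "\<dots> < 1"
      using \<open>(y \<bullet> b)\<^sup>2 < (1/2)\<^sup>2\<close> by (simp add: power2_eq_square)
    finally have "norm y < 1"
      using y(3) power2_less_imp_less[of "norm y" 1] by (simp add: dot_square_norm)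
    moreover have "(1 - h) * norm y < y \<bullet> b"
    proof (cases "h < 1")
      case True
      have "(1 - h)\<^sup>2 * (1 + h / 2) \<le> (1 - h) * (1 + h / 2)"
        using True h by (simp add: power2_eq_square mult_le_cancel_right)
      also have "\<dots> \<le> 1"
        using h by (simp add: algebra_simps)
      finally have *: "(1 - h)\<^sup>2 * (1 + h / 2) \<le> 1" .
      have "((1 - h) * norm y)\<^sup>2 = (1 - h)\<^sup>2 * (y \<bullet> y)"
        by (simp add: power_mult_distrib dot_square_norm)
      also have "\<dots> < (1 - h)\<^sup>2 * ((1 + h / 2) * (y \<bullet> b)\<^sup>2)"
        using y(3) True by (intro mult_strict_left_mono) auto
      also have "\<dots> \<le> 1 * (y \<bullet> b)\<^sup>2"
        unfolding mult.assoc[symmetric] using * by (intro mult_right_mono) auto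
      finally show ?thesis
        using y(1) power2_less_imp_less[of "(1 - h) * norm y" "y \<bullet> b"] by simp
    next
      case False
      then have "(1 - h) * norm y \<le> 0"
        by (simp add: mult_nonpos_nonneg)
      then show ?thesis using y(1) by simp
    qed
    then have "1 - h < b \<bullet> sgn y"
      using y0 by (simp add: sgn_div_norm inner_commute field_simps)
    ultimately show "y \<in> {y \<in> ball 0 1. sgn y \<in> cap b h}"
      using y0 by (simp add: cap_def norm_sgn)
  qed
  have [measurable]: "cap b h \<in> sets borel"
    using cap_sets[of b h] by (simp add: sets_sphere_measure_iff)
  have "measure lborel (axial_cone b (1/2) (sqrt (h / 2))) \<le>
      measure lborel {y \<in> ball 0 1. sgn y \<in> cap b h}"
  proof (rule measure_mono_fmeasurable[OF sub])
    have "emeasure lborel {y \<in> ball 0 1. sgn y \<in> cap b h} \<le> emeasure lborel (ball (0::'a) 1)"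
      by (intro emeasure_mono) auto
    then show "{y \<in> ball 0 1. sgn y \<in> cap b h} \<in> fmeasurable lborel"
      using ball_volume_finite[where ?'a='a] by (auto simp: fmeasurable_def le_less_trans)
  qed auto
  then show ?thesis
    using measure_axial_cone[OF b, of "sqrt (h / 2)" "1/2"] h content_ball_pos[of 1 "0::'a"]
    by (simp add: measure_sphere_measure divide_right_mono)
qed

text \<open>The number 9 makes (1 + 9h) (1 - h)^2 at least 1 on \<open>h \<le> 1/2\<close>, so the
  cone over the cap fits into the one of tangent \<open>sqrt (9 * h)\<close>.\<close>

lemma measure_cap_upper:
  fixes b :: "'a::euclidean_space"
  assumes b: "b \<in> Basis" and h: "0 < h" "h \<le> 1/2"
  shows "measure sphere_measure (cap b h)
    \<le> (sqrt (9 * h)) ^ (DIM('a) - 1) * measure lborel (axial_cone b 1 1) / measure lborel (ball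
        (0::'a) 1)"
proof -
  have sub: "{y \<in> ball 0 1. sgn y \<in> cap b h} \<subseteq> axial_cone b 1 (sqrt (9 * h))"
  proof
    fix y assume y: "y \<in> {y \<in> ball 0 1. sgn y \<in> cap b h}"
    then have y0: "y \<noteq> 0" "norm y > 0" "norm y < 1"
      by (auto simp: cap_def norm_sgn)
    have *: "(1 - h) * norm y < y \<bullet> b"
      using y y0 by (simp add: cap_def sgn_div_norm inner_commute field_simps)
    have "0 < (1 - h) * norm y"
      using h y0 by simp
    with * have pos: "0 < y \<bullet> b"
      by linarith
    have "y \<bullet> b \<le> norm y"
      using norm_cauchy_schwarz[of y b] b by simp
    have "1 \<le> (1 + 9 * h) * (1 - h)\<^sup>2"
    proof -
      have "0 \<le> h * (7 - 17 * h + 9 * h\<^sup>2)"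
      proof (intro mult_nonneg_nonneg)
        have "7 - 17 * h + 9 * h\<^sup>2 = 9 * (1/2 - h)\<^sup>2 + 8 * (1/2 - h) + 3/4"
          by (simp add: power2_eq_square field_simps)
        also have "\<dots> \<ge> 0"
          using h by (intro add_nonneg_nonneg) auto
        finally show "0 \<le> 7 - 17 * h + 9 * h\<^sup>2" .
      qed (use h in simp)
      then show ?thesis
        by (simp add: power2_eq_square algebra_simps)
    qed
    then have "1 * (y \<bullet> y) \<le> ((1 + 9 * h) * (1 - h)\<^sup>2) * (y \<bullet> y)"
      by (intro mult_right_mono) auto
    also have "\<dots> = (1 + 9 * h) * ((1 - h) * norm y)\<^sup>2"
      by (simp add: power_mult_distrib dot_square_norm)
    also have "\<dots> < (1 + 9 * h) * (y \<bullet> b)\<^sup>2"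
      using * h y0 by (intro mult_strict_left_mono power_strict_mono) auto
    finally show "y \<in> axial_cone b 1 (sqrt (9 * h))"
      using pos \<open>y \<bullet> b \<le> norm y\<close> y0 h by (simp add: axial_cone_def algebra_simps)
  qed
  have [measurable]: "cap b h \<in> sets borel"
    using cap_sets[of b h] by (simp add: sets_sphere_measure_iff)
  have "measure lborel {y \<in> ball 0 1. sgn y \<in> cap b h} \<le>
      measure lborel (axial_cone b 1 (sqrt (9 * h)))"
    using measure_axial_cone_pos(2)[OF b, of 1] emeasure_axial_cone[OF b, of "sqrt (9 * h)" 1] h
    by (intro measure_mono_fmeasurable[OF sub]) (auto simp: fmeasurable_def ennreal_mult_less_top)
  then show ?thesis
    using measure_axial_cone[OF b, of "sqrt (9 * h)" 1] h content_ball_pos[of 1 "0::'a"]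
    by (simp add: measure_sphere_measure divide_right_mono)
qed

lemma measure_cap_cong:
  fixes z w :: "'a::euclidean_space"
  assumes "norm z = norm w"
  shows "measure sphere_measure (cap z h) = measure sphere_measure (cap w h)"
proof -
  obtain T where T: "orthogonal_transformation T" "T z = w"
    using reflection_exists[OF assms] by blast
  have "T -` cap w h \<inter> space sphere_measure = cap z h"
    using T orthogonal_transformation_norm[OF T(1)] unfolding cap_def
    by (auto simp: orthogonal_transformation_def)
  then show ?thesis
    using measure_distr[OF distr_sphere_orthogonal(1)[OF T(1)] cap_sets, of w h]
      distr_sphere_orthogonal(2)[OF T(1)] by simp
qed

text \<open>A cap of height \<open>h\<close> has radius of order \<open>sqrt h\<close>, hence the
  exponent is half the dimension of the sphere.\<close>

lemma measure_cap_bounds: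
  obtains a c where "a > 0" "c > 0"
    "\<And>(z::'a::euclidean_space) h. \<lbrakk>norm z = 1; 0 < h; h \<le> 2\<rbrakk> \<Longrightarrow>
       a * h powr (real (DIM('a) - 1) / 2) \<le> measure sphere_measure (cap z h)"
    "\<And>(z::'a::euclidean_space) h. \<lbrakk>norm z = 1; 0 < h; h \<le> 2\<rbrakk> \<Longrightarrow>
       measure sphere_measure (cap z h) \<le> c * h powr (real (DIM('a) - 1) / 2)"
proof -
  obtain b :: 'a where b: "b \<in> Basis"
    using nonempty_Basis by blast
  define v where "v = measure lborel (ball (0::'a) 1)"
  define k where "k = real (DIM('a) - 1) / 2"
  have v: "v > 0"
    using content_ball_pos[of 1 "0::'a"] by (simp add: v_def)
  define a where "a = (1/2) powr k * measure lborel (axial_cone b (1/2) 1) / v"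
  \<comment> \<open>The summand \<open>2 powr k\<close> covers heights above 1/2, where the measure
    is estimated by 1, which is at most \<open>(2 * h) powr k\<close>.\<close>
  define c where "c = 9 powr k * measure lborel (axial_cone b 1 1) / v + 2 powr k"
  show thesis
  proof (rule that[of a c])
    show "a > 0" "c > 0"
      using v measure_axial_cone_pos(1)[OF b, of "1/2"] measure_axial_cone_pos(1)[OF b, of 1]
      by (auto simp: a_def c_def intro!: add_pos_pos divide_pos_pos mult_pos_pos)
    fix z :: 'a and h :: real
    assume z: "norm z = 1" and h: "0 < h" "h \<le> 2"
    have zb: "measure sphere_measure (cap z h) = measure sphere_measure (cap b h)"
      using z b by (intro measure_cap_cong) simp
    have "sqrt (h / 2) ^ (DIM('a) - 1) = (1/2) powr k * h powr k"
      using h sqrt_power_powr[of "h / 2" "DIM('a) - 1"] powr_mult[of "1/2" h k] by (simp add: k_def)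
    with measure_cap_lower[OF b h]
    have "(1/2) powr k * h powr k * measure lborel (axial_cone b (1/2) 1) / v
        \<le> measure sphere_measure (cap b h)"
      unfolding v_def by simp
    then show "a * h powr (real (DIM('a) - 1) / 2) \<le> measure sphere_measure (cap z h)"
      unfolding zb k_def[symmetric] by (simp add: a_def mult_ac)
    have "measure sphere_measure (cap b h) \<le> c * h powr k"
    proof (cases "h \<le> 1/2")
      case True
      have "sqrt (9 * h) ^ (DIM('a) - 1) = 9 powr k * h powr k"
        using h sqrt_power_powr[of "9 * h" "DIM('a) - 1"] powr_mult[of 9 h k] by (simp add: k_def)
      with measure_cap_upper[OF b h(1) True]
      have "9 powr k * h powr k * measure lborel (axial_cone b 1 1) / v
          \<ge> measure sphere_measure (cap b h)"
        unfolding v_def by simp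
      then have "measure sphere_measure (cap b h) \<le>
          9 powr k * measure lborel (axial_cone b 1 1) / v * h powr k"
        by (simp add: mult_ac)
      also have "\<dots> \<le> c * h powr k"
        unfolding c_def by (intro mult_right_mono) auto
      finally show ?thesis .
    next
      case False
      have "measure sphere_measure (cap b h) \<le> 1"
        by (rule sphere.prob_le_1)
      also have "1 \<le> (2 * h) powr k"
        using False by (intro ge_one_powr_ge_zero) (auto simp: k_def)
      also have "\<dots> = 2 powr k * h powr k"
        using h by (simp add: powr_mult)
      also have "\<dots> \<le> c * h powr k"
        unfolding c_def using v by (intro mult_right_mono) auto
      finally show ?thesis .
    qed
    then show "measure sphere_measure (cap z h) \<le> c * h powr (real (DIM('a) - 1) / 2)"
      unfolding zb k_def .
  qed
qed

text \<open>A positive value persists, up to a factor 1/2, on a small cap, and caps have positive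
  measure. This gives definiteness of the inner product on continuous functions.\<close>

lemma sphere_integral_zero_imp_zero:
  fixes f :: "'a::euclidean_space \<Rightarrow> real"
  assumes f: "continuous_on (sphere 0 1) f" "\<And>x. x \<in> sphere 0 1 \<Longrightarrow> 0 \<le> f x"
    and int: "(\<integral>x. f x \<partial>sphere_measure) = 0" and x: "x \<in> sphere 0 1"
  shows "f x = 0"
proof (rule ccontr)
  assume "f x \<noteq> 0"
  define e where "e = f x / 2"
  have e: "e > 0"
    using \<open>f x \<noteq> 0\<close> f(2)[OF x] by (simp add: e_def)
  obtain r where r: "r > 0" "\<And>y. y \<in> sphere 0 1 \<Longrightarrow> dist y x < r \<Longrightarrow> dist (f y) (f x) < e"
    using f(1) x e unfolding continuous_on_iff by blast
  \<comment> \<open>On the sphere the squared distance is \<open>2 - 2 * (x \<bullet> y)\<close>,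
    which is below \<open>2 * h\<close> in the cap, so height \<open>r\<^sup>2 / 2\<close> stays
    within distance \<open>r\<close>.\<close>
  define h where "h = min 1 (r\<^sup>2 / 2)"
  have h: "0 < h" "h \<le> 2"
    using r(1) by (auto simp: h_def)
  have "e * indicator (cap x h) y \<le> f y" if "y \<in> sphere 0 1" for y
  proof (cases "y \<in> cap x h")
    case True
    have "(dist y x)\<^sup>2 = 2 - 2 * (x \<bullet> y)"
    proof -
      have "x \<bullet> x = 1" "y \<bullet> y = 1"
        using that x by (simp_all add: dot_square_norm)
      then show ?thesis
        by (simp add: dist_norm power2_norm_eq_inner inner_diff_left inner_diff_right inner_commute)
    qed
    also have "\<dots> < 2 * h"
      using True by (simp add: cap_def)
    also have "\<dots> \<le> r\<^sup>2"
      by (simp add: h_def)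
    finally have "dist y x < r"
      using r(1) by (simp add: power2_less_imp_less)
    then have "dist (f y) (f x) < e"
      using r(2) that by blast
    then have "f x - f y < e"
      by (simp add: dist_real_def)
    then show ?thesis
      using True by (simp add: e_def)
  qed (use f(2)[OF that] in simp)
  then have "(\<integral>y. e * indicator (cap x h) y \<partial>sphere_measure) \<le> (\<integral>y. f y \<partial>sphere_measure)"
    by (intro integral_mono sphere_integrable_continuous[OF f(1)] integrable_mult_right
        integrable_real_indicator cap_sets) (auto simp: sphere.emeasure_finite less_top[symmetric])
  moreover have "cap x h \<inter> sphere 0 1 = cap x h"
    by (auto simp: cap_def)
  ultimately have "e * measure sphere_measure (cap x h) \<le> 0"
    using int by simp
  moreover have "0 < measure sphere_measure (cap x h)"
  proof (rule measure_cap_bounds[where ?'a='a])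
    fix a assume a: "a > 0"
      "\<And>(z::'a) h. \<lbrakk>norm z = 1; 0 < h; h \<le> 2\<rbrakk> \<Longrightarrow>
         a * h powr (real (DIM('a) - 1) / 2) \<le> measure sphere_measure (cap z h)"
    have "0 < a * h powr (real (DIM('a) - 1) / 2)"
      using a(1) h by simp
    also have "\<dots> \<le> measure sphere_measure (cap x h)"
      using x h by (intro a(2)) auto
    finally show ?thesis .
  qed
  ultimately show False
    using e by (simp add: mult_le_0_iff)
qed

text \<open>Indicators of closed sets are pointwise limits of continuous cut-offs, so
  \<open>u\<close> has integral 0 over closed sets; these generate the Borel sets and are stable
  under intersection, so a Dynkin argument reaches every Borel set.\<close>

lemma sphere_AE_zero:
  fixes u :: "'a::euclidean_space \<Rightarrow> real"
  assumes u: "integrable sphere_measure u"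
    and orth: "\<And>\<phi>. continuous_on (sphere 0 1) \<phi> \<Longrightarrow> (\<integral>x. u x * \<phi> x \<partial>sphere_measure) = 0"
  shows "AE x in sphere_measure. u x = 0"
proof (rule density_unique_real[OF u])
  have int0: "(\<integral>x. u x \<partial>sphere_measure) = 0"
    using orth[of "\<lambda>x. 1"] by simp
  have meas: "sphere 0 1 \<inter> B \<in> sets sphere_measure" if "B \<in> sets borel" for B :: "'a set"
    using that by (simp add: sets_sphere_measure_iff)
  have *: "(LINT x:sphere 0 1 \<inter> B|sphere_measure. u x) = 0" if "B \<in> sets borel" for B
  proof -
    have "Int_stable (Collect closed)" "Collect closed \<subseteq> Pow UNIV"
      "B \<in> sigma_sets UNIV (Collect closed)"
      using that by (auto simp: Int_stable_def borel_eq_closed)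
    then show ?thesis
    proof (induction B rule: sigma_sets_induct_disjoint)
      case (basic C)
      show ?case
      proof (cases "C = {}")
        \<comment> \<open>The empty set is treated apart because \<open>infdist\<close> to it is 0
          by convention, which would make every cut-off constantly 1.\<close>
        case False
        define \<phi> where "\<phi> n x = max 0 (1 - real n * infdist x C)" for n x
        have cont: "continuous_on (sphere 0 1) (\<phi> n)" for n
          unfolding \<phi>_def by (intro continuous_intros)
        have [measurable]: "\<phi> n \<in> borel_measurable sphere_measure" for n
          by (intro sphere_borel_measurable_continuous cont)
        have "(\<lambda>n. \<integral>x. u x * \<phi> n x \<partial>sphere_measure) \<longlonglongrightarrow>
            (\<integral>x. u x * indicator (sphere 0 1 \<inter> C) x \<partial>sphere_measure)"
        proof (rule integral_dominated_convergence)
          show "(\<lambda>x. u x * indicator (sphere 0 1 \<inter> C) x) \<in> borel_measurable sphere_measure"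
            using u basic meas[of C]
            by (intro borel_measurable_times borel_measurable_indicator) auto
          show "(\<lambda>x. u x * \<phi> n x) \<in> borel_measurable sphere_measure" for n
            using u by (intro borel_measurable_times) auto
          show "integrable sphere_measure (\<lambda>x. \<bar>u x\<bar>)"
            using u by simp
          have "0 \<le> \<phi> n x" "\<phi> n x \<le> 1" for n x
            using infdist_nonneg[of x C] by (auto simp: \<phi>_def)
          then show "AE x in sphere_measure. norm (u x * \<phi> n x) \<le> \<bar>u x\<bar>" for n
            by (auto simp: abs_mult intro!: AE_I2 mult_left_le)
          have "(\<lambda>n. \<phi> n x) \<longlonglongrightarrow> indicator (sphere 0 1 \<inter> C) x" if "x \<in> sphere 0 1" for x
          proof (cases "x \<in> C")
            case True
            then show ?thesis
              using that by (simp add: \<phi>_def)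
          next
            case x: False
            then have pos: "infdist x C > 0"
              using basic False by (simp add: infdist_pos_not_in_closed)
            obtain N where "1 / infdist x C < real N"
              using reals_Archimedean2 by blast
            then have "\<phi> n x = 0" if "n \<ge> N" for n
            proof -
              have "1 < real N * infdist x C"
                using \<open>1 / infdist x C < real N\<close> pos by (simp add: field_simps)
              also have "\<dots> \<le> real n * infdist x C"
                using that pos by (intro mult_right_mono) auto
              finally show ?thesis by (simp add: \<phi>_def)
            qed
            then have "(\<lambda>n. \<phi> n x) \<longlonglongrightarrow> 0"
              by (intro tendsto_eventually) (auto simp: eventually_sequentially)
            then show ?thesis
              using x by simp
          qed
          then show "AE x in sphere_measure.
              (\<lambda>n. u x * \<phi> n x) \<longlonglongrightarrow> u x * indicator (sphere 0 1 \<inter> C) x"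
            by (auto intro!: AE_I2 tendsto_mult)
        qed
        then have "(\<integral>x. u x * indicator (sphere 0 1 \<inter> C) x \<partial>sphere_measure) = 0"
          unfolding orth[OF cont] by (simp add: LIMSEQ_const_iff)
        then show ?thesis
          by (simp add: set_lebesgue_integral_def mult.commute)
      qed (simp add: set_lebesgue_integral_def)
    next
      case empty
      then show ?case by (simp add: set_lebesgue_integral_def)
    next
      case (compl A)
      then have "A \<in> sets borel"
        by (simp add: borel_eq_closed)
      note meas[OF this]
      have "(\<integral>x. u x \<partial>sphere_measure) =
          (\<integral>x. indicator (sphere 0 1 \<inter> A) x *\<^sub>R u x + indicator (sphere 0 1 \<inter> (UNIV -
              A)) x *\<^sub>R u x \<partial>sphere_measure)"
        by (intro sphere_integral_cong) (auto simp: indicator_def)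
      also have "\<dots> = (LINT x:sphere 0 1 \<inter> A|sphere_measure. u x) +
          (LINT x:sphere 0 1 \<inter> (UNIV - A)|sphere_measure. u x)"
        unfolding set_lebesgue_integral_def using u meas[of A] meas[of "UNIV - A"] \<open>A \<in> sets borel\<close>
        by (intro Bochner_Integration.integral_add integrable_mult_indicator) auto
      finally show ?case
        using compl int0 by simp
    next
      case (union A)
      then have A: "A i \<in> sets borel" for i
        by (auto simp: borel_eq_closed)
      have "(LINT x:(\<Union>i. sphere 0 1 \<inter> A i)|sphere_measure. u x) =
          (\<Sum>i. (LINT x:sphere 0 1 \<inter> A i|sphere_measure. u x))"
      proof (rule lebesgue_integral_countable_add)
        show "sphere 0 1 \<inter> A i \<in> sets sphere_measure" for i
          using meas[OF A] .
        show "(sphere 0 1 \<inter> A i) \<inter> (sphere 0 1 \<inter> A j) = {}" if "i \<noteq> j" for i j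
          using union(1) that by (auto simp: disjoint_family_on_def)
        show "set_integrable sphere_measure (\<Union>i. sphere 0 1 \<inter> A i) u"
          unfolding set_integrable_def using meas[OF A] u
          by (intro integrable_mult_indicator sets.countable_UN) auto
      qed
      then show ?case
        unfolding Int_UN_distrib using union(3) by simp
    qed
  qed
  fix A :: "'a set" assume "A \<in> sets sphere_measure"
  then have "A \<in> sets borel" "A = sphere 0 1 \<inter> A"
    by (auto simp: sets_sphere_measure_iff)
  then show "(LINT x:A|sphere_measure. u x) = (LINT x:A|sphere_measure. 0)"
    using *[of A] by (simp add: set_lebesgue_integral_def)
qed simp

subsection \<open>The Laplace-Beltrami operator\<close>

text \<open>For distinct basis vectors this is the rotation by \<open>\<theta>\<close> in their
  plane. Writing it as a perturbation of the identity avoids mentioning the other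
  coordinates.\<close>

definition rot :: "'a::euclidean_space \<Rightarrow> 'a \<Rightarrow> real \<Rightarrow> 'a \<Rightarrow> 'a" where
  "rot b b' \<theta> x = x + ((cos \<theta> - 1) * (x \<bullet> b) - sin \<theta> * (x \<bullet> b')) *\<^sub>R b
                   + (sin \<theta> * (x \<bullet> b) + (cos \<theta> - 1) * (x \<bullet> b')) *\<^sub>R b'"

lemma rot_0 [simp]: "rot b b' 0 x = x"
  by (simp add: rot_def)

lemma rot_inner_basis:
  assumes "b \<in> Basis" "b' \<in> Basis" "b \<noteq> b'"
  shows "rot b b' \<theta> x \<bullet> b = cos \<theta> * (x \<bullet> b) - sin \<theta> * (x \<bullet> b')"
    "rot b b' \<theta> x \<bullet> b' = sin \<theta> * (x \<bullet> b) + cos \<theta> * (x \<bullet> b')"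
  using assms by (simp_all add: rot_def inner_simps inner_Basis algebra_simps)

lemma rot_add:
  assumes "b \<in> Basis" "b' \<in> Basis" "b \<noteq> b'"
  shows "rot b b' (s + t) x = rot b b' s (rot b b' t x)"
  unfolding rot_def[of b b' s "rot b b' t x"] rot_inner_basis[OF assms]
  unfolding rot_def cos_add sin_add
  by (simp add: algebra_simps)

lemma orthogonal_rot:
  assumes "b \<in> Basis" "b' \<in> Basis" "b \<noteq> b'"
  shows "orthogonal_transformation (rot b b' \<theta>)"
  unfolding orthogonal_transformation
proof (intro conjI allI)
  show "linear (rot b b' \<theta>)"
    unfolding rot_def by (rule linearI) (simp_all add: inner_simps algebra_simps)
  fix x
  define p q where "p = x \<bullet> b" and "q = x \<bullet> b'"
  define u v where "u = (cos \<theta> - 1) * p - sin \<theta> * q" and "v = sin \<theta> * p + (cos \<theta> - 1) * q"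
  have eq: "rot b b' \<theta> x = x + (u *\<^sub>R b + v *\<^sub>R b')"
    by (simp add: rot_def u_def v_def p_def q_def)
  have "rot b b' \<theta> x \<bullet> rot b b' \<theta> x = x \<bullet> x + (2 * u * p + 2 * v * q + u\<^sup>2 + v\<^sup>2)"
    unfolding eq using assms
    by (simp add: inner_add_left inner_add_right inner_Basis inner_commute[of b x]
        inner_commute[of b' x] p_def[symmetric] q_def[symmetric] power2_eq_square algebra_simps)
  also have "2 * u * p + 2 * v * q + u\<^sup>2 + v\<^sup>2 = ((cos \<theta>)\<^sup>2 + (sin \<theta>)\<^sup>2 - 1) * (p\<^sup>2 + q\<^sup>2)"
    unfolding u_def v_def by algebra
  finally show "norm (rot b b' \<theta> x) = norm x"
    by (simp add: norm_eq_sqrt_inner)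
qed

lemma rot_in_sphere:
  assumes "b \<in> Basis" "b' \<in> Basis" "b \<noteq> b'" "x \<in> sphere 0 1"
  shows "rot b b' \<theta> x \<in> sphere 0 1"
  using orthogonal_transformation_norm[OF orthogonal_rot[OF assms(1-3)]] assms(4) by simp

text \<open>Differentiation at angle 0 is enough: the rotations form a one-parameter group
  preserving the sphere, so \<open>rot_deriv_at\<close> recovers the derivative at every
  angle.\<close>

definition rot_deriv :: "'a::euclidean_space \<Rightarrow> 'a \<Rightarrow> ('a \<Rightarrow> real) \<Rightarrow> ('a \<Rightarrow> real) \<Rightarrow> bool" where
  "rot_deriv b b' f f' \<longleftrightarrow>
     (\<forall>x\<in>sphere 0 1. ((\<lambda>\<theta>. f (rot b b' \<theta> x)) has_real_derivative f' x) (at 0))"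

lemma rot_deriv_at:
  assumes "b \<in> Basis" "b' \<in> Basis" "b \<noteq> b'" "rot_deriv b b' f f'" "x \<in> sphere 0 1"
  shows "((\<lambda>\<theta>. f (rot b b' \<theta> x)) has_real_derivative f' (rot b b' t x)) (at t)"
proof -
  have "((\<lambda>\<theta>. f (rot b b' \<theta> (rot b b' t x))) has_real_derivative f' (rot b b' t x)) (at 0)"
    using assms rot_in_sphere[OF assms(1-3,5)] by (simp add: rot_deriv_def)
  then have "((\<lambda>\<theta>. f (rot b b' (\<theta> + t) x)) has_real_derivative f' (rot b b' t x)) (at 0)"
    by (simp add: rot_add[OF assms(1-3)])
  then show ?thesis
    using DERIV_shift[of "\<lambda>\<theta>. f (rot b b' \<theta> x)" _ 0 t] by simp
qed

lemma rot_deriv_add: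
  "rot_deriv b b' f f' \<Longrightarrow> rot_deriv b b' g g' \<Longrightarrow>
   rot_deriv b b' (\<lambda>x. f x + g x) (\<lambda>x. f' x + g' x)"
  unfolding rot_deriv_def by (auto intro!: derivative_eq_intros)

lemma rot_deriv_cmult:
  "rot_deriv b b' f f' \<Longrightarrow> rot_deriv b b' (\<lambda>x. c * f x) (\<lambda>x. c * f' x)"
  unfolding rot_deriv_def by (auto intro!: derivative_eq_intros)

lemma rot_deriv_mult:
  "rot_deriv b b' f f' \<Longrightarrow> rot_deriv b b' g g' \<Longrightarrow>
   rot_deriv b b' (\<lambda>x. f x * g x) (\<lambda>x. f' x * g x + f x * g' x)"
  unfolding rot_deriv_def by (auto intro!: derivative_eq_intros)

lemma rot_deriv_compose:
  assumes "rot_deriv b b' f f'" "\<And>t. (u has_real_derivative u' t) (at t)"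
  shows "rot_deriv b b' (\<lambda>x. u (f x)) (\<lambda>x. u' (f x) * f' x)"
  unfolding rot_deriv_def
proof
  fix x :: 'a assume "x \<in> sphere 0 1"
  then have "((\<lambda>\<theta>. f (rot b b' \<theta> x)) has_real_derivative f' x) (at 0)"
    using assms(1) by (simp add: rot_deriv_def)
  from DERIV_chain2[OF assms(2) this]
  show "((\<lambda>\<theta>. u (f (rot b b' \<theta> x))) has_real_derivative u' (f x) * f' x) (at 0)"
    by simp
qed

lemma rot_curve_derivative:
  "((\<lambda>\<theta>. rot b b' \<theta> x) has_derivative (\<lambda>t. t *\<^sub>R ((x \<bullet> b) *\<^sub>R b' - (x \<bullet> b') *\<^sub>R b))) (at 0)"
  unfolding rot_def
  by (auto intro!: derivative_eq_intros simp: algebra_simps)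

lemma rot_deriv_inner:
  "rot_deriv b b' (\<lambda>x. x \<bullet> v) (\<lambda>x. (x \<bullet> b) * (b' \<bullet> v) - (x \<bullet> b') * (b \<bullet> v))"
  unfolding rot_deriv_def rot_def
  by (auto intro!: derivative_eq_intros simp: inner_simps)

lemma rot_deriv_poly:
  fixes p :: "'a::euclidean_space \<Rightarrow> real"
  assumes "real_polynomial_function p"
  shows "rot_deriv b b' p (\<lambda>x. (x \<bullet> b) * pd b' p x - (x \<bullet> b') * pd b p x)"
  unfolding rot_deriv_def
proof
  fix x :: 'a
  note D = poly_has_derivative[OF assms]
  have lin: "linear (\<lambda>v. pd v p x)"
    using D by (rule has_derivative_linear)
  have "((\<lambda>\<theta>. p (rot b b' \<theta> x)) has_derivative
      (\<lambda>t. pd (t *\<^sub>R ((x \<bullet> b) *\<^sub>R b' - (x \<bullet> b') *\<^sub>R b)) p (rot b b' 0 x))) (at 0)"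
    by (rule has_derivative_compose[OF rot_curve_derivative D])
  then show "((\<lambda>\<theta>. p (rot b b' \<theta> x)) has_real_derivative
      (x \<bullet> b) * pd b' p x - (x \<bullet> b') * pd b p x) (at 0)"
    unfolding has_field_derivative_def
    by (simp add: linear_cmul[OF lin, simplified] linear_diff[OF lin] mult.commute[of _ "_ - _"])
qed

text \<open>By rotation invariance every difference quotient has integral 0. The mean value theorem
  bounds the quotients by the maximum of the derivative, so dominated convergence applies.\<close>

lemma rot_deriv_integral_0:
  fixes f :: "'a::euclidean_space \<Rightarrow> real"
  assumes b: "b \<in> Basis" "b' \<in> Basis" "b \<noteq> b'" and f: "rot_deriv b b' f f'"
    and cont: "continuous_on (sphere 0 1) f" "continuous_on (sphere 0 1) f'"
  shows "(\<integral>x. f' x \<partial>sphere_measure) = 0"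
proof -
  define s where "s n x = (f (rot b b' (1 / real (Suc n)) x) - f x) * real (Suc n)" for n x
  obtain B where B: "\<And>x. x \<in> sphere 0 1 \<Longrightarrow> \<bar>f' x\<bar> \<le> B"
    using sphere_bounded_continuous[OF cont(2)] by blast
  have meas: "f \<in> borel_measurable sphere_measure"
    by (intro sphere_borel_measurable_continuous cont)
  have measr: "(\<lambda>x. f (rot b b' t x)) \<in> borel_measurable sphere_measure" for t
    using measurable_compose[OF distr_sphere_orthogonal(1)[OF orthogonal_rot[OF b]] meas] .
  have contr: "continuous_on (sphere 0 1) (\<lambda>x. f (rot b b' t x))" for t
    by (rule continuous_on_compose2[OF cont(1)])
      (use rot_in_sphere[OF b] in \<open>auto simp: rot_def intro!: continuous_intros\<close>)
  have int: "(\<integral>x. s n x \<partial>sphere_measure) = 0" for n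
    unfolding s_def using sphere_integral_orthogonal[OF orthogonal_rot[OF b] meas]
    by (simp add: sphere_integrable_continuous contr cont)
  have "(\<lambda>n. \<integral>x. s n x \<partial>sphere_measure) \<longlonglongrightarrow> (\<integral>x. f' x \<partial>sphere_measure)"
  proof (rule integral_dominated_convergence[of _ _ _ "\<lambda>_. B"])
    show "f' \<in> borel_measurable sphere_measure"
      by (intro sphere_borel_measurable_continuous cont)
    show "s n \<in> borel_measurable sphere_measure" for n
      unfolding s_def using meas measr by (intro borel_measurable_times borel_measurable_diff) auto
    show "AE x in sphere_measure. (\<lambda>n. s n x) \<longlonglongrightarrow> f' x"
    proof (rule AE_I2)
      fix x :: 'a assume "x \<in> space sphere_measure"
      then have "((\<lambda>h. (f (rot b b' h x) - f x) / h) \<longlongrightarrow> f' x) (at 0)"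
        using f by (simp add: rot_deriv_def has_field_derivative_iff)
      moreover have "filterlim (\<lambda>n. 1 / real (Suc n)) (at 0) sequentially"
        unfolding filterlim_at using LIMSEQ_Suc[OF lim_1_over_n] by auto
      ultimately have "(\<lambda>n. (f (rot b b' (1 / real (Suc n)) x) - f x) / (1 / real (Suc n))) \<longlonglongrightarrow> f' x"
        by (rule filterlim_compose)
      then show "(\<lambda>n. s n x) \<longlonglongrightarrow> f' x"
        by (simp add: s_def)
    qed
    show "AE x in sphere_measure. norm (s n x) \<le> B" for n
    proof (rule AE_I2)
      fix x :: 'a assume "x \<in> space sphere_measure"
      then have x: "x \<in> sphere 0 1" by simp
      obtain z where "f (rot b b' (1 / real (Suc n)) x) - f (rot b b' 0 x) =
          (1 / real (Suc n) - 0) * f' (rot b b' z x)"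
        using MVT2[of 0 "1 / real (Suc n)" "\<lambda>\<theta>. f (rot b b' \<theta> x)" "\<lambda>\<theta>. f' (rot b b' \<theta> x)"]
          rot_deriv_at[OF b f x] by auto
      then have "s n x = f' (rot b b' z x)"
        by (simp add: s_def)
      then show "norm (s n x) \<le> B"
        using B[OF rot_in_sphere[OF b x]] by simp
    qed
  qed simp
  then show ?thesis
    unfolding int by (simp add: LIMSEQ_const_iff)
qed

lemma rot_deriv_by_parts:
  fixes f g :: "'a::euclidean_space \<Rightarrow> real"
  assumes b: "b \<in> Basis" "b' \<in> Basis" "b \<noteq> b'"
    and f: "rot_deriv b b' f f'" "continuous_on (sphere 0 1) f" "continuous_on (sphere 0 1) f'"
    and g: "rot_deriv b b' g g'" "continuous_on (sphere 0 1) g" "continuous_on (sphere 0 1) g'"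
  shows "(\<integral>x. f' x * g x \<partial>sphere_measure) = - (\<integral>x. f x * g' x \<partial>sphere_measure)"
proof -
  have "(\<integral>x. f' x * g x + f x * g' x \<partial>sphere_measure) = 0"
    by (rule rot_deriv_integral_0[OF b rot_deriv_mult[OF f(1) g(1)]])
      (intro continuous_intros f g)+
  moreover have "(\<integral>x. f' x * g x + f x * g' x \<partial>sphere_measure) =
      (\<integral>x. f' x * g x \<partial>sphere_measure) + (\<integral>x. f x * g' x \<partial>sphere_measure)"
    by (intro Bochner_Integration.integral_add sphere_integrable_continuous continuous_intros f g)
  ultimately show ?thesis
    by simp
qed

definition rot_derivs :: "('a::euclidean_space \<Rightarrow> real) \<Rightarrow> ('a \<Rightarrow> 'a \<Rightarrow> 'a \<Rightarrow> real) \<Rightarrow>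
    ('a \<Rightarrow> 'a \<Rightarrow> 'a \<Rightarrow> real) \<Rightarrow> bool" where
  "rot_derivs f f1 f2 \<longleftrightarrow> continuous_on (sphere 0 1) f \<and>
     (\<forall>b\<in>Basis. \<forall>b'\<in>Basis. b \<noteq> b' \<longrightarrow>
       rot_deriv b b' f (f1 b b') \<and> continuous_on (sphere 0 1) (f1 b b') \<and>
       rot_deriv b b' (f1 b b') (f2 b b') \<and> continuous_on (sphere 0 1) (f2 b b'))"

lemma rot_derivsD:
  assumes "rot_derivs f f1 f2"
  shows "continuous_on (sphere 0 1) f"
    "\<lbrakk>b \<in> Basis; b' \<in> Basis; b \<noteq> b'\<rbrakk> \<Longrightarrow> rot_deriv b b' f (f1 b b')"
    "\<lbrakk>b \<in> Basis; b' \<in> Basis; b \<noteq> b'\<rbrakk> \<Longrightarrow> continuous_on (sphere 0 1) (f1 b b')"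
    "\<lbrakk>b \<in> Basis; b' \<in> Basis; b \<noteq> b'\<rbrakk> \<Longrightarrow> rot_deriv b b' (f1 b b') (f2 b b')"
    "\<lbrakk>b \<in> Basis; b' \<in> Basis; b \<noteq> b'\<rbrakk> \<Longrightarrow> continuous_on (sphere 0 1) (f2 b b')"
  using assms by (auto simp: rot_derivs_def)

text \<open>
  \<open>is_LB f g\<close> says that \<open>g\<close> is the Laplace-Beltrami operator applied to \<open>f\<close>, computed as
  the sum of the squares of the generators of the rotations in the coordinate planes; each
  plane occurs twice in the sum.
\<close>

definition is_LB :: "('a::euclidean_space \<Rightarrow> real) \<Rightarrow> ('a \<Rightarrow> real) \<Rightarrow> bool" where
  "is_LB f g \<longleftrightarrow> (\<exists>f1 f2. rot_derivs f f1 f2 \<and>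
     (\<forall>x\<in>sphere 0 1. g x = (\<Sum>b\<in>Basis. \<Sum>b'\<in>Basis - {b}. f2 b b' x) / 2))"

lemma is_LBI:
  assumes "continuous_on (sphere 0 1) f"
    "\<And>b b'. \<lbrakk>b \<in> Basis; b' \<in> Basis; b \<noteq> b'\<rbrakk> \<Longrightarrow> rot_deriv b b' f (f1 b b')"
    "\<And>b b'. \<lbrakk>b \<in> Basis; b' \<in> Basis; b \<noteq> b'\<rbrakk> \<Longrightarrow> continuous_on (sphere 0 1) (f1 b b')"
    "\<And>b b'. \<lbrakk>b \<in> Basis; b' \<in> Basis; b \<noteq> b'\<rbrakk> \<Longrightarrow> rot_deriv b b' (f1 b b') (f2 b b')"
    "\<And>b b'. \<lbrakk>b \<in> Basis; b' \<in> Basis; b \<noteq> b'\<rbrakk> \<Longrightarrow> continuous_on (sphere 0 1) (f2 b b')"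
    "\<And>x. x \<in> sphere 0 1 \<Longrightarrow> g x = (\<Sum>b\<in>Basis. \<Sum>b'\<in>Basis - {b}. f2 b b' x) / 2"
  shows "is_LB f g"
  unfolding is_LB_def rot_derivs_def
  using assms by (intro exI[of _ f1] exI[of _ f2] conjI ballI impI)

lemma is_LBE:
  assumes "is_LB f g"
  obtains f1 f2 where "rot_derivs f f1 f2"
    "\<And>x. x \<in> sphere 0 1 \<Longrightarrow> g x = (\<Sum>b\<in>Basis. \<Sum>b'\<in>Basis - {b}. f2 b b' x) / 2"
  using assms unfolding is_LB_def by blast

lemma is_LB_continuous:
  assumes "is_LB f g"
  shows "continuous_on (sphere 0 1) f" "continuous_on (sphere 0 1) g"
proof -
  obtain f1 f2 where f12: "rot_derivs f f1 f2"
    and g: "\<And>x. x \<in> sphere 0 1 \<Longrightarrow> g x = (\<Sum>b\<in>Basis. \<Sum>b'\<in>Basis - {b}. f2 b b' x) / 2"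
    using is_LBE[OF assms] by blast
  show "continuous_on (sphere 0 1) f"
    by (rule rot_derivsD(1)[OF f12])
  have "continuous_on (sphere 0 1) (\<lambda>x. (\<Sum>b\<in>Basis. \<Sum>b'\<in>Basis - {b}. f2 b b' x) / 2)"
    using rot_derivsD(5)[OF f12] by (intro continuous_intros) auto
  then show "continuous_on (sphere 0 1) g"
    by (rule continuous_on_eq) (use g in auto)
qed

lemma is_LB_add:
  assumes "is_LB f g" "is_LB h k"
  shows "is_LB (\<lambda>x. f x + h x) (\<lambda>x. g x + k x)"
proof -
  obtain f1 f2 where f12: "rot_derivs f f1 f2"
    and g: "\<And>x. x \<in> sphere 0 1 \<Longrightarrow> g x = (\<Sum>b\<in>Basis. \<Sum>b'\<in>Basis - {b}. f2 b b' x) / 2"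
    using is_LBE[OF assms(1)] by blast
  note f = rot_derivsD[OF f12] g
  obtain h1 h2 where h12: "rot_derivs h h1 h2"
    and k: "\<And>x. x \<in> sphere 0 1 \<Longrightarrow> k x = (\<Sum>b\<in>Basis. \<Sum>b'\<in>Basis - {b}. h2 b b' x) / 2"
    using is_LBE[OF assms(2)] by blast
  note h = rot_derivsD[OF h12] k
  show ?thesis
    by (rule is_LBI[where ?f1.0 = "\<lambda>b b' x. f1 b b' x + h1 b b' x"
          and ?f2.0 = "\<lambda>b b' x. f2 b b' x + h2 b b' x"])
      (simp_all add: f h rot_deriv_add continuous_on_add sum.distrib add_divide_distrib)
qed

lemma is_LB_cmult:
  assumes "is_LB f g"
  shows "is_LB (\<lambda>x. c * f x) (\<lambda>x. c * g x)"
proof -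
  obtain f1 f2 where f12: "rot_derivs f f1 f2"
    and g: "\<And>x. x \<in> sphere 0 1 \<Longrightarrow> g x = (\<Sum>b\<in>Basis. \<Sum>b'\<in>Basis - {b}. f2 b b' x) / 2"
    using is_LBE[OF assms(1)] by blast
  note f = rot_derivsD[OF f12] g
  show ?thesis
    by (rule is_LBI[where ?f1.0 = "\<lambda>b b' x. c * f1 b b' x" and ?f2.0 = "\<lambda>b b' x. c * f2 b b' x"])
      (simp_all add: f rot_deriv_cmult continuous_on_mult_left sum_distrib_left)
qed

lemma is_LB_0: "is_LB (\<lambda>x. 0) (\<lambda>x. 0)"
  by (rule is_LBI[where ?f1.0 = "\<lambda>b b' x. 0" and ?f2.0 = "\<lambda>b b' x. 0"])
    (auto simp: rot_deriv_def)

lemma is_LB_sum: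
  assumes "finite I" "\<And>i. i \<in> I \<Longrightarrow> is_LB (f i) (g i)"
  shows "is_LB (\<lambda>x. \<Sum>i\<in>I. f i x) (\<lambda>x. \<Sum>i\<in>I. g i x)"
  using assms by (induction I rule: finite_induct) (simp_all add: is_LB_0 is_LB_add)

lemma is_LB_cong:
  assumes "is_LB f g" "\<And>x. x \<in> sphere 0 1 \<Longrightarrow> g x = g' x"
  shows "is_LB f g'"
  using assms unfolding is_LB_def by (elim exE conjE) (intro exI conjI, auto)

text \<open>Two integrations by parts in each coordinate plane; the sphere has no boundary and the
  two signs cancel.\<close>

lemma is_LB_symmetric:
  assumes "is_LB f g" "is_LB h k"
  shows "(\<integral>x. g x * h x \<partial>sphere_measure) = (\<integral>x. f x * k x \<partial>sphere_measure)"
proof -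
  obtain f1 f2 where f12: "rot_derivs f f1 f2"
    and g: "\<And>x. x \<in> sphere 0 1 \<Longrightarrow> g x = (\<Sum>b\<in>Basis. \<Sum>b'\<in>Basis - {b}. f2 b b' x) / 2"
    using is_LBE[OF assms(1)] by blast
  note f = rot_derivsD[OF f12] g
  obtain h1 h2 where h12: "rot_derivs h h1 h2"
    and k: "\<And>x. x \<in> sphere 0 1 \<Longrightarrow> k x = (\<Sum>b\<in>Basis. \<Sum>b'\<in>Basis - {b}. h2 b b' x) / 2"
    using is_LBE[OF assms(2)] by blast
  note h = rot_derivsD[OF h12] k
  have eq: "(\<integral>x. f2 b b' x * h x \<partial>sphere_measure) = (\<integral>x. f x * h2 b b' x \<partial>sphere_measure)"
    if b: "b \<in> Basis" "b' \<in> Basis" "b \<noteq> b'" for b b'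
    using rot_deriv_by_parts[OF b f(4)[OF b] f(3)[OF b] f(5)[OF b] h(2)[OF b] h(1) h(3)[OF b]]
      rot_deriv_by_parts[OF b f(2)[OF b] f(1) f(3)[OF b] h(4)[OF b] h(3)[OF b] h(5)[OF b]]
    by simp
  have int: "(\<integral>x. (\<Sum>b\<in>Basis. \<Sum>b'\<in>Basis - {b}. F b b' x) / 2 \<partial>sphere_measure) =
      (\<Sum>b\<in>Basis. \<Sum>b'\<in>Basis - {b}. \<integral>x. F b b' x \<partial>sphere_measure) / 2"
    if "\<And>b b'. \<lbrakk>b \<in> Basis; b' \<in> Basis; b \<noteq> b'\<rbrakk> \<Longrightarrow> continuous_on (sphere 0 1) (F b b')"
    for F :: "'a \<Rightarrow> 'a \<Rightarrow> 'a \<Rightarrow> real"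
  proof -
    have F: "integrable sphere_measure (F b b')" if "b \<in> Basis" "b' \<in> Basis - {b}" for b b'
      using that \<open>\<And>b b'. \<lbrakk>b \<in> Basis; b' \<in> Basis; b \<noteq> b'\<rbrakk> \<Longrightarrow> continuous_on (sphere 0 1) (F b b')\<close>
      by (intro sphere_integrable_continuous) auto
    have "(\<integral>x. (\<Sum>b\<in>Basis. \<Sum>b'\<in>Basis - {b}. F b b' x) \<partial>sphere_measure) =
        (\<Sum>b\<in>Basis. \<integral>x. (\<Sum>b'\<in>Basis - {b}. F b b' x) \<partial>sphere_measure)"
      by (rule Bochner_Integration.integral_sum) (intro Bochner_Integration.integrable_sum F)
    also have "\<dots> = (\<Sum>b\<in>Basis. \<Sum>b'\<in>Basis - {b}. \<integral>x. F b b' x \<partial>sphere_measure)"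
      by (intro sum.cong refl Bochner_Integration.integral_sum F)
    finally show ?thesis
      by simp
  qed
  have "(\<integral>x. g x * h x \<partial>sphere_measure) =
     (\<integral>x. (\<Sum>b\<in>Basis. \<Sum>b'\<in>Basis - {b}. f2 b b' x * h x) / 2 \<partial>sphere_measure)"
    by (intro sphere_integral_cong) (simp add: f(6) sum_distrib_right)
  also have "\<dots> = (\<Sum>b\<in>Basis. \<Sum>b'\<in>Basis - {b}. \<integral>x. f2 b b' x * h x \<partial>sphere_measure) / 2"
    by (intro int continuous_on_mult f(5) h(1))
  also have "\<dots> = (\<Sum>b\<in>Basis. \<Sum>b'\<in>Basis - {b}. \<integral>x. f x * h2 b b' x \<partial>sphere_measure) / 2"
    using eq by (intro arg_cong[of _ _ "\<lambda>x. x / 2"] sum.cong) auto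
  also have "\<dots> = (\<integral>x. (\<Sum>b\<in>Basis. \<Sum>b'\<in>Basis - {b}. f x * h2 b b' x) / 2 \<partial>sphere_measure)"
    by (intro int[symmetric] continuous_on_mult h(5) f(1))
  also have "\<dots> = (\<integral>x. f x * k x \<partial>sphere_measure)"
    by (intro sphere_integral_cong) (simp add: h(6) sum_distrib_left)
  finally show ?thesis .
qed

text \<open>If \<open>D\<close> were positive, \<open>\<phi>1\<close>, which vanishes at the
  maximum, would be positive just to the right of 0, and \<open>\<phi>\<close> would exceed its
  maximum by the mean value theorem.\<close>

lemma second_derivative_at_max:
  fixes \<phi> \<phi>1 :: "real \<Rightarrow> real"
  assumes "\<And>t. (\<phi> has_real_derivative \<phi>1 t) (at t)" "(\<phi>1 has_real_derivative D) (at 0)"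
    "\<And>t. \<phi> t \<le> \<phi> 0"
  shows "D \<le> 0"
proof (rule ccontr)
  assume "\<not> D \<le> 0"
  then have "D > 0" by simp
  have "\<phi>1 0 = 0"
    by (rule DERIV_local_max[OF assms(1), of 1]) (use assms(3) in auto)
  obtain d where d: "d > 0" "\<And>h. 0 < h \<Longrightarrow> h < d \<Longrightarrow> \<phi>1 0 < \<phi>1 (0 + h)"
    using DERIV_pos_inc_right[OF assms(2) \<open>D > 0\<close>] by blast
  obtain z where z: "0 < z" "z < d / 2" "\<phi> (d / 2) - \<phi> 0 = (d / 2 - 0) * \<phi>1 z"
    using MVT2[of 0 "d / 2" \<phi> \<phi>1] assms(1) d(1) by auto
  have "\<phi>1 z > 0"
    using d z \<open>\<phi>1 0 = 0\<close> by fastforce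
  then have "(d / 2 - 0) * \<phi>1 z > 0"
    using d(1) by simp
  then show False
    using z(3) assms(3)[of "d / 2"] by linarith
qed

lemma is_LB_max:
  assumes "is_LB f g" "x \<in> sphere 0 1" "\<And>y. y \<in> sphere 0 1 \<Longrightarrow> f y \<le> f x"
  shows "g x \<le> 0"
proof -
  obtain f1 f2 where f12: "rot_derivs f f1 f2"
    and g: "\<And>x. x \<in> sphere 0 1 \<Longrightarrow> g x = (\<Sum>b\<in>Basis. \<Sum>b'\<in>Basis - {b}. f2 b b' x) / 2"
    using is_LBE[OF assms(1)] by blast
  note f = rot_derivsD[OF f12] g
  have "f2 b b' x \<le> 0" if b: "b \<in> Basis" "b' \<in> Basis" "b \<noteq> b'" for b b'
  proof (rule second_derivative_at_max)
    show "((\<lambda>\<theta>. f (rot b b' \<theta> x)) has_real_derivative f1 b b' (rot b b' t x)) (at t)" for t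
      by (rule rot_deriv_at[OF b f(2)[OF b] assms(2)])
    show "((\<lambda>\<theta>. f1 b b' (rot b b' \<theta> x)) has_real_derivative f2 b b' x) (at 0)"
      using f(4)[OF b] assms(2) by (simp add: rot_deriv_def)
    show "f (rot b b' t x) \<le> f (rot b b' 0 x)" for t
      using assms(3)[OF rot_in_sphere[OF b assms(2)]] by simp
  qed
  then show ?thesis
    unfolding f(6)[OF assms(2)] by (auto intro!: sum_nonpos divide_nonpos_nonneg)
qed

text \<open>Full double sums factor into products of single sums, so the diagonal is added and
  subtracted.\<close>

lemma sum_off_diagonal:
  fixes F :: "'a::euclidean_space \<Rightarrow> 'a \<Rightarrow> real"
  shows "(\<Sum>b\<in>Basis. \<Sum>b'\<in>Basis - {b}. F b b') =
    (\<Sum>b\<in>Basis. \<Sum>b'\<in>Basis. F b b') - (\<Sum>b\<in>Basis. F b b)"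
proof -
  have "(\<Sum>b'\<in>Basis - {b}. F b b') = (\<Sum>b'\<in>Basis. F b b') - F b b" if "b \<in> Basis" for b
    using that by (simp add: sum_diff1)
  then show ?thesis
    by (simp add: sum_subtractf)
qed

text \<open>With D = \<open>DIM('a)\<close>, the sum of squared rotation generators is |x|^2 Lap -
  (x . grad)^2 - (D - 2) (x . grad). For a harmonic polynomial the first term vanishes, and Euler's
  identity replaces x . grad by \<open>l\<close>.\<close>

lemma is_LB_solid_harmonic:
  fixes h :: "'a::euclidean_space \<Rightarrow> real"
  assumes "h \<in> solid_harmonics l"
  shows "is_LB h (\<lambda>x. - lb_eigenvalue (DIM('a) - 1) l * h x)"
proof -
  have hom: "hom_poly l h" and lap: "\<And>x. laplacian h x = 0"
    using assms by (auto simp: solid_harmonics_iff)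
  have [simp]: "real_polynomial_function h"
    using hom by simp
  define h1 where "h1 b b' = (\<lambda>x. (x \<bullet> b) * pd b' h x - (x \<bullet> b') * pd b h x)" for b b'
  define h2 where "h2 b b' = (\<lambda>x. (x \<bullet> b) * pd b' (h1 b b') x -
      (x \<bullet> b') * pd b (h1 b b') x)" for b b'
  have p1 [simp]: "real_polynomial_function (h1 b b')" for b b'
    unfolding h1_def by (intro real_polynomial_function_diff rpf_mult poly_inner poly_pd) simp_all
  have p2: "real_polynomial_function (h2 b b')" for b b'
    unfolding h2_def by (intro real_polynomial_function_diff rpf_mult poly_inner poly_pd) simp_all
  have d1: "rot_deriv b b' h (h1 b b')" and d2: "rot_deriv b b' (h1 b b') (h2 b b')" for b b'
    unfolding h2_def h1_def[of b b'] by (rule rot_deriv_poly; simp flip: h1_def)+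
  show ?thesis
  proof (rule is_LBI[of _ h1 h2])
    fix x :: 'a assume x: "x \<in> sphere 0 1"
    \<comment> \<open>The expansion of \<open>h2\<close> for distinct basis vectors. On the diagonal
      the formula gives -2 (x . b) \<open>pd b h x\<close>, which is subtracted when the sum is
      completed.\<close>
    define H where "H b b' = (x \<bullet> b)\<^sup>2 * pd b' (pd b' h) x + (x \<bullet> b')\<^sup>2 * pd b (pd b h) x
        - (x \<bullet> b) * ((x \<bullet> b') * pd b' (pd b h) x) - (x \<bullet> b') * ((x \<bullet> b) * pd b (pd b' h) x)
        - (x \<bullet> b) * pd b h x - (x \<bullet> b') * pd b' h x" for b b'
    have h2_eq: "h2 b b' x = H b b'" if b: "b \<in> Basis" "b' \<in> Basis" "b \<noteq> b'" for b b'
    proof -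
      have "pd v (h1 b b') x = (x \<bullet> b) * pd v (pd b' h) x + (v \<bullet> b) * pd b' h x
          - ((x \<bullet> b') * pd v (pd b h) x + (v \<bullet> b') * pd b h x)" for v
        unfolding h1_def by (simp add: pd_diff pd_mult rpf_mult)
      note this[of b] this[of b']
      then show ?thesis
        using b unfolding h2_def H_def
        by (simp only: inner_Basis) (simp add: power2_eq_square algebra_simps)
    qed
    have "(\<Sum>b\<in>Basis. \<Sum>b'\<in>Basis - {b}. h2 b b' x) = (\<Sum>b\<in>Basis. \<Sum>b'\<in>Basis - {b}. H b b')"
      using h2_eq by (intro sum.cong) auto
    also have "\<dots> = (\<Sum>b\<in>Basis. \<Sum>b'\<in>Basis. H b b') - (\<Sum>b\<in>Basis. H b b)"
      by (rule sum_off_diagonal)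
    also have "(\<Sum>b\<in>Basis. H b b) = - 2 * (\<Sum>b\<in>Basis. (x \<bullet> b) * pd b h x)"
      by (simp add: H_def power2_eq_square sum_distrib_left algebra_simps)
    also have "\<dots> = - 2 * (l * h x)"
      by (simp add: euler[OF hom])
    also have "(\<Sum>b\<in>Basis. \<Sum>b'\<in>Basis. H b b') =
      - 2 * (l * ((real l - 1) * h x)) - 2 * (DIM('a) * (l * h x))"
    proof -
      have xx: "(\<Sum>b\<in>Basis. (x \<bullet> b)\<^sup>2) = 1"
        using x by (simp add: euclidean_inner[of x x, symmetric] power2_eq_square dot_square_norm)
      have lap0: "(\<Sum>b\<in>Basis. pd b (pd b h) x) = 0"
        using lap[of x] by (simp add: laplacian_eq_pd)
      have e1: "(\<Sum>b\<in>Basis. (x \<bullet> b) * pd b h x) = l * h x"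
        by (rule euler[OF hom])
      have e2: "(\<Sum>b\<in>Basis. \<Sum>b'\<in>Basis. (x \<bullet> b) * ((x \<bullet> b') * pd b' (pd b h) x)) =
          l * ((real l - 1) * h x)"
      proof -
        have "(\<Sum>b\<in>Basis. \<Sum>b'\<in>Basis. (x \<bullet> b) * ((x \<bullet> b') * pd b' (pd b h) x)) =
          (real l - 1) * (\<Sum>b\<in>Basis. (x \<bullet> b) * pd b h x)"
          by (simp add: sum_distrib_left[symmetric] euler2[OF hom])
            (simp add: sum_distrib_left mult_ac)
        then show ?thesis
          by (simp add: e1)
      qed
      have e3: "(\<Sum>b\<in>Basis. \<Sum>b'\<in>Basis. (x \<bullet> b') * ((x \<bullet> b) * pd b (pd b' h) x)) =
          l * ((real l - 1) * h x)"
        by (subst sum.swap) (rule e2)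
      have s1: "(\<Sum>b\<in>Basis. \<Sum>b'\<in>Basis. (x \<bullet> b)\<^sup>2 * pd b' (pd b' h) x) = 0"
        by (simp add: sum_distrib_left[symmetric] lap0)
      have s2: "(\<Sum>b\<in>Basis. \<Sum>b'\<in>Basis. (x \<bullet> b')\<^sup>2 * pd b (pd b h) x) = 0"
        by (simp add: sum_distrib_right[symmetric] sum_distrib_left[symmetric] xx lap0)
      have s3: "(\<Sum>b\<in>Basis. \<Sum>b'\<in>(Basis :: 'a set). (x \<bullet> b) * pd b h x) = DIM('a) * (l * h x)"
        by (simp add: e1 sum_distrib_left[symmetric])
      have s4: "(\<Sum>b\<in>(Basis :: 'a set). \<Sum>b'\<in>Basis. (x \<bullet> b') * pd b' h x) = DIM('a) * (l * h x)"
        by (simp add: e1)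
      show ?thesis
        unfolding H_def sum_subtractf sum.distrib e2 e3 s1 s2 s3 s4 by simp
    qed
    finally show "- lb_eigenvalue (DIM('a) - 1) l * h x =
        (\<Sum>b\<in>Basis. \<Sum>b'\<in>Basis - {b}. h2 b b' x) / 2"
      by (simp add: lb_eigenvalue_def of_nat_diff DIM_positive Suc_leI algebra_simps)
  qed (simp_all add: poly_continuous p2 d1 d2)
qed

text \<open>Two continuous derivatives of the profile \<open>u\<close> suffice, so the formula
  applies to truncated powers and not only to polynomials.\<close>

lemma is_LB_zonal:
  fixes z :: "'a::euclidean_space"
  assumes z: "norm z = 1"
    and u: "\<And>t. (u has_real_derivative u1 t) (at t)" "\<And>t. (u1 has_real_derivative u2 t) (at t)"
      "continuous_on UNIV u2"
  shows "is_LB (\<lambda>x. u (x \<bullet> z))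
    (\<lambda>x. (1 - (x \<bullet> z)\<^sup>2) * u2 (x \<bullet> z) - (DIM('a) - 1) * (x \<bullet> z) * u1 (x \<bullet> z))"
proof -
  define f1 where "f1 b b' x = u1 (x \<bullet> z) * ((x \<bullet> b) * (b' \<bullet> z) -
      (x \<bullet> b') * (b \<bullet> z))" for b b' and x :: 'a
  define f2 where "f2 b b' x = u2 (x \<bullet> z) * ((x \<bullet> b) * (b' \<bullet> z) - (x \<bullet> b') * (b \<bullet> z))\<^sup>2
    - u1 (x \<bullet> z) * ((x \<bullet> b') * (b' \<bullet> z) + (x \<bullet> b) * (b \<bullet> z))" for b b' and x :: 'a
  have cu: "continuous_on UNIV u" "continuous_on UNIV u1"
    using u by (auto intro!: DERIV_continuous_on)
  have cont: "continuous_on A (\<lambda>x. u (x \<bullet> z))" "continuous_on A (\<lambda>x. u1 (x \<bullet> z))"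
    "continuous_on A (\<lambda>x. u2 (x \<bullet> z))" for A
    by (rule continuous_on_compose2[of UNIV]; (intro cu u(3) continuous_intros subset_UNIV))+
  show ?thesis
  proof (rule is_LBI[of _ f1 f2])
    fix b b' :: 'a assume b: "b \<in> Basis" "b' \<in> Basis" "b \<noteq> b'"
    show "rot_deriv b b' (\<lambda>x. u (x \<bullet> z)) (f1 b b')"
      unfolding f1_def by (intro rot_deriv_compose rot_deriv_inner u)
    have 1: "rot_deriv b b' (\<lambda>x. (b' \<bullet> z) * (x \<bullet> b) + (- (b \<bullet> z)) * (x \<bullet> b'))
      (\<lambda>x. (b' \<bullet> z) * ((x \<bullet> b) * (b' \<bullet> b) - (x \<bullet> b') * (b \<bullet> b)) +
        (- (b \<bullet> z)) * ((x \<bullet> b) * (b' \<bullet> b') - (x \<bullet> b') * (b \<bullet> b')))"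
      by (intro rot_deriv_add rot_deriv_cmult rot_deriv_inner)
    have "rot_deriv b b' (\<lambda>x. u1 (x \<bullet> z) * ((b' \<bullet> z) * (x \<bullet> b) + (- (b \<bullet> z)) * (x \<bullet> b')))
      (\<lambda>x. u2 (x \<bullet> z) * ((x \<bullet> b) * (b' \<bullet> z) - (x \<bullet> b') * (b \<bullet> z)) *
          ((b' \<bullet> z) * (x \<bullet> b) + (- (b \<bullet> z)) * (x \<bullet> b')) +
        u1 (x \<bullet> z) * ((b' \<bullet> z) * ((x \<bullet> b) * (b' \<bullet> b) - (x \<bullet> b') * (b \<bullet> b)) +
        (- (b \<bullet> z)) * ((x \<bullet> b) * (b' \<bullet> b') - (x \<bullet> b') * (b \<bullet> b'))))"
      by (intro rot_deriv_mult 1 rot_deriv_compose rot_deriv_inner u)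
    moreover have "(\<lambda>x. u1 (x \<bullet> z) * ((b' \<bullet> z) * (x \<bullet> b) + (- (b \<bullet> z)) * (x \<bullet> b'))) = f1 b b'"
      by (simp add: f1_def fun_eq_iff mult_ac)
    moreover have "(\<lambda>x. u2 (x \<bullet> z) * ((x \<bullet> b) * (b' \<bullet> z) - (x \<bullet> b') * (b \<bullet> z)) *
          ((b' \<bullet> z) * (x \<bullet> b) + (- (b \<bullet> z)) * (x \<bullet> b')) +
        u1 (x \<bullet> z) * ((b' \<bullet> z) * ((x \<bullet> b) * (b' \<bullet> b) - (x \<bullet> b') * (b \<bullet> b)) +
        (- (b \<bullet> z)) * ((x \<bullet> b) * (b' \<bullet> b') - (x \<bullet> b') * (b \<bullet> b')))) = f2 b b'"
      using b by (simp add: f2_def fun_eq_iff inner_Basis power2_eq_square algebra_simps)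
    ultimately show "rot_deriv b b' (f1 b b') (f2 b b')"
      by simp
    show "continuous_on (sphere 0 1) (f1 b b')" "continuous_on (sphere 0 1) (f2 b b')"
      unfolding f1_def f2_def by (intro continuous_intros cont)+
  next
    fix x :: 'a assume x: "x \<in> sphere 0 1"
    have xz: "(\<Sum>b\<in>Basis. (x \<bullet> b) * (b \<bullet> z)) = x \<bullet> z"
      by (subst euclidean_inner[of x z]) (simp add: inner_commute)
    have xx: "(\<Sum>b\<in>Basis. (x \<bullet> b)\<^sup>2) = 1" "(\<Sum>b\<in>Basis. (b \<bullet> z)\<^sup>2) = 1"
      using x z euclidean_inner[of x x] euclidean_inner[of z z]
      by (simp_all add: power2_eq_square dot_square_norm inner_commute)
    \<comment> \<open>Lagrange's identity: the squared minors of two unit vectors sum to 2 (1 - (x .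
      z)^2), each plane being counted twice.\<close>
    have "(\<Sum>b\<in>Basis. \<Sum>b'\<in>Basis. ((x \<bullet> b) * (b' \<bullet> z) - (x \<bullet> b') * (b \<bullet> z))\<^sup>2) =
        (\<Sum>b\<in>Basis. \<Sum>b'\<in>Basis. (x \<bullet> b)\<^sup>2 * (b' \<bullet> z)\<^sup>2) +
        (\<Sum>b\<in>Basis. \<Sum>b'\<in>Basis. (b \<bullet> z)\<^sup>2 * (x \<bullet> b')\<^sup>2) -
        2 * (\<Sum>b\<in>Basis. \<Sum>b'\<in>Basis. ((x \<bullet> b) * (b \<bullet> z)) * ((x \<bullet> b') * (b' \<bullet> z)))"
      by (simp add: power2_diff power_mult_distrib sum.distrib sum_subtractf sum_distrib_left
          mult_ac)
    also have "\<dots> = 2 * (1 - (x \<bullet> z)\<^sup>2)"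
      unfolding sum_product[symmetric] xx xz by (simp add: power2_eq_square)
    finally have A: "(\<Sum>b\<in>Basis. \<Sum>b'\<in>Basis. ((x \<bullet> b) * (b' \<bullet> z) - (x \<bullet> b') * (b \<bullet> z))\<^sup>2) =
        2 * (1 - (x \<bullet> z)\<^sup>2)" .
    have B: "(\<Sum>b\<in>(Basis::'a set). \<Sum>b'\<in>Basis. (x \<bullet> b') * (b' \<bullet> z) + (x \<bullet> b) * (b \<bullet> z)) =
        2 * DIM('a) * (x \<bullet> z)"
      by (simp add: sum.distrib xz sum_distrib_left[symmetric])
    have C: "(\<Sum>b\<in>(Basis::'a set). (x \<bullet> b) * (b \<bullet> z) + (x \<bullet> b) * (b \<bullet> z)) = 2 * (x \<bullet> z)"
      unfolding sum.distrib xz by simp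
    have "(\<Sum>b\<in>Basis. \<Sum>b'\<in>Basis - {b}. f2 b b' x) =
        u2 (x \<bullet> z) * (2 * (1 - (x \<bullet> z)\<^sup>2)) - u1 (x \<bullet> z) * (2 * DIM('a) * (x \<bullet> z)) +
            u1 (x \<bullet> z) * (2 * (x \<bullet> z))"
      unfolding sum_off_diagonal f2_def sum_subtractf sum_distrib_left[symmetric] A B C
      by (simp add: algebra_simps)
    then show "(1 - (x \<bullet> z)\<^sup>2) * u2 (x \<bullet> z) - (DIM('a) - 1) * (x \<bullet> z) * u1 (x \<bullet> z) =
        (\<Sum>b\<in>Basis. \<Sum>b'\<in>Basis - {b}. f2 b b' x) / 2"
      by (simp add: of_nat_diff DIM_positive Suc_leI algebra_simps)
  qed (rule cont)
qed

subsection \<open>Projections onto spherical harmonics\<close>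

definition sphere_inner :: "('a::euclidean_space \<Rightarrow> real) \<Rightarrow> ('a \<Rightarrow> real) \<Rightarrow> real" where
  "sphere_inner f g = (\<integral>x. f x * g x \<partial>sphere_measure)"

lemma sphere_inner_commute: "sphere_inner f g = sphere_inner g f"
  by (simp add: sphere_inner_def mult.commute)

lemma sphere_integrable_mult:
  fixes f g :: "'a::euclidean_space \<Rightarrow> real"
  assumes "continuous_on (sphere 0 1) f" "integrable sphere_measure g"
  shows "integrable sphere_measure (\<lambda>x. f x * g x)"
proof -
  obtain B where B: "\<And>x. x \<in> sphere 0 1 \<Longrightarrow> \<bar>f x\<bar> \<le> B"
    using sphere_bounded_continuous[OF assms(1)] by blast
  show ?thesis
  proof (rule Bochner_Integration.integrable_bound)
    show "integrable sphere_measure (\<lambda>x. B * \<bar>g x\<bar>)"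
      using assms(2) by simp
    show "(\<lambda>x. f x * g x) \<in> borel_measurable sphere_measure"
      using assms(2) by (intro borel_measurable_times sphere_borel_measurable_continuous[OF
          assms(1)]) auto
    have "\<bar>f x\<bar> * \<bar>g x\<bar> \<le> \<bar>B\<bar> * \<bar>g x\<bar>" if "x \<in> sphere 0 1" for x
      using B[OF that] by (intro mult_right_mono) auto
    then show "AE x in sphere_measure. norm (f x * g x) \<le> norm (B * \<bar>g x\<bar>)"
      by (intro AE_I2) (simp add: abs_mult)
  qed
qed

lemma sphere_inner_add_right:
  assumes "continuous_on (sphere 0 1) f" "integrable sphere_measure g" "integrable sphere_measure h"
  shows "sphere_inner f (\<lambda>x. g x + h x) = sphere_inner f g + sphere_inner f h"
  unfolding sphere_inner_def using assms
  by (simp add: distrib_left sphere_integrable_mult)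

lemma sphere_inner_diff_right:
  assumes "continuous_on (sphere 0 1) f" "integrable sphere_measure g" "integrable sphere_measure h"
  shows "sphere_inner f (\<lambda>x. g x - h x) = sphere_inner f g - sphere_inner f h"
  unfolding sphere_inner_def using assms
  by (simp add: right_diff_distrib sphere_integrable_mult)

lemma sphere_inner_cmult_right: "sphere_inner f (\<lambda>x. c * g x) = c * sphere_inner f g"
  by (simp add: sphere_inner_def mult.left_commute)

lemma sphere_inner_sum_right:
  assumes "finite I" "continuous_on (sphere 0 1) f" "\<And>i. i \<in> I \<Longrightarrow> integrable sphere_measure (g i)"
  shows "sphere_inner f (\<lambda>x. \<Sum>i\<in>I. g i x) = (\<Sum>i\<in>I. sphere_inner f (g i))"
  unfolding sphere_inner_def sum_distrib_left using assms
  by (intro Bochner_Integration.integral_sum sphere_integrable_mult) auto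

lemma sphere_inner_cong:
  assumes "\<And>x. x \<in> sphere 0 1 \<Longrightarrow> f x = f' x" "\<And>x. x \<in> sphere 0 1 \<Longrightarrow> g x = g' x"
  shows "sphere_inner f g = sphere_inner f' g'"
  unfolding sphere_inner_def using assms by (intro sphere_integral_cong) simp

lemma orthonormal_coefficients:
  fixes e :: "nat \<Rightarrow> 'a::euclidean_space \<Rightarrow> real"
  assumes "\<And>i. i < k \<Longrightarrow> continuous_on (sphere 0 1) (e i)"
    and "\<And>i j. \<lbrakk>i < k; j < k\<rbrakk> \<Longrightarrow> sphere_inner (e i) (e j) = (if i = j then 1 else 0)"
    and "\<And>x. x \<in> sphere 0 1 \<Longrightarrow> f x = (\<Sum>i<k. b i * e i x)" and "j < k"
  shows "sphere_inner (e j) f = b j"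
proof -
  have "sphere_inner (e j) f = sphere_inner (e j) (\<lambda>x. \<Sum>i<k. b i * e i x)"
    using assms(3) by (intro sphere_inner_cong) auto
  also have "\<dots> = (\<Sum>i<k. b i * sphere_inner (e j) (e i))"
    using assms(1,4) by (subst sphere_inner_sum_right)
      (auto simp: sphere_inner_cmult_right
          intro!: sphere_integrable_continuous continuous_on_mult_left)
  also have "\<dots> = (\<Sum>i<k. b i * (if j = i then 1 else 0))"
    using assms(2,4) by (intro sum.cong) auto
  also have "\<dots> = b j"
    using assms(4) by (simp add: if_distrib cong: if_cong)
  finally show ?thesis .
qed

text \<open>Gram-Schmidt by induction on the spanning set. One element \<open>v\<close> of
  \<open>V\<close> outside \<open>fspan B\<close> absorbs the coordinate along \<open>m\<close>, so
  \<open>V\<close> is \<open>V \<inter> fspan B\<close> plus at most one new direction. Expansions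
  hold on the sphere only, because the inner product sees nothing else.\<close>

lemma orthonormal_basis_exists:
  fixes V :: "('a::euclidean_space \<Rightarrow> real) set"
  assumes "finite B" "V \<subseteq> fspan B"
    and "\<And>f. f \<in> V \<Longrightarrow> continuous_on (sphere 0 1) f"
    and "\<And>f g. f \<in> V \<Longrightarrow> g \<in> V \<Longrightarrow> (\<lambda>x. f x + g x) \<in> V"
    and "\<And>f c. f \<in> V \<Longrightarrow> (\<lambda>x. c * f x) \<in> V"
    and "(\<lambda>x. 0) \<in> V"
  shows "\<exists>(k::nat) e. (\<forall>i<k. e i \<in> V) \<and>
    (\<forall>i<k. \<forall>j<k. sphere_inner (e i) (e j) = (if i = j then 1 else (0::real))) \<and>
    (\<forall>f\<in>V. \<forall>x\<in>sphere 0 1. f x = (\<Sum>i<k. sphere_inner (e i) f * e i x))"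
  using assms
proof (induction B arbitrary: V rule: finite_induct)
  case empty
  have "f \<in> fspan {} \<Longrightarrow> f = (\<lambda>x. 0)" for f :: "'a \<Rightarrow> real"
    by (induction rule: fspan.induct) auto
  then have zero: "f = (\<lambda>x. 0)" if "f \<in> V" for f
    using that empty.prems(1) by blast
  show ?case
    by (rule exI[of _ "0::nat"], rule exI[of _ "\<lambda>(_::nat) (_::'a). 0::real"]) (auto dest: zero)
next
  case (insert m B)
  note V = insert.prems
  have Vdiff: "(\<lambda>x. f x - c * g x) \<in> V" if "f \<in> V" "g \<in> V" for f g c
    using V(3)[OF that(1) V(4)[OF that(2), of "- c"]] by simp
  define V' where "V' = V \<inter> fspan B"
  have "\<exists>(k::nat) e. (\<forall>i<k. e i \<in> V') \<and>
    (\<forall>i<k. \<forall>j<k. sphere_inner (e i) (e j) = (if i = j then 1 else (0::real))) \<and>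
    (\<forall>f\<in>V'. \<forall>x\<in>sphere 0 1. f x = (\<Sum>i<k. sphere_inner (e i) f * e i x))"
    unfolding V'_def using V by (intro insert.IH) (auto intro: fspan_add fspan_cmult fspan.zero)
  then obtain k :: nat and e where e: "\<And>i. i < k \<Longrightarrow> e i \<in> V'"
    "\<And>i j. \<lbrakk>i < k; j < k\<rbrakk> \<Longrightarrow> sphere_inner (e i) (e j) = (if i = j then 1 else (0::real))"
    "\<And>f x. f \<in> V' \<Longrightarrow> x \<in> sphere 0 1 \<Longrightarrow> f x = (\<Sum>i<k. sphere_inner (e i) f * e i x)"
    by blast
  have eV: "e i \<in> V" and ec: "continuous_on (sphere 0 1) (e i)" if "i < k" for i
    using e(1)[OF that] V(2) by (auto simp: V'_def)
  show ?case
  proof (cases "V \<subseteq> fspan B")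
    case True
    then have "V' = V"
      by (auto simp: V'_def)
    with e show ?thesis
      by (intro exI[of _ k] exI[of _ e]) auto
  next
    case False
    then obtain v where v: "v \<in> V" "v \<notin> fspan B"
      by blast
    obtain c where c: "(\<lambda>x. v x - c * m x) \<in> fspan B"
      using fspan_insert v(1) V(1) by blast
    have "c \<noteq> 0"
      using c v(2) by auto
    \<comment> \<open>If \<open>a\<close> and \<open>c\<close> are the coordinates of
      \<open>f\<close> and \<open>v\<close> along \<open>m\<close>, subtracting \<open>a / c\<close>
      times \<open>v\<close> removes \<open>m\<close> from \<open>f\<close>.\<close>
    have ex_a: "\<exists>a. (\<lambda>x. f x - a * v x) \<in> V'" if f: "f \<in> V" for f
    proof -
      obtain a where a: "(\<lambda>x. f x - a * m x) \<in> fspan B"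
        using fspan_insert f V(1) by blast
      have "(\<lambda>x. (f x - a * m x) + (- a / c) * (v x - c * m x)) \<in> fspan B"
        by (intro fspan_add fspan_cmult a c)
      also have "(\<lambda>x. (f x - a * m x) + (- a / c) * (v x - c * m x)) = (\<lambda>x. f x - (a / c) * v x)"
        using \<open>c \<noteq> 0\<close> by (simp add: fun_eq_iff field_simps)
      finally show ?thesis
        using Vdiff[OF f v(1), of "a / c"] by (auto simp: V'_def intro!: exI[of _ "a / c"])
    qed
    define w where "w x = v x - (\<Sum>i<k. sphere_inner (e i) v * e i x)" for x
    have sumV: "(\<lambda>x. \<Sum>i\<in>I. b i * e i x) \<in> V" if "finite I" "I \<subseteq> {..<k}" for I b
      using that
    proof (induction I rule: finite_induct)
      case (insert i I)
      then show ?case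
        using V(3)[OF V(4)[OF eV]] by auto
    qed (simp add: V(5))
    have wV: "w \<in> V"
      unfolding w_def using Vdiff[OF v(1) sumV[of "{..<k}"], of 1] by simp
    have wc: "continuous_on (sphere 0 1) w"
      by (rule V(2)[OF wV])
    have w_orth: "sphere_inner (e j) w = 0" if "j < k" for j
    proof -
      have "sphere_inner (e j) (\<lambda>x. \<Sum>i<k. sphere_inner (e i) v * e i x) = sphere_inner (e j) v"
        by (rule orthonormal_coefficients[OF ec e(2) _ that]) auto
      moreover have "continuous_on (sphere 0 1) (\<lambda>x. \<Sum>i<k. sphere_inner (e i) v * e i x)"
        by (intro V(2) sumV) auto
      ultimately show ?thesis
        unfolding w_def using that V(2)[OF v(1)]
        by (subst sphere_inner_diff_right) (auto intro!: sphere_integrable_continuous ec)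
    qed
    have rep: "\<exists>a b. \<forall>x\<in>sphere 0 1. f x = a * w x + (\<Sum>i<k. b i * e i x)" if f: "f \<in> V" for f
    proof -
      obtain a where a: "(\<lambda>x. f x - a * v x) \<in> V'"
        using ex_a[OF f] by blast
      define g where "g = (\<lambda>x. f x - a * v x)"
      have "f x = a * w x + (\<Sum>i<k. (sphere_inner (e i) g + a * sphere_inner (e i) v) * e i x)"
        if "x \<in> sphere 0 1" for x
      proof -
        have "f x = a * v x + g x"
          by (simp add: g_def)
        also have "g x = (\<Sum>i<k. sphere_inner (e i) g * e i x)"
          using e(3)[OF a that] by (simp add: g_def)
        finally show ?thesis
          by (simp add: w_def sum.distrib sum_distrib_left algebra_simps)
      qed
      then show ?thesis
        by (intro exI[of _ a] exI[of _ "\<lambda>i. sphere_inner (e i) g + a * sphere_inner (e i) v"]) simp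
    qed
    define N where "N = sphere_inner w w"
    have w2: "continuous_on (sphere 0 1) (\<lambda>x. w x * w x)"
      by (intro continuous_intros wc)
    show ?thesis
    proof (cases "N = 0")
      \<comment> \<open>The orthogonal remainder can vanish on the sphere without vanishing
        identically; the old basis then already expands all of \<open>V\<close> there.\<close>
      case True
      have "w x = 0" if "x \<in> sphere 0 1" for x
        using sphere_integral_zero_imp_zero[OF w2, of x] True that
        by (simp add: N_def sphere_inner_def)
      have "f x = (\<Sum>i<k. sphere_inner (e i) f * e i x)" if f: "f \<in> V" and x: "x \<in> sphere 0 1" for
          f x
      proof -
        obtain b where b: "\<And>x. x \<in> sphere 0 1 \<Longrightarrow> f x = (\<Sum>i<k. b i * e i x)"
          using rep[OF f] \<open>\<And>x. x \<in> sphere 0 1 \<Longrightarrow> w x = 0\<close> by auto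
        then show ?thesis
          using orthonormal_coefficients[OF ec e(2) b] x by simp
      qed
      then show ?thesis
        using e(2) eV by (intro exI[of _ k] exI[of _ e]) auto
    next
      case False
      have "N \<ge> 0"
        unfolding N_def sphere_inner_def by (intro Bochner_Integration.integral_nonneg) simp
      with False have N: "N > 0" by simp
      define e' where "e' i = (if i < k then e i else (\<lambda>x. (1 / sqrt N) * w x))" for i
      have e'V: "e' i \<in> V" for i
        using eV V(4)[OF wV, of "1 / sqrt N"] by (simp add: e'_def)
      have e'c: "continuous_on (sphere 0 1) (e' i)" for i
        by (rule V(2)[OF e'V])
      have orth: "sphere_inner (e' i) (e' j) = (if i = j then 1 else 0)" if "i < Suc k"
          "j < Suc k" for i j
      proof -
        have "i < k \<or> i = k" "j < k \<or> j = k"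
          using that by auto
        then show ?thesis
        proof (elim disjE)
          assume "i < k" "j < k"
          then show ?thesis using e(2) by (simp add: e'_def)
        next
          assume "i < k" "j = k"
          then show ?thesis
            using w_orth by (simp add: e'_def sphere_inner_cmult_right del: times_divide_eq_left)
        next
          assume "i = k" "j < k"
          then show ?thesis
            using w_orth by (subst sphere_inner_commute)
              (simp add: e'_def sphere_inner_cmult_right del: times_divide_eq_left)
        next
          assume "i = k" "j = k"
          have "sphere_inner (\<lambda>x. (1 / sqrt N) * w x) (\<lambda>x. (1 / sqrt N) * w x) =
              (1 / sqrt N) * ((1 / sqrt N) * N)"
            unfolding sphere_inner_cmult_right N_def
            by (subst sphere_inner_commute) (simp only: sphere_inner_cmult_right)
          then show ?thesis
            using \<open>i = k\<close> \<open>j = k\<close> N by (simp add: e'_def real_div_sqrt field_simps)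
        qed
      qed
      have "f x = (\<Sum>i<Suc k. sphere_inner (e' i) f * e' i x)" if f: "f \<in> V" and x: "x \<in> sphere 0
          1" for f x
      proof -
        obtain a b where ab: "\<And>x. x \<in> sphere 0 1 \<Longrightarrow> f x = a * w x + (\<Sum>i<k. b i * e i x)"
          using rep[OF f] by blast
        define b' where "b' i = (if i < k then b i else a * sqrt N)" for i
        have b': "f x = (\<Sum>i<Suc k. b' i * e' i x)" if "x \<in> sphere 0 1" for x
          using ab[OF that] N by (simp add: b'_def e'_def)
        then show ?thesis
          using orthonormal_coefficients[OF e'c orth b'] x by simp
      qed
      then show ?thesis
        using orth e'V by (intro exI[of _ "Suc k"] exI[of _ e']) auto
    qed
  qed
qed

section \<open>Orthonormal bases of harmonics and the zonal kernel\<close>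

lemma solid_harmonics_continuous:
  "h \<in> solid_harmonics l \<Longrightarrow> continuous_on A h"
  by (auto simp: solid_harmonics_iff intro!: poly_continuous dest: hom_polyD)

lemma solid_harmonics_basis:
  obtains k :: nat and e :: "nat \<Rightarrow> 'a::euclidean_space \<Rightarrow> real"
  where "\<And>i. i < k \<Longrightarrow> e i \<in> solid_harmonics l"
    "\<And>i j. \<lbrakk>i < k; j < k\<rbrakk> \<Longrightarrow> sphere_inner (e i) (e j) = (if i = j then 1 else 0)"
    "\<And>h x. \<lbrakk>h \<in> solid_harmonics l; x \<in> sphere 0 1\<rbrakk> \<Longrightarrow> h x = (\<Sum>i<k. sphere_inner (e i) h * e i x)"
proof -
  obtain B :: "('a \<Rightarrow> real) set" where B: "finite B" "{P. hom_poly l P} \<subseteq> fspan B"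
    using hom_poly_finite_span by blast
  have "solid_harmonics l \<subseteq> fspan B"
    using B(2) by (auto simp: solid_harmonics_iff)
  then have "\<exists>(k::nat) e. (\<forall>i<k. e i \<in> solid_harmonics l) \<and>
    (\<forall>i<k. \<forall>j<k. sphere_inner (e i) (e j) = (if i = j then 1 else (0::real))) \<and>
    (\<forall>f\<in>solid_harmonics l. \<forall>x\<in>sphere 0 (1::real).
      f (x::'a) = (\<Sum>i<k. sphere_inner (e i) f * e i x))"
  proof (rule orthonormal_basis_exists[OF B(1)])
    show "continuous_on (sphere 0 1) f" if "f \<in> solid_harmonics l" for f :: "'a \<Rightarrow> real"
      using that by (rule solid_harmonics_continuous)
    show "(\<lambda>x. f x + g x) \<in> solid_harmonics l"
      if "f \<in> solid_harmonics l" "g \<in> solid_harmonics l" for f g :: "'a \<Rightarrow> real"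
      using that by (rule solid_harmonics_add)
    show "(\<lambda>x. c * f x) \<in> solid_harmonics l" if "f \<in> solid_harmonics l" for f :: "'a \<Rightarrow> real" and c
      using that by (rule solid_harmonics_cmult)
  qed (rule solid_harmonics_0)
  then obtain k :: nat and e where "(\<forall>i<k. e i \<in> solid_harmonics l) \<and>
    (\<forall>i<k. \<forall>j<k. sphere_inner (e i) (e j) = (if i = j then 1 else (0::real))) \<and>
    (\<forall>f\<in>solid_harmonics l. \<forall>x\<in>sphere 0 (1::real).
      f (x::'a) = (\<Sum>i<k. sphere_inner (e i) f * e i x))"
    by (elim exE)
  then show thesis
    by (intro that[of k e]) auto
qed

text \<open>Resolves the definite description in \<open>zonal_kernel\<close>. The sum over an
  orthonormal basis reproduces; for uniqueness, two candidates give the same inner product with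
  their difference \<open>D\<close>, namely \<open>D x\<close>, so \<open>D\<close> has norm
  0.\<close>

lemma zonal_kernel_eq:
  fixes e :: "nat \<Rightarrow> 'a::euclidean_space \<Rightarrow> real"
  assumes e: "\<And>i. i < k \<Longrightarrow> e i \<in> solid_harmonics l"
    "\<And>i j. \<lbrakk>i < k; j < k\<rbrakk> \<Longrightarrow> sphere_inner (e i) (e j) = (if i = j then 1 else 0)"
    "\<And>h x. \<lbrakk>h \<in> solid_harmonics l; x \<in> sphere 0 1\<rbrakk> \<Longrightarrow> h x = (\<Sum>i<k. sphere_inner (e i) h * e i x)"
    and x: "x \<in> sphere 0 1"
  shows "zonal_kernel l x = restrict (\<lambda>y. \<Sum>i<k. e i x * e i y) (sphere 0 1)"
proof -
  define K where "K = (\<lambda>y. \<Sum>i<k. e i x * e i y)"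
  have K: "K \<in> solid_harmonics l"
    unfolding K_def using e(1) by (intro solid_harmonics_sum solid_harmonics_cmult) auto
  have inner_restrict: "(\<integral>y. restrict f (sphere 0 1) y * restrict g (sphere 0 1) y
      \<partial>sphere_measure) =
      sphere_inner f g" for f g :: "'a \<Rightarrow> real"
    unfolding sphere_inner_def by (intro sphere_integral_cong) simp
  have repr: "sphere_inner K h = h x" if h: "h \<in> solid_harmonics l" for h
  proof -
    have "sphere_inner K h = sphere_inner h K"
      by (rule sphere_inner_commute)
    also have "\<dots> = (\<Sum>i<k. e i x * sphere_inner h (e i))"
      unfolding K_def using h e(1)
      by (subst sphere_inner_sum_right)
        (auto simp: sphere_inner_cmult_right intro!: solid_harmonics_continuous
          sphere_integrable_continuous continuous_on_mult_left)
    also have "\<dots> = h x"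
      using e(3)[OF h x] by (simp add: sphere_inner_commute mult.commute)
    finally show ?thesis .
  qed
  show ?thesis
    unfolding zonal_kernel_def K_def[symmetric]
  proof (rule the_equality)
    show "restrict K (sphere 0 1) \<in> spherical_harmonics l \<and>
      (\<forall>h\<in>spherical_harmonics l. (\<integral>y. restrict K (sphere 0 1) y * h y \<partial>sphere_measure) = h x)"
    proof (intro conjI ballI)
      show "restrict K (sphere 0 1) \<in> spherical_harmonics l"
        using K by (simp add: spherical_harmonics_def)
      fix h :: "'a \<Rightarrow> real" assume "h \<in> spherical_harmonics l"
      then obtain h' where h': "h = restrict h' (sphere 0 1)" "h' \<in> solid_harmonics l"
        unfolding spherical_harmonics_def by blast
      then show "(\<integral>y. restrict K (sphere 0 1) y * h y \<partial>sphere_measure) = h x"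
        using repr[OF h'(2)] x unfolding h'(1) inner_restrict by simp
    qed
  next
    fix k' assume k': "k' \<in> spherical_harmonics l \<and>
      (\<forall>h\<in>spherical_harmonics l. (\<integral>y. k' y * h y \<partial>sphere_measure) = h x)"
    then obtain P where P: "P \<in> solid_harmonics l" "k' = restrict P (sphere 0 1)"
      by (auto simp: spherical_harmonics_def)
    have reprP: "sphere_inner P h = h x" if h: "h \<in> solid_harmonics l" for h
    proof -
      have "restrict h (sphere 0 1) \<in> spherical_harmonics l"
        using h by (auto simp: spherical_harmonics_def)
      then have "(\<integral>y. k' y * restrict h (sphere 0 1) y \<partial>sphere_measure) = restrict h (sphere 0 1) x"
        using k' by blast
      then show ?thesis
        using x unfolding P(2) inner_restrict by simp
    qed
    define D where "D = (\<lambda>y. P y + (- 1) * K y)"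
    have D: "D \<in> solid_harmonics l"
      unfolding D_def by (intro solid_harmonics_add solid_harmonics_cmult P K)
    have Dc: "continuous_on (sphere 0 1) D"
      by (rule solid_harmonics_continuous[OF D])
    have "sphere_inner D D = sphere_inner D P + (- 1) * sphere_inner D K"
      unfolding D_def[unfolded D_def, of] using P K Dc
      by (subst (2) D_def, subst sphere_inner_add_right)
        (auto simp: sphere_inner_cmult_right[of _ "-1", simplified]
            intro!: sphere_integrable_continuous
          solid_harmonics_continuous continuous_intros)
    also have "\<dots> = 0"
      using reprP[OF D] repr[OF D] by (simp add: sphere_inner_commute)
    finally have "D y = 0" if "y \<in> sphere 0 1" for y
      using sphere_integral_zero_imp_zero[of "\<lambda>x. D x * D x" y] that Dc
      by (simp add: sphere_inner_def continuous_on_mult)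
    then show "k' = restrict K (sphere 0 1)"
      unfolding P(2) by (auto simp: D_def restrict_def)
  qed
qed

lemma harmonic_proj_eq:
  fixes e :: "nat \<Rightarrow> 'a::euclidean_space \<Rightarrow> real"
  assumes e: "\<And>i. i < k \<Longrightarrow> e i \<in> solid_harmonics l"
    "\<And>i j. \<lbrakk>i < k; j < k\<rbrakk> \<Longrightarrow> sphere_inner (e i) (e j) = (if i = j then 1 else 0)"
    "\<And>h x. \<lbrakk>h \<in> solid_harmonics l; x \<in> sphere 0 1\<rbrakk> \<Longrightarrow> h x = (\<Sum>i<k. sphere_inner (e i) h * e i x)"
    and x: "x \<in> sphere 0 1" and f: "integrable sphere_measure f"
  shows "harmonic_proj l f x = (\<Sum>i<k. sphere_inner (e i) f * e i x)"
proof -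
  have kernel: "zonal_kernel l x = restrict (\<lambda>y. \<Sum>i<k. e i x * e i y) (sphere 0 1)"
    by (rule zonal_kernel_eq[OF e x])
  have "harmonic_proj l f x = (\<integral>y. (\<Sum>i<k. e i x * (e i y * f y)) \<partial>sphere_measure)"
    unfolding harmonic_proj_def kernel
    by (intro sphere_integral_cong) (simp add: sum_distrib_right mult.assoc)
  also have "\<dots> = (\<Sum>i<k. \<integral>y. e i x * (e i y * f y) \<partial>sphere_measure)"
    using e(1) f by (intro Bochner_Integration.integral_sum integrable_mult_right
        sphere_integrable_mult solid_harmonics_continuous) auto
  finally show ?thesis
    by (simp add: sphere_inner_def mult.commute)
qed

text \<open>Reduces \<open>bessel_image\<close> to inner products with single harmonics, where the
  operators below are computed.\<close>

lemma harmonic_proj_scaled: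
  assumes "integrable sphere_measure f" "integrable sphere_measure g" "x \<in> sphere 0 1"
    and "\<And>h. h \<in> solid_harmonics l \<Longrightarrow> sphere_inner h g = c * sphere_inner h f"
  shows "harmonic_proj l g x = c * harmonic_proj l f x"
proof (rule solid_harmonics_basis[of l])
  fix k :: nat and e :: "nat \<Rightarrow> 'a \<Rightarrow> real"
  assume e: "\<And>i. i < k \<Longrightarrow> e i \<in> solid_harmonics l"
    "\<And>i j. \<lbrakk>i < k; j < k\<rbrakk> \<Longrightarrow> sphere_inner (e i) (e j) = (if i = j then 1 else 0)"
    "\<And>h x. \<lbrakk>h \<in> solid_harmonics l; x \<in> sphere 0 1\<rbrakk> \<Longrightarrow> h x = (\<Sum>i<k. sphere_inner (e i) h * e i x)"
  have "harmonic_proj l g x = (\<Sum>i<k. sphere_inner (e i) g * e i x)"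
    by (rule harmonic_proj_eq[OF e assms(3,2)])
  also have "\<dots> = (\<Sum>i<k. c * (sphere_inner (e i) f * e i x))"
    by (intro sum.cong) (simp_all add: assms(4)[OF e(1)])
  also have "\<dots> = c * (\<Sum>i<k. sphere_inner (e i) f * e i x)"
    by (simp add: sum_distrib_left)
  also have "(\<Sum>i<k. sphere_inner (e i) f * e i x) = harmonic_proj l f x"
    by (rule harmonic_proj_eq[OF e assms(3,1), symmetric])
  finally show ?thesis .
qed

text \<open>Pairing the projection with the basis functions returns the coefficients of
  \<open>f\<close>; the expansion of \<open>h\<close> in the same basis then determines its inner
  product.\<close>

lemma harmonic_proj_cong_imp_inner_eq:
  assumes f: "integrable sphere_measure f" and g: "integrable sphere_measure g"
    and eq: "\<And>x. x \<in> sphere 0 1 \<Longrightarrow> harmonic_proj l f x = harmonic_proj l g x"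
    and h: "h \<in> solid_harmonics l"
  shows "sphere_inner h f = sphere_inner h g"
proof (rule solid_harmonics_basis[of l])
  fix k :: nat and e :: "nat \<Rightarrow> 'a \<Rightarrow> real"
  assume e: "\<And>i. i < k \<Longrightarrow> e i \<in> solid_harmonics l"
    "\<And>i j. \<lbrakk>i < k; j < k\<rbrakk> \<Longrightarrow> sphere_inner (e i) (e j) = (if i = j then 1 else 0)"
    "\<And>h x. \<lbrakk>h \<in> solid_harmonics l; x \<in> sphere 0 1\<rbrakk> \<Longrightarrow> h x = (\<Sum>i<k. sphere_inner (e i) h * e i x)"
  have ec: "continuous_on (sphere 0 1) (e i)" if "i < k" for i
    using e(1)[OF that] by (rule solid_harmonics_continuous)
  have coeff: "sphere_inner (e i) f = sphere_inner (e i) g" if "i < k" for i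
  proof -
    have "sphere_inner (e i) (harmonic_proj l f) = sphere_inner (e i) f"
      using harmonic_proj_eq[OF e _ f] by (intro orthonormal_coefficients[OF ec e(2) _ that])
    moreover have "sphere_inner (e i) (harmonic_proj l g) = sphere_inner (e i) g"
      using harmonic_proj_eq[OF e _ g] by (intro orthonormal_coefficients[OF ec e(2) _ that])
    moreover have "sphere_inner (e i) (harmonic_proj l f) = sphere_inner (e i) (harmonic_proj l g)"
      using eq by (intro sphere_inner_cong) auto
    ultimately show ?thesis by simp
  qed
  have "sphere_inner h u = (\<Sum>i<k. sphere_inner (e i) h * sphere_inner (e i) u)"
    if u: "integrable sphere_measure u" for u
  proof -
    have "sphere_inner h u = (\<integral>x. (\<Sum>i<k. sphere_inner (e i) h * (e i x * u x)) \<partial>sphere_measure)"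
      unfolding sphere_inner_def
      by (intro sphere_integral_cong)
        (simp add: e(3)[OF h, unfolded sphere_inner_def] sum_distrib_right mult.assoc)
    also have "\<dots> = (\<Sum>i<k. \<integral>x. sphere_inner (e i) h * (e i x * u x) \<partial>sphere_measure)"
      using ec u by (intro Bochner_Integration.integral_sum integrable_mult_right
          sphere_integrable_mult) auto
    finally show ?thesis
      by (simp add: sphere_inner_def)
  qed
  then show ?thesis
    using coeff f g by simp
qed

text \<open>Completeness of the harmonics: orthogonality to them passes to polynomials, by
  Stone-Weierstrass to continuous functions, and from these to almost everywhere. It makes the
  choice inside \<open>sobolev_norm\<close> immaterial.\<close>

lemma AE_eq_if_harmonic_proj_eq:
  fixes f g :: "'a::euclidean_space \<Rightarrow> real"
  assumes f: "integrable sphere_measure f" and g: "integrable sphere_measure g"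
    and eq: "\<And>l x. x \<in> sphere 0 1 \<Longrightarrow> harmonic_proj l f x = harmonic_proj l g x"
  shows "AE x in sphere_measure. f x = g x"
proof -
  define u where "u x = f x - g x" for x
  have u: "integrable sphere_measure u"
    unfolding u_def using f g by simp
  have solid: "sphere_inner h u = 0" if "h \<in> solid_harmonics l" for h l
    unfolding u_def
    using sphere_inner_diff_right[OF solid_harmonics_continuous[OF that] f g]
      harmonic_proj_cong_imp_inner_eq[OF f g eq that] by simp
  have poly: "sphere_inner u p = 0" if p: "real_polynomial_function p" for p
  proof -
    obtain L h where h: "harmonic_seq L h" "\<And>x. x \<in> sphere 0 1 \<Longrightarrow> p x = (\<Sum>l\<le>L. h l x)"
      using poly_eq_harmonic_sum[OF p] by blast
    have hs: "h l \<in> solid_harmonics l" for l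
      using h(1) by (simp add: harmonic_seq_def)
    have "sphere_inner u p = (\<integral>x. (\<Sum>l\<le>L. h l x * u x) \<partial>sphere_measure)"
      unfolding sphere_inner_def
      by (intro sphere_integral_cong) (simp add: h(2) sum_distrib_right mult.commute[of "u _"])
    also have "\<dots> = (\<Sum>l\<le>L. sphere_inner (h l) u)"
      unfolding sphere_inner_def
      by (intro Bochner_Integration.integral_sum sphere_integrable_mult u
          solid_harmonics_continuous[OF hs])
    finally show ?thesis
      using solid[OF hs] by simp
  qed
  have "(\<integral>x. u x * \<phi> x \<partial>sphere_measure) = 0" if \<phi>: "continuous_on (sphere 0 1) \<phi>" for \<phi>
  proof -
    define C where "C = (\<integral>x. \<bar>u x\<bar> \<partial>sphere_measure)"
    have "C \<ge> 0"
      unfolding C_def by simp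
    have "\<bar>sphere_inner u \<phi>\<bar> \<le> \<epsilon>" if "\<epsilon> > 0" for \<epsilon>
    proof -
      have "\<epsilon> / (C + 1) > 0"
        using that \<open>C \<ge> 0\<close> by simp
      then obtain p where p: "real_polynomial_function p"
        "\<And>x. x \<in> sphere 0 1 \<Longrightarrow> \<bar>\<phi> x - p x\<bar> < \<epsilon> / (C + 1)"
        using Stone_Weierstrass_real_polynomial_function[OF compact_sphere \<phi>] by metis
      have int: "integrable sphere_measure (\<lambda>x. u x * \<phi> x)"
          "integrable sphere_measure (\<lambda>x. u x * p x)"
        using sphere_integrable_mult[OF \<phi> u] sphere_integrable_mult[OF poly_continuous[OF p(1)] u]
        by (simp_all add: mult.commute)
      have "sphere_inner u \<phi> = sphere_inner u \<phi> - sphere_inner u p"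
        using poly[OF p(1)] by simp
      also have "\<dots> = (\<integral>x. u x * \<phi> x - u x * p x \<partial>sphere_measure)"
        unfolding sphere_inner_def using int by simp
      finally have "\<bar>sphere_inner u \<phi>\<bar> \<le> (\<integral>x. \<bar>u x * \<phi> x - u x * p x\<bar> \<partial>sphere_measure)"
        by simp
      also have "\<dots> \<le> (\<integral>x. \<bar>u x\<bar> * (\<epsilon> / (C + 1)) \<partial>sphere_measure)"
      proof (rule integral_mono)
        show "integrable sphere_measure (\<lambda>x. \<bar>u x * \<phi> x - u x * p x\<bar>)"
          using int by simp
        show "integrable sphere_measure (\<lambda>x. \<bar>u x\<bar> * (\<epsilon> / (C + 1)))"
          using u by simp
        show "\<bar>u x * \<phi> x - u x * p x\<bar> \<le> \<bar>u x\<bar> * (\<epsilon> / (C + 1))" if "x \<in> space sphere_measure" for x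
          using p(2)[of x] that
          by (auto simp: abs_mult right_diff_distrib[symmetric]
              simp del: times_divide_eq_right intro!: mult_left_mono)
      qed
      also have "\<dots> = C * \<epsilon> / (C + 1)"
        by (simp add: C_def)
      also have "\<dots> \<le> \<epsilon>"
        using \<open>C \<ge> 0\<close> that by (simp add: field_simps)
      finally show ?thesis .
    qed
    then have "sphere_inner u \<phi> = 0"
      by (metis abs_le_zero_iff field_le_epsilon add_0)
    then show ?thesis
      by (simp add: sphere_inner_def)
  qed
  from sphere_AE_zero[OF u this] show ?thesis
    by (auto simp: u_def)
qed

lemma is_LB_harmonic_coefficients:
  assumes "is_LB f g" "h \<in> solid_harmonics l"
  shows "sphere_inner h g =
      - lb_eigenvalue (DIM('a) - 1) l * sphere_inner h (f :: 'a::euclidean_space \<Rightarrow> real)"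
proof -
  have "sphere_inner h g = (\<integral>x. (- lb_eigenvalue (DIM('a) - 1) l * h x) * f x \<partial>sphere_measure)"
    unfolding sphere_inner_def
    by (rule is_LB_symmetric[OF is_LB_solid_harmonic[OF assms(2)] assms(1), symmetric])
  also have "\<dots> = - lb_eigenvalue (DIM('a) - 1) l * sphere_inner h f"
    unfolding sphere_inner_def mult.assoc by (rule integral_mult_right_zero)
  finally show ?thesis .
qed

subsection \<open>Spectral multipliers\<close>

text \<open>The eigenvalue of 1 - \<Delta>* on degree \<open>l\<close>; the type argument carries
  the dimension.\<close>

definition ev :: "'a::euclidean_space itself \<Rightarrow> nat \<Rightarrow> real" where
  "ev _ l = 1 + lb_eigenvalue (DIM('a) - 1) l"

lemma ev_ge_1: "1 \<le> ev TYPE('a::euclidean_space) l"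
proof -
  have "1 \<le> real DIM('a)"
    using DIM_positive[where ?'a='a] by (simp add: Suc_leI)
  then show ?thesis
    by (cases l) (auto simp: ev_def lb_eigenvalue_def intro!: mult_nonneg_nonneg add_increasing)
qed

text \<open>
  \<open>sup_bounded TYPE('a) \<psi> K\<close>: on polynomials the spectral multiplier \<open>\<psi>(1 - \<Delta>\<^sup>*)\<close> has norm
  at most \<open>K\<close> with respect to the supremum norm on the sphere.
\<close>

definition sup_bounded :: "'a::euclidean_space itself \<Rightarrow> (real \<Rightarrow> real) \<Rightarrow> real \<Rightarrow> bool" where
  "sup_bounded _ \<psi> K \<longleftrightarrow> (\<forall>L (h :: nat \<Rightarrow> 'a \<Rightarrow> real) B.
     harmonic_seq L h \<longrightarrow> (\<forall>x\<in>sphere 0 1. \<bar>\<Sum>l\<le>L. h l x\<bar> \<le> B) \<longrightarrow>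
     (\<forall>x\<in>sphere 0 1. \<bar>\<Sum>l\<le>L. \<psi> (ev TYPE('a) l) * h l x\<bar> \<le> K * B))"

lemma sup_boundedD:
  assumes "sup_bounded TYPE('a::euclidean_space) \<psi> K" "harmonic_seq L h"
    "\<And>x::'a. x \<in> sphere 0 1 \<Longrightarrow> \<bar>\<Sum>l\<le>L. h l x\<bar> \<le> B" "x \<in> sphere 0 1"
  shows "\<bar>\<Sum>l\<le>L. \<psi> (ev TYPE('a) l) * h l x\<bar> \<le> K * B"
  using assms unfolding sup_bounded_def by blast

lemma harmonic_seq_cmult:
  assumes "harmonic_seq L h"
  shows "harmonic_seq L (\<lambda>l x. c l * h l x)"
  using assms by (auto simp: harmonic_seq_def solid_harmonics_cmult)

lemma harmonic_seq_continuous: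
  assumes "harmonic_seq L h"
  shows "continuous_on A (h l)"
  using assms by (intro solid_harmonics_continuous[of _ l]) (simp add: harmonic_seq_def)

text \<open>The maximum principle: at a maximum point of \<open>u\<close>, \<open>\<Delta>\<^sup>* u \<le> 0\<close>.\<close>

lemma resolvent_max:
  fixes h :: "nat \<Rightarrow> 'a::euclidean_space \<Rightarrow> real"
  assumes t: "0 \<le> t" and h: "harmonic_seq L h"
    and B: "\<And>x. x \<in> sphere 0 1 \<Longrightarrow> (\<Sum>l\<le>L. h l x) \<le> B" and x: "x \<in> sphere 0 1"
  shows "(\<Sum>l\<le>L. 1 / (t + ev TYPE('a) l) * h l x) \<le> 1 / (1 + t) * B"
proof -
  define u where "u x = (\<Sum>l\<le>L. 1 / (t + ev TYPE('a) l) * h l x)" for x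
  have hs: "h l \<in> solid_harmonics l" for l
    using h by (simp add: harmonic_seq_def)
  have LB: "is_LB u (\<lambda>x. \<Sum>l\<le>L. 1 / (t + ev TYPE('a) l) * (- lb_eigenvalue (DIM('a) - 1) l * h l x))"
    unfolding u_def by (intro is_LB_sum is_LB_cmult is_LB_solid_harmonic hs) simp
  obtain y where y: "y \<in> sphere 0 1" "\<And>z. z \<in> sphere 0 1 \<Longrightarrow> u z \<le> u y"
    using continuous_attains_sup[OF compact_sphere _ is_LB_continuous(1)[OF LB]] x by blast
  have "(\<Sum>l\<le>L. h l y) = (1 + t) * u y -
      (\<Sum>l\<le>L. 1 / (t + ev TYPE('a) l) * (- lb_eigenvalue (DIM('a) - 1) l * h l y))"
  proof -
    have "h l y = (1 + t) * (1 / (t + ev TYPE('a) l) * h l y) -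
        1 / (t + ev TYPE('a) l) * (- lb_eigenvalue (DIM('a) - 1) l * h l y)" for l
    proof -
      have "t + ev TYPE('a) l \<noteq> 0"
        using t ev_ge_1[where ?'a='a, of l] by linarith
      moreover have "(1 + t) * (1 / (t + ev TYPE('a) l) * h l y) -
          1 / (t + ev TYPE('a) l) * (- lb_eigenvalue (DIM('a) - 1) l * h l y) =
          (t + ev TYPE('a) l) * (1 / (t + ev TYPE('a) l)) * h l y"
        unfolding ev_def by algebra
      ultimately show ?thesis
        by simp
    qed
    then have "(\<Sum>l\<le>L. h l y) = (\<Sum>l\<le>L. (1 + t) * (1 / (t + ev TYPE('a) l) * h l y) -
        1 / (t + ev TYPE('a) l) * (- lb_eigenvalue (DIM('a) - 1) l * h l y))"
      by (intro sum.cong) auto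
    then show ?thesis
      by (simp only: sum_subtractf u_def sum_distrib_left)
  qed
  moreover have "(\<Sum>l\<le>L. 1 / (t + ev TYPE('a) l) * (- lb_eigenvalue (DIM('a) - 1) l * h l y)) \<le> 0"
    by (rule is_LB_max[OF LB y])
  ultimately have "(1 + t) * u y \<le> B"
    using B[OF y(1)] by linarith
  then have "u y \<le> 1 / (1 + t) * B"
    using t by (simp add: field_simps)
  then show ?thesis
    using y(2)[OF x] by (simp add: u_def)
qed

lemma sup_bounded_resolvent:
  assumes "0 \<le> t"
  shows "sup_bounded TYPE('a::euclidean_space) (\<lambda>\<mu>. 1 / (t + \<mu>)) (1 / (1 + t))"
  unfolding sup_bounded_def
proof (intro allI impI ballI)
  fix L B and h :: "nat \<Rightarrow> 'a \<Rightarrow> real" and x :: 'a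
  assume h: "harmonic_seq L h" and B: "\<forall>x\<in>sphere 0 1. \<bar>\<Sum>l\<le>L. h l x\<bar> \<le> B" and x: "x \<in> sphere 0 1"
  have "(\<Sum>l\<le>L. 1 / (t + ev TYPE('a) l) * h l x) \<le> 1 / (1 + t) * B"
    using B by (intro resolvent_max[OF assms h _ x]) (auto dest!: bspec)
  moreover have "(\<Sum>l\<le>L. 1 / (t + ev TYPE('a) l) * (- 1 * h l x)) \<le> 1 / (1 + t) * B"
  proof (rule resolvent_max[OF assms harmonic_seq_cmult[OF h] _ x])
    show "(\<Sum>l\<le>L. - 1 * h l y) \<le> B" if "y \<in> sphere 0 1" for y
      using B that by (force simp: sum_negf)
  qed
  then have "- (\<Sum>l\<le>L. 1 / (t + ev TYPE('a) l) * h l x) \<le> 1 / (1 + t) * B"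
    by (simp add: sum_negf)
  ultimately show "\<bar>\<Sum>l\<le>L. 1 / (t + ev TYPE('a) l) * h l x\<bar> \<le> 1 / (1 + t) * B"
    by linarith
qed

text \<open>The multiplier is 1 - t / (t + \<mu>), so its norm is at most 1 + t / (1 + t).\<close>

lemma sup_bounded_complement_resolvent:
  assumes "0 \<le> t"
  shows "sup_bounded TYPE('a::euclidean_space) (\<lambda>\<mu>. \<mu> / (t + \<mu>)) 2"
  unfolding sup_bounded_def
proof (intro allI impI ballI)
  fix L B and h :: "nat \<Rightarrow> 'a \<Rightarrow> real" and x :: 'a
  assume h: "harmonic_seq L h" and B: "\<forall>x\<in>sphere 0 1. \<bar>\<Sum>l\<le>L. h l x\<bar> \<le> B" and x: "x \<in> sphere 0 1"
  define S where "S = (\<Sum>l\<le>L. h l x)"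
  define R where "R = (\<Sum>l\<le>L. 1 / (t + ev TYPE('a) l) * h l x)"
  have S: "\<bar>S\<bar> \<le> B"
    using B x by (simp add: S_def)
  have "ev TYPE('a) l / (t + ev TYPE('a) l) * h l x =
      h l x - t * (1 / (t + ev TYPE('a) l) * h l x)" for l
  proof -
    have "t + ev TYPE('a) l \<noteq> 0"
      using assms ev_ge_1[where ?'a='a, of l] by linarith
    then show ?thesis
      by (simp add: field_simps)
  qed
  then have eq: "(\<Sum>l\<le>L. ev TYPE('a) l / (t + ev TYPE('a) l) * h l x) = S - t * R"
    by (simp add: sum_subtractf sum_distrib_left S_def R_def)
  have "\<bar>R\<bar> \<le> 1 / (1 + t) * B"
    unfolding R_def using B by (intro sup_boundedD[OF sup_bounded_resolvent[OF assms] h _ x]) auto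
  then have "t * \<bar>R\<bar> \<le> t * (1 / (1 + t) * B)"
    using assms by (intro mult_left_mono)
  also have "\<dots> = t / (1 + t) * B"
    by simp
  also have "\<dots> \<le> 1 * B"
    using assms S by (intro mult_right_mono) auto
  finally have "\<bar>t * R\<bar> \<le> B"
    using assms by (simp add: abs_mult)
  then show "\<bar>\<Sum>l\<le>L. ev TYPE('a) l / (t + ev TYPE('a) l) * h l x\<bar> \<le> 2 * B"
    unfolding eq using S by linarith
qed

text \<open>The triangle inequality for an integral of multipliers. Every function involved is a
  finite sum, so sum and integral are interchanged freely; integrability at
  \<open>\<mu> \<ge> 1\<close> covers all eigenvalues.\<close>

lemma sup_bounded_integral:
  fixes \<psi> :: "real \<Rightarrow> real \<Rightarrow> real"
  assumes "\<And>t. t \<in> A \<Longrightarrow> sup_bounded TYPE('a::euclidean_space) (\<psi> t) (K t)"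
    and \<psi>: "\<And>\<mu>. 1 \<le> \<mu> \<Longrightarrow> set_integrable lborel A (\<lambda>t. \<psi> t \<mu>)"
    and K: "set_integrable lborel A K"
  shows "sup_bounded TYPE('a) (\<lambda>\<mu>. LINT t:A|lborel. \<psi> t \<mu>) (LINT t:A|lborel. K t)"
  unfolding sup_bounded_def
proof (intro allI impI ballI)
  fix L B and h :: "nat \<Rightarrow> 'a \<Rightarrow> real" and x :: 'a
  assume h: "harmonic_seq L h" and B: "\<forall>x\<in>sphere 0 1. \<bar>\<Sum>l\<le>L. h l x\<bar> \<le> B" and x: "x \<in> sphere 0 1"
  have int: "set_integrable lborel A (\<lambda>t. \<psi> t (ev TYPE('a) l) * h l x)" for l
    by (intro set_integrable_mult_left \<psi> ev_ge_1)
  have ints: "integrable lborel (\<lambda>t. indicator A t *\<^sub>R (\<Sum>l\<le>L. \<psi> t (ev TYPE('a) l) * h l x))"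
    using int unfolding set_integrable_def scaleR_sum_right
    by (intro Bochner_Integration.integrable_sum)
  have "(\<Sum>l\<le>L. (LINT t:A|lborel. \<psi> t (ev TYPE('a) l)) * h l x) =
      (\<Sum>l\<le>L. (LINT t:A|lborel. \<psi> t (ev TYPE('a) l) * h l x))"
    by simp
  also have "\<dots> = (LINT t:A|lborel. (\<Sum>l\<le>L. \<psi> t (ev TYPE('a) l) * h l x))"
    unfolding set_lebesgue_integral_def scaleR_sum_right
    using int unfolding set_integrable_def by (intro Bochner_Integration.integral_sum[symmetric])
  finally have "\<bar>\<Sum>l\<le>L. (LINT t:A|lborel. \<psi> t (ev TYPE('a) l)) * h l x\<bar> \<le>
      (\<integral>t. \<bar>indicator A t *\<^sub>R (\<Sum>l\<le>L. \<psi> t (ev TYPE('a) l) * h l x)\<bar> \<partial>lborel)"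
    unfolding set_lebesgue_integral_def by simp
  also have "\<dots> \<le> (\<integral>t. indicator A t *\<^sub>R K t * B \<partial>lborel)"
  proof (rule integral_mono)
    show "integrable lborel (\<lambda>t. \<bar>indicator A t *\<^sub>R (\<Sum>l\<le>L. \<psi> t (ev TYPE('a) l) * h l x)\<bar>)"
      using ints by (rule integrable_abs)
    show "integrable lborel (\<lambda>t. indicator A t *\<^sub>R K t * B)"
      using K unfolding set_integrable_def by (rule integrable_mult_left)
    show "\<bar>indicator A t *\<^sub>R (\<Sum>l\<le>L. \<psi> t (ev TYPE('a) l) * h l x)\<bar> \<le> indicator A t *\<^sub>R K t * B" for t
      using sup_boundedD[OF assms(1) h _ x, of t B] B by (cases "t \<in> A") auto
  qed
  also have "\<dots> = (LINT t:A|lborel. K t) * B"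
    unfolding set_lebesgue_integral_def by simp
  finally show "\<bar>\<Sum>l\<le>L. (LINT t:A|lborel. \<psi> t (ev TYPE('a) l)) * h l x\<bar> \<le>
      (LINT t:A|lborel. K t) * B" .
qed

lemma sphere_inner_uniform_limit:
  fixes g :: "'a::euclidean_space \<Rightarrow> real"
  assumes lim: "uniform_limit (sphere 0 1) F f sequentially"
    and F: "\<And>n. continuous_on (sphere 0 1) (F n)" and g: "continuous_on (sphere 0 1) g"
  shows "(\<lambda>n. sphere_inner g (F n)) \<longlonglongrightarrow> sphere_inner g f"
proof -
  have f: "continuous_on (sphere 0 1) f"
    using uniform_limit_theorem[OF _ lim] F by simp
  obtain B where B: "B > 0" "\<And>x. x \<in> sphere 0 1 \<Longrightarrow> \<bar>g x\<bar> \<le> B"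
    using sphere_bounded_continuous[OF g] by blast
  show ?thesis
  proof (rule LIMSEQ_I)
    fix r :: real assume r: "r > 0"
    have "\<forall>\<^sub>F n in sequentially. \<forall>x\<in>sphere 0 1. dist (F n x) (f x) < r / (2 * B)"
      using lim r B(1) by (intro uniform_limitD) auto
    then obtain N where N: "\<And>n x. n \<ge> N \<Longrightarrow> x \<in> sphere 0 1 \<Longrightarrow> dist (F n x) (f x) < r / (2 * B)"
      unfolding eventually_sequentially by blast
    have "norm (sphere_inner g (F n) - sphere_inner g f) < r" if n: "n \<ge> N" for n
    proof -
      have "sphere_inner g (F n) - sphere_inner g f = (\<integral>x. g x * (F n x - f x) \<partial>sphere_measure)"
        using sphere_inner_diff_right[OF g sphere_integrable_continuous[OF F[of n]]
            sphere_integrable_continuous[OF f]] by (simp add: sphere_inner_def)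
      then have "norm (sphere_inner g (F n) - sphere_inner g f) \<le>
          (\<integral>x. \<bar>g x * (F n x - f x)\<bar> \<partial>sphere_measure)"
        by simp
      also have "\<dots> \<le> (\<integral>x. r / 2 \<partial>(sphere_measure :: 'a measure))"
      proof (rule sphere_integral_mono)
        show "continuous_on (sphere 0 1) (\<lambda>x. \<bar>g x * (F n x - f x)\<bar>)"
          by (intro continuous_intros g f F)
        show "\<bar>g x * (F n x - f x)\<bar> \<le> r / 2" if "x \<in> sphere 0 1" for x
        proof -
          have "\<bar>g x\<bar> * \<bar>F n x - f x\<bar> \<le> B * (r / (2 * B))"
            using B N[OF n that] that by (intro mult_mono) (auto simp: dist_real_def)
          then show ?thesis
            using B(1) by (simp add: abs_mult)
        qed
      qed simp
      also have "\<dots> = r / 2"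
        by simp
      finally show ?thesis
        using r by simp
    qed
    then show "\<exists>N. \<forall>n\<ge>N. norm (sphere_inner g (F n) - sphere_inner g f) < r"
      by blast
  qed
qed

text \<open>
  Not simply \<open>sphere_inner f g = 0\<close>: this fails when the two eigenvalues coincide.
\<close>

lemma harmonic_inner_orthogonal:
  fixes f g :: "'a::euclidean_space \<Rightarrow> real"
  assumes f: "f \<in> solid_harmonics l" and g: "g \<in> solid_harmonics m"
  shows "\<psi> (ev TYPE('a) l) * sphere_inner f g = \<psi> (ev TYPE('a) m) * sphere_inner f g"
proof (cases "ev TYPE('a) l = ev TYPE('a) m")
  case False
  have "sphere_inner f g * lb_eigenvalue (DIM('a) - 1) l =
      sphere_inner f g * lb_eigenvalue (DIM('a) - 1) m"
    using is_LB_harmonic_coefficients[OF is_LB_solid_harmonic[OF g] f]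
    by (auto simp: sphere_inner_cmult_right[of f "- lb_eigenvalue (DIM('a) - 1) m" g, simplified])
  then have "sphere_inner f g = 0"
    using False unfolding ev_def by (metis mult_cancel_left)
  then show ?thesis
    by simp
qed simp

lemma sphere_inner_harmonic_sum:
  assumes "continuous_on (sphere 0 1) f" "harmonic_seq L h"
  shows "sphere_inner f (\<lambda>x. \<Sum>l\<le>L. c l * h l x) = (\<Sum>l\<le>L. c l * sphere_inner f (h l))"
  using assms
  by (subst sphere_inner_sum_right)
    (auto simp: sphere_inner_cmult_right
      intro!: sphere_integrable_continuous continuous_on_mult_left harmonic_seq_continuous)

text \<open>Moves the multiplier to the other factor, which is what turns a supremum bound into an
  \<open>L\<^sub>1\<close> bound.\<close>

lemma multiplier_symmetric:
  fixes h k :: "nat \<Rightarrow> 'a::euclidean_space \<Rightarrow> real"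
  assumes h: "harmonic_seq L h" and k: "harmonic_seq M k"
  shows "sphere_inner (\<lambda>x. \<Sum>m\<le>M. k m x) (\<lambda>x. \<Sum>l\<le>L. \<psi> (ev TYPE('a) l) * h l x) =
    sphere_inner (\<lambda>x. \<Sum>m\<le>M. \<psi> (ev TYPE('a) m) * k m x) (\<lambda>x. \<Sum>l\<le>L. h l x)"
proof -
  have hc: "continuous_on (sphere 0 1) (h l)" and kc: "continuous_on (sphere 0 1) (k l)" for l
    using harmonic_seq_continuous h k by blast+
  have "sphere_inner (\<lambda>x. \<Sum>m\<le>M. a m * k m x) (\<lambda>x. \<Sum>l\<le>L. c l * h l x) =
      (\<Sum>l\<le>L. c l * (\<Sum>m\<le>M. a m * sphere_inner (k m) (h l)))" for a c
    by (subst sphere_inner_harmonic_sum[OF _ h])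
      (auto simp: sphere_inner_commute[of _ "h _"] sphere_inner_harmonic_sum[OF hc k]
        intro!: continuous_on_sum continuous_on_mult_left kc)
  from this[of "\<lambda>_. 1" "\<lambda>l. \<psi> (ev TYPE('a) l)"] this[of "\<lambda>m. \<psi> (ev TYPE('a) m)" "\<lambda>_. 1"]
  have "sphere_inner (\<lambda>x. \<Sum>m\<le>M. k m x) (\<lambda>x. \<Sum>l\<le>L. \<psi> (ev TYPE('a) l) * h l x) =
      (\<Sum>l\<le>L. \<Sum>m\<le>M. \<psi> (ev TYPE('a) l) * sphere_inner (k m) (h l))"
    "sphere_inner (\<lambda>x. \<Sum>m\<le>M. \<psi> (ev TYPE('a) m) * k m x) (\<lambda>x. \<Sum>l\<le>L. h l x) =
      (\<Sum>l\<le>L. \<Sum>m\<le>M. \<psi> (ev TYPE('a) m) * sphere_inner (k m) (h l))"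
    by (simp_all add: sum_distrib_left)
  moreover have "\<psi> (ev TYPE('a) l) * sphere_inner (k m) (h l) =
      \<psi> (ev TYPE('a) m) * sphere_inner (k m) (h l)" for l m
    using harmonic_inner_orthogonal[of "k m" m "h l" l \<psi>] h k by (auto simp: harmonic_seq_def)
  then have "(\<Sum>l\<le>L. \<Sum>m\<le>M. \<psi> (ev TYPE('a) l) * sphere_inner (k m) (h l)) =
      (\<Sum>l\<le>L. \<Sum>m\<le>M. \<psi> (ev TYPE('a) m) * sphere_inner (k m) (h l))"
    by (intro sum.cong refl)
  ultimately show ?thesis
    by simp
qed

text \<open>
  A bounded multiplier extends from polynomials to continuous functions; being symmetric, it
  satisfies the same bound in \<open>L\<^sub>1\<close> by duality.
\<close>

lemma sup_bounded_extension:
  fixes U :: "'a::euclidean_space \<Rightarrow> real"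
  assumes \<psi>: "sup_bounded TYPE('a) \<psi> K" and K: "K > 0" and U: "continuous_on (sphere 0 1) U"
  obtains V where "continuous_on (sphere 0 1) V"
    "\<And>l h. h \<in> solid_harmonics l \<Longrightarrow> sphere_inner h V = \<psi> (ev TYPE('a) l) * sphere_inner h U"
    "\<And>B x. \<lbrakk>\<And>y. y \<in> sphere 0 1 \<Longrightarrow> \<bar>U y\<bar> \<le> B; x \<in> sphere 0 1\<rbrakk> \<Longrightarrow> \<bar>V x\<bar> \<le> K * B"
    "(\<integral>x. \<bar>V x\<bar> \<partial>sphere_measure) \<le> K * (\<integral>x. \<bar>U x\<bar> \<partial>sphere_measure)"
proof -
  define \<epsilon> where "\<epsilon> n = 1 / real (Suc n)" for n
  have \<epsilon>: "\<epsilon> n > 0" for n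
    by (simp add: \<epsilon>_def)
  have \<epsilon>0: "\<epsilon> \<longlonglongrightarrow> 0"
    unfolding \<epsilon>_def using LIMSEQ_Suc[OF lim_1_over_n] by simp
  have "\<exists>L h. harmonic_seq L h \<and> (\<forall>x\<in>sphere 0 1. \<bar>U x - (\<Sum>l\<le>L. h l x)\<bar> < \<epsilon> n)" for n
  proof -
    obtain p where p: "real_polynomial_function p" "\<And>x. x \<in> sphere 0 1 \<Longrightarrow> \<bar>U x - p x\<bar> < \<epsilon> n"
      using Stone_Weierstrass_real_polynomial_function[OF compact_sphere U \<epsilon>] by blast
    obtain L h where "harmonic_seq L h" "\<And>x. x \<in> sphere 0 1 \<Longrightarrow> p x = (\<Sum>l\<le>L. h l x)"
      using poly_eq_harmonic_sum[OF p(1)] by blast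
    with p(2) show ?thesis
      by (intro exI[of _ L] exI[of _ h]) auto
  qed
  then obtain L h where h: "\<And>n. harmonic_seq (L n) (h n)"
    "\<And>n x. x \<in> sphere 0 1 \<Longrightarrow> \<bar>U x - (\<Sum>l\<le>L n. h n l x)\<bar> < \<epsilon> n"
    by metis
  define p where "p n x = (\<Sum>l\<le>L n. h n l x)" for n x
  define v where "v n x = (\<Sum>l\<le>L n. \<psi> (ev TYPE('a) l) * h n l x)" for n x
  have pc: "continuous_on (sphere 0 1) (p n)" for n
    unfolding p_def by (intro continuous_on_sum harmonic_seq_continuous[OF h(1)])
  have vc: "continuous_on (sphere 0 1) (v n)" for n
    unfolding v_def by (intro continuous_on_sum continuous_on_mult_left
        harmonic_seq_continuous[OF h(1)])
  have close: "\<bar>U x - p n x\<bar> < \<epsilon> n" if "x \<in> sphere 0 1" for n x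
    using h(2)[OF that] by (simp add: p_def)
  have plim: "uniform_limit (sphere 0 1) p U sequentially"
  proof (rule uniform_limitI)
    fix e :: real assume "e > 0"
    then have "\<forall>\<^sub>F n in sequentially. \<epsilon> n < e"
      using \<epsilon>0 by (rule order_tendstoD(2)[rotated])
    then show "\<forall>\<^sub>F n in sequentially. \<forall>x\<in>sphere 0 1. dist (p n x) (U x) < e"
    proof eventually_elim
      case (elim n)
      then show ?case
        using close[of _ n] by (fastforce simp: dist_real_def abs_minus_commute)
    qed
  qed
  \<comment> \<open>The multiplier is applied to the difference of two approximants, which is small
    on the sphere; hence the images are uniformly Cauchy.\<close>
  have diff: "\<bar>v n x - v m x\<bar> \<le> K * (\<epsilon> n + \<epsilon> m)" if x: "x \<in> sphere 0 1" for n m x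
  proof -
    define H where "H l x = h n l x + - 1 * h m l x" for l x
    note add = harmonic_seq_add[OF h(1)[of n] harmonic_seq_cmult[OF h(1)[of m], of "\<lambda>_. - 1"]]
    note addv = harmonic_seq_add[OF harmonic_seq_cmult[OF h(1)[of n], of "\<lambda>l. \<psi> (ev TYPE('a) l)"]
        harmonic_seq_cmult[OF h(1)[of m], of "\<lambda>l. - \<psi> (ev TYPE('a) l)"]]
    have seq: "harmonic_seq (max (L n) (L m)) H"
      using add(1) by (simp add: H_def[abs_def])
    have "\<bar>\<Sum>l\<le>max (L n) (L m). H l y\<bar> \<le> \<epsilon> n + \<epsilon> m" if "y \<in> sphere 0 1" for y
    proof -
      have "(\<Sum>l\<le>max (L n) (L m). H l y) = p n y - p m y"
        using add(2) by (simp add: H_def p_def sum_negf)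
      then show ?thesis
        using close[OF that, of n] close[OF that, of m] by (simp add: abs_if split: if_splits)
    qed
    from sup_boundedD[OF \<psi> seq this x]
    have "\<bar>\<Sum>l\<le>max (L n) (L m). \<psi> (ev TYPE('a) l) * H l x\<bar> \<le> K * (\<epsilon> n + \<epsilon> m)" .
    moreover have "(\<Sum>l\<le>max (L n) (L m). \<psi> (ev TYPE('a) l) * H l x) = v n x - v m x"
      using addv(2)[of x] by (simp add: H_def v_def sum_negf algebra_simps)
    ultimately show ?thesis by simp
  qed
  have "uniformly_convergent_on (sphere 0 1) v"
  proof (rule Cauchy_uniformly_convergent, rule uniformly_Cauchy_onI)
    fix e :: real assume "e > 0"
    then have "\<forall>\<^sub>F n in sequentially. \<epsilon> n < e / (2 * K)"
      using K by (intro order_tendstoD(2)[OF \<epsilon>0]) simp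
    then obtain N where N: "\<And>n. n \<ge> N \<Longrightarrow> \<epsilon> n < e / (2 * K)"
      unfolding eventually_sequentially by blast
    have "dist (v m x) (v n x) < e" if "x \<in> sphere 0 1" "m \<ge> N" "n \<ge> N" for x m n
    proof -
      have "\<bar>v m x - v n x\<bar> \<le> K * (\<epsilon> m + \<epsilon> n)"
        using diff that by blast
      also have "\<dots> < K * (e / (2 * K) + e / (2 * K))"
        using N that K by (intro mult_strict_left_mono add_strict_mono) auto
      also have "\<dots> = e"
        using K by (simp add: field_simps)
      finally show ?thesis
        by (simp add: dist_real_def)
    qed
    then show "\<exists>M. \<forall>x\<in>sphere 0 1. \<forall>m\<ge>M. \<forall>n\<ge>M. dist (v m x) (v n x) < e"
      by blast
  qed
  then obtain V where V: "uniform_limit (sphere 0 1) v V sequentially"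
    unfolding uniformly_convergent_on_def by blast
  have Vc: "continuous_on (sphere 0 1) V"
    using uniform_limit_theorem[OF _ V] vc by simp
  show thesis
  proof (rule that[OF Vc])
    fix l and k :: "'a \<Rightarrow> real" assume k: "k \<in> solid_harmonics l"
    have kc: "continuous_on (sphere 0 1) k"
      by (rule solid_harmonics_continuous[OF k])
    have "sphere_inner k (v n) = \<psi> (ev TYPE('a) l) * sphere_inner k (p n)" for n
    proof -
      have "sphere_inner k (v n) = (\<Sum>m\<le>L n. \<psi> (ev TYPE('a) m) * sphere_inner k (h n m))"
        unfolding v_def by (rule sphere_inner_harmonic_sum[OF kc h(1)])
      also have "\<dots> = (\<Sum>m\<le>L n. \<psi> (ev TYPE('a) l) * sphere_inner k (h n m))"
        using h(1)[of n] k by (intro sum.cong harmonic_inner_orthogonal[symmetric]) (auto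
            simp: harmonic_seq_def)
      also have "\<dots> = \<psi> (ev TYPE('a) l) * sphere_inner k (p n)"
        using sphere_inner_harmonic_sum[OF kc h(1)[of n], of "\<lambda>_. 1"]
        by (simp add: p_def[abs_def] sum_distrib_left)
      finally show ?thesis .
    qed
    then have "(\<lambda>n. \<psi> (ev TYPE('a) l) * sphere_inner k (p n)) \<longlonglongrightarrow> sphere_inner k V"
      using sphere_inner_uniform_limit[OF V vc kc] by simp
    moreover have "(\<lambda>n. \<psi> (ev TYPE('a) l) * sphere_inner k (p n)) \<longlonglongrightarrow>
        \<psi> (ev TYPE('a) l) * sphere_inner k U"
      by (intro tendsto_mult_left sphere_inner_uniform_limit[OF plim pc kc])
    ultimately show "sphere_inner k V = \<psi> (ev TYPE('a) l) * sphere_inner k U"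
      by (rule LIMSEQ_unique)
  next
    fix B and x :: 'a assume B: "\<And>y. y \<in> sphere 0 1 \<Longrightarrow> \<bar>U y\<bar> \<le> B" and x: "x \<in> sphere 0 1"
    have "\<bar>v n x\<bar> \<le> K * (B + \<epsilon> n)" for n
      unfolding v_def
    proof (rule sup_boundedD[OF \<psi> h(1) _ x])
      show "\<bar>\<Sum>l\<le>L n. h n l y\<bar> \<le> B + \<epsilon> n" if "y \<in> sphere 0 1" for y
        using close[OF that, of n] B[OF that] unfolding p_def by linarith
    qed
    moreover have "(\<lambda>n. \<bar>v n x\<bar>) \<longlonglongrightarrow> \<bar>V x\<bar>"
      by (intro tendsto_rabs tendsto_uniform_limitI[OF V x])
    moreover have "(\<lambda>n. K * (B + \<epsilon> n)) \<longlonglongrightarrow> K * (B + 0)"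
      by (intro tendsto_intros \<epsilon>0)
    ultimately show "\<bar>V x\<bar> \<le> K * B"
      using LIMSEQ_le by fastforce
  next
    define CU where "CU = (\<integral>x. \<bar>U x\<bar> \<partial>sphere_measure)"
    define CV where "CV = (\<integral>x. \<bar>V x\<bar> \<partial>sphere_measure)"
    have nonneg: "CU \<ge> 0" "CV \<ge> 0"
      by (simp_all add: CU_def CV_def)
    \<comment> \<open>Paired with a polynomial, the multiplier acts on that polynomial, where the
      supremum bound is available.\<close>
    have dual: "sphere_inner (\<lambda>x. \<Sum>m\<le>M. k m x) V \<le> K * b * CU"
      if k: "harmonic_seq M k" "\<And>x. x \<in> sphere 0 1 \<Longrightarrow> \<bar>\<Sum>m\<le>M. k m x\<bar> \<le> b" for M k b
    proof -
      define q where "q x = (\<Sum>m\<le>M. k m x)" for x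
      define w where "w x = (\<Sum>m\<le>M. \<psi> (ev TYPE('a) m) * k m x)" for x
      have qc: "continuous_on (sphere 0 1) q" "continuous_on (sphere 0 1) w"
        unfolding q_def w_def
        by (intro continuous_on_sum continuous_on_mult_left harmonic_seq_continuous[OF k(1)])+
      have "sphere_inner q (v n) = sphere_inner w (p n)" for n
        unfolding q_def w_def v_def p_def by (rule multiplier_symmetric[OF h(1) k(1)])
      then have "(\<lambda>n. sphere_inner w (p n)) \<longlonglongrightarrow> sphere_inner q V"
        using sphere_inner_uniform_limit[OF V vc qc(1)] by simp
      moreover have "(\<lambda>n. sphere_inner w (p n)) \<longlonglongrightarrow> sphere_inner w U"
        by (rule sphere_inner_uniform_limit[OF plim pc qc(2)])
      ultimately have "sphere_inner q V = sphere_inner w U"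
        by (rule LIMSEQ_unique)
      also have "\<dots> \<le> (\<integral>x. K * b * \<bar>U x\<bar> \<partial>sphere_measure)"
        unfolding sphere_inner_def
      proof (rule sphere_integral_mono)
        show "w x * U x \<le> K * b * \<bar>U x\<bar>" if "x \<in> sphere 0 1" for x
        proof -
          have "w x * U x \<le> \<bar>w x\<bar> * \<bar>U x\<bar>"
            by (metis abs_ge_self abs_mult)
          also have "\<dots> \<le> K * b * \<bar>U x\<bar>"
            unfolding w_def using sup_boundedD[OF \<psi> k that] by (intro mult_right_mono) auto
          finally show ?thesis .
        qed
      qed (intro continuous_intros qc U)+
      finally show ?thesis
        by (simp add: q_def[abs_def] CU_def)
    qed
    have bound: "CV \<le> K * (1 + \<delta>) * CU + \<delta> * CV + \<delta>" if \<delta>: "\<delta> > 0" for \<delta>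
    proof -
      \<comment> \<open>A continuous substitute for the sign of \<open>V\<close>: it is bounded by
        1, and its product with \<open>V\<close> is at least |V| - \<delta>. A polynomial within
        \<delta> of it is used in the pairing.\<close>
      define \<phi> where "\<phi> x = V x / (\<bar>V x\<bar> + \<delta>)" for x
      have den: "\<bar>V x\<bar> + \<delta> > 0" for x
        using \<delta> by (simp add: add_nonneg_pos)
      have \<phi>c: "continuous_on (sphere 0 1) \<phi>"
        unfolding \<phi>_def using den by (intro continuous_intros Vc) (metis less_irrefl)
      have \<phi>1: "\<bar>\<phi> x\<bar> \<le> 1" for x
        using den[of x] \<delta> by (simp add: \<phi>_def)
      obtain p' where p': "real_polynomial_function p'" "\<And>x. x \<in> sphere 0 1 \<Longrightarrow> \<bar>\<phi> x - p' x\<bar> < \<delta>"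
        using Stone_Weierstrass_real_polynomial_function[OF compact_sphere \<phi>c \<delta>] by blast
      obtain M k where k: "harmonic_seq M k" "\<And>x. x \<in> sphere 0 1 \<Longrightarrow> p' x = (\<Sum>l\<le>M. k l x)"
        using poly_eq_harmonic_sum[OF p'(1)] by blast
      have "sphere_inner (\<lambda>x. \<Sum>m\<le>M. k m x) V \<le> K * (1 + \<delta>) * CU"
      proof (rule dual[OF k(1)])
        show "\<bar>\<Sum>m\<le>M. k m x\<bar> \<le> 1 + \<delta>" if "x \<in> sphere 0 1" for x
          using \<phi>1[of x] p'(2)[OF that] k(2)[OF that] by linarith
      qed
      then have 1: "sphere_inner p' V \<le> K * (1 + \<delta>) * CU"
        using sphere_inner_cong[of p' "\<lambda>x. \<Sum>m\<le>M. k m x" V V] k(2) by simp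
      have p'c: "continuous_on (sphere 0 1) p'"
        by (rule poly_continuous[OF p'(1)])
      have "CV \<le> (\<integral>x. p' x * V x + \<delta> * \<bar>V x\<bar> + \<delta> \<partial>sphere_measure)"
        unfolding CV_def
      proof (rule sphere_integral_mono)
        show "\<bar>V x\<bar> \<le> p' x * V x + \<delta> * \<bar>V x\<bar> + \<delta>" if "x \<in> sphere 0 1" for x
        proof -
          have "\<bar>V x\<bar> - \<delta> \<le> \<phi> x * V x"
          proof -
            have "(\<bar>V x\<bar> - \<delta>) * (\<bar>V x\<bar> + \<delta>) \<le> V x * V x"
              using \<delta> by (simp add: algebra_simps abs_mult_self_eq)
            then show ?thesis
              using den[of x] by (simp add: \<phi>_def pos_le_divide_eq)
          qed
          moreover have "(\<phi> x - p' x) * V x \<le> \<delta> * \<bar>V x\<bar>"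
          proof -
            have "(\<phi> x - p' x) * V x \<le> \<bar>\<phi> x - p' x\<bar> * \<bar>V x\<bar>"
              by (metis abs_ge_self abs_mult)
            also have "\<dots> \<le> \<delta> * \<bar>V x\<bar>"
              using p'(2)[OF that] by (intro mult_right_mono) auto
            finally show ?thesis .
          qed
          ultimately show ?thesis
            by (simp add: algebra_simps)
        qed
      qed (intro continuous_intros Vc p'c)+
      also have "\<dots> = sphere_inner p' V + \<delta> * CV + \<delta>"
        using sphere_integrable_continuous[OF Vc] sphere_integrable_mult[OF p'c
            sphere_integrable_continuous[OF Vc]]
        by (simp add: sphere_inner_def CV_def)
      finally show ?thesis
        using 1 by linarith
    qed
    have "CV \<le> K * CU"
    proof (rule field_le_epsilon)
      fix e :: real assume e: "e > 0"
      define c where "c = K * CU + CV + 1"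
      \<comment> \<open>The errors in \<open>bound\<close> add up to \<delta> times
        \<open>c\<close>, so \<delta> = \<open>e / c\<close> makes the total exactly
        \<open>e\<close>.\<close>
      have c: "c > 0"
        using nonneg K by (simp add: c_def add_nonneg_pos)
      define r where "r = e / c"
      have "CV \<le> K * (1 + r) * CU + r * CV + r"
        using e c by (intro bound) (simp add: r_def)
      also have "\<dots> = K * CU + r * c"
        unfolding c_def by (simp add: algebra_simps)
      also have "\<dots> = K * CU + e / c * c"
        by (simp add: r_def)
      also have "e / c * c = e"
        using c by simp
      finally show "CV \<le> K * CU + e" .
    qed
    then show "(\<integral>x. \<bar>V x\<bar> \<partial>sphere_measure) \<le> K * (\<integral>x. \<bar>U x\<bar> \<partial>sphere_measure)"
      by (simp add: CV_def CU_def)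
  qed
qed

subsection \<open>Fractional powers and zonal bump functions\<close>

lemma sup_bounded_cmult:
  assumes "sup_bounded TYPE('a::euclidean_space) \<psi> K" "0 \<le> c"
  shows "sup_bounded TYPE('a) (\<lambda>\<mu>. c * \<psi> \<mu>) (c * K)"
  unfolding sup_bounded_def
proof (intro allI impI ballI)
  fix L B and h :: "nat \<Rightarrow> 'a \<Rightarrow> real" and x :: 'a
  assume h: "harmonic_seq L h" and B: "\<forall>x\<in>sphere 0 1. \<bar>\<Sum>l\<le>L. h l x\<bar> \<le> B" and x: "x \<in> sphere 0 1"
  have "c * \<bar>\<Sum>l\<le>L. \<psi> (ev TYPE('a) l) * h l x\<bar> \<le> c * (K * B)"
    using B by (intro mult_left_mono sup_boundedD[OF assms(1) h _ x] assms(2)) auto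
  then show "\<bar>\<Sum>l\<le>L. c * \<psi> (ev TYPE('a) l) * h l x\<bar> \<le> c * K * B"
    using assms(2) by (simp add: sum_distrib_left[symmetric] mult.assoc abs_mult)
qed

lemma sup_bounded_mono:
  assumes "sup_bounded TYPE('a::euclidean_space) \<psi> K" "K \<le> K'"
  shows "sup_bounded TYPE('a) \<psi> K'"
  unfolding sup_bounded_def
proof (intro allI impI ballI)
  fix L B and h :: "nat \<Rightarrow> 'a \<Rightarrow> real" and x :: 'a
  assume h: "harmonic_seq L h" and B: "\<forall>x\<in>sphere 0 1. \<bar>\<Sum>l\<le>L. h l x\<bar> \<le> B" and x: "x \<in> sphere 0 1"
  have "\<bar>\<Sum>l\<le>L. \<psi> (ev TYPE('a) l) * h l x\<bar> \<le> K * B"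
    using B by (intro sup_boundedD[OF assms(1) h _ x]) auto
  also have "\<dots> \<le> K' * B"
    using assms(2) B x by (intro mult_right_mono) (auto dest!: bspec
        intro: order_trans[OF abs_ge_zero])
  finally show "\<bar>\<Sum>l\<le>L. \<psi> (ev TYPE('a) l) * h l x\<bar> \<le> K' * B" .
qed

text \<open>Transfers closed forms of power integrals from gauge integrals; nonnegativity makes them
  Lebesgue integrals as well.\<close>

lemma set_lebesgue_integral_of_has_integral:
  fixes f :: "real \<Rightarrow> real"
  assumes [measurable]: "f \<in> borel_measurable borel" "A \<in> sets borel"
    and "\<And>x. x \<in> A \<Longrightarrow> 0 \<le> f x" "(f has_integral I) A"
  shows "set_integrable lborel A f" "(LINT x:A|lborel. f x) = I"
proof -
  have I: "0 \<le> I"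
    using has_integral_nonneg[OF assms(4)] assms(3) by blast
  define g where "g x = indicator A x * f x" for x
  have g: "g \<in> borel_measurable borel" "0 \<le> g x" for x
    using assms(3) unfolding g_def by (auto simp: indicator_def)
  have "g = (\<lambda>x. if x \<in> A then f x else 0)"
    by (auto simp: g_def)
  then have "(g has_integral I) UNIV"
    using assms(4) by (simp only: has_integral_restrict_UNIV)
  then have "(\<integral>\<^sup>+x. g x \<partial>lborel) = ennreal I"
    by (rule nn_integral_has_integral_lborel[OF g])
  then have "has_bochner_integral lborel g I"
    using g I by (intro has_bochner_integral_nn_integral) auto
  then show "set_integrable lborel A f" "(LINT x:A|lborel. f x) = I"
    unfolding set_integrable_def set_lebesgue_integral_def
    by (simp_all add: g_def[abs_def] has_bochner_integral_iff)
qed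

text \<open>
  \<open>fractional_power \<alpha> C T U W G\<close>: \<open>G = (1 - \<Delta>\<^sup>*)\<^sup>\<alpha> U\<close>, with bounds in terms of \<open>U\<close> and
  \<open>W = (1 - \<Delta>\<^sup>*) U\<close> both in the supremum norm and in \<open>L\<^sub>1\<close>.
\<close>

definition fractional_power ::
    "real \<Rightarrow> real \<Rightarrow> real \<Rightarrow> ('a::euclidean_space \<Rightarrow> real) \<Rightarrow> ('a \<Rightarrow> real) \<Rightarrow> ('a \<Rightarrow> real) \<Rightarrow> bool" where
  "fractional_power \<alpha> C T U W G \<longleftrightarrow> continuous_on (sphere 0 1) G \<and>
     (\<forall>l. \<forall>h\<in>solid_harmonics l. sphere_inner h G = ev TYPE('a) l powr \<alpha> * sphere_inner h U) \<and>
     (\<forall>B0 B1. (\<forall>x\<in>sphere 0 1. \<bar>U x\<bar> \<le> B0) \<longrightarrow> (\<forall>x\<in>sphere 0 1. \<bar>W x\<bar> \<le> B1) \<longrightarrow>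
       (\<forall>x\<in>sphere 0 1. \<bar>G x\<bar> \<le> C * (T powr \<alpha> * B0 + T powr (\<alpha> - 1) * B1))) \<and>
     (\<integral>x. \<bar>G x\<bar> \<partial>sphere_measure) \<le>
       C * (T powr \<alpha> * (\<integral>x. \<bar>U x\<bar> \<partial>sphere_measure) + T powr (\<alpha> - 1) * (\<integral>x. \<bar>W x\<bar> \<partial>sphere_measure))"

section \<open>Balakrishnan's formula for exponents strictly between 0 and 1\<close>

context
  fixes \<alpha> :: real
  assumes \<alpha>: "0 < \<alpha>" "\<alpha> < 1"
begin

lemma powr_integral_low:
  assumes "0 < T"
  shows "set_integrable lborel {0..T} (\<lambda>t. t powr (\<alpha> - 1))"
    "(LINT t:{0..T}|lborel. t powr (\<alpha> - 1)) = T powr \<alpha> / \<alpha>"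
  using set_lebesgue_integral_of_has_integral[OF _ _ _ has_integral_powr_from_0[of "\<alpha> -
      1" T]] \<alpha> assms
  by auto

lemma powr_integral_high:
  assumes "0 < T"
  shows "set_integrable lborel {T..} (\<lambda>t. t powr (\<alpha> - 2))"
    "(LINT t:{T..}|lborel. t powr (\<alpha> - 2)) = T powr (\<alpha> - 1) / (1 - \<alpha>)"
proof -
  have "- (T powr (\<alpha> - 2 + 1)) / (\<alpha> - 2 + 1) = T powr (\<alpha> - 1) / (1 - \<alpha>)"
    using \<alpha> by (simp add: field_simps)
  then have "((\<lambda>t. t powr (\<alpha> - 2)) has_integral T powr (\<alpha> - 1) / (1 - \<alpha>)) {T..}"
    using has_integral_powr_to_inf[of "\<alpha> - 2" T] \<alpha> assms by simp
  from set_lebesgue_integral_of_has_integral[OF _ _ _ this]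
  show "set_integrable lborel {T..} (\<lambda>t. t powr (\<alpha> - 2))"
    "(LINT t:{T..}|lborel. t powr (\<alpha> - 2)) = T powr (\<alpha> - 1) / (1 - \<alpha>)"
    by auto
qed

lemma resolvent_integrable_low:
  assumes "0 < T" "0 < \<mu>"
  shows "set_integrable lborel {0..T} (\<lambda>t. t powr (\<alpha> - 1) * (\<mu> / (t + \<mu>)))"
proof (rule set_integrable_bound[OF powr_integral_low(1)[OF assms(1)]])
  show "set_borel_measurable lborel {0..T} (\<lambda>t. t powr (\<alpha> - 1) * (\<mu> / (t + \<mu>)))"
    unfolding set_borel_measurable_def by measurable
  have "t powr (\<alpha> - 1) * (\<mu> / (t + \<mu>)) \<le> t powr (\<alpha> - 1) * 1" if "0 \<le> t" for t
    using that assms(2) by (intro mult_left_mono) auto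
  then show "AE t in lborel. t \<in> {0..T} \<longrightarrow>
      norm (t powr (\<alpha> - 1) * (\<mu> / (t + \<mu>))) \<le> norm (t powr (\<alpha> - 1))"
    using assms(2) by (intro AE_I2) (auto simp: abs_mult)
qed

lemma resolvent_integrable_high:
  assumes "0 < T" "0 < \<mu>"
  shows "set_integrable lborel {T..} (\<lambda>t. t powr (\<alpha> - 1) * (1 / (t + \<mu>)))"
proof (rule set_integrable_bound[OF powr_integral_high(1)[OF assms(1)]])
  show "set_borel_measurable lborel {T..} (\<lambda>t. t powr (\<alpha> - 1) * (1 / (t + \<mu>)))"
    unfolding set_borel_measurable_def by measurable
  have "t powr (\<alpha> - 1) * (1 / (t + \<mu>)) \<le> t powr (\<alpha> - 2)" if "T \<le> t" for t
  proof -
    have t: "0 < t"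
      using that assms(1) by linarith
    have "t powr (\<alpha> - 1) * (1 / (t + \<mu>)) \<le> t powr (\<alpha> - 1) * (1 / t)"
      using t assms(2) by (intro mult_left_mono divide_left_mono) auto
    also have "\<dots> = t powr (\<alpha> - 2)"
      using t powr_diff[of t "\<alpha> - 1" 1] by simp
    finally show ?thesis .
  qed
  then show "AE t in lborel. t \<in> {T..} \<longrightarrow>
      norm (t powr (\<alpha> - 1) * (1 / (t + \<mu>))) \<le> norm (t powr (\<alpha> - 2))"
    using assms by (intro AE_I2) (auto simp: abs_mult)
qed

text \<open>On the lower interval the factor \<open>\<mu>\<close> is absorbed into the integrand, on
  the upper one it stays outside; the common endpoint \<open>T\<close> is a null set.\<close>

lemma resolvent_integral_split:
  assumes "0 < T" "0 < \<mu>"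
  shows "set_integrable lborel {0..} (\<lambda>t. t powr (\<alpha> - 1) * (1 / (t + \<mu>)))"
    "\<mu> * (LINT t:{0..}|lborel. t powr (\<alpha> - 1) * (1 / (t + \<mu>))) =
     (LINT t:{0..T}|lborel. t powr (\<alpha> - 1) * (\<mu> / (t + \<mu>))) +
     \<mu> * (LINT t:{T..}|lborel. t powr (\<alpha> - 1) * (1 / (t + \<mu>)))"
proof -
  define f where "f t = t powr (\<alpha> - 1) * (1 / (t + \<mu>))" for t
  have U: "{0..} = {0..T} \<union> {T..}"
    using assms(1) by auto
  have eq: "t powr (\<alpha> - 1) * (\<mu> / (t + \<mu>)) = \<mu> * f t" for t
    by (simp add: f_def)
  have low: "set_integrable lborel {0..T} f"
    using resolvent_integrable_low[OF assms] assms(2) unfolding eq set_integrable_def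
    by (simp add: mult.left_commute[of _ \<mu>] integrable_mult_right_iff)
  have high: "set_integrable lborel {T..} f"
    unfolding f_def by (rule resolvent_integrable_high[OF assms])
  have ae: "AE t in lborel. \<not> (t \<in> {0..T} \<and> t \<in> {T..})"
    using AE_lborel_singleton[of T] by eventually_elim auto
  show "set_integrable lborel {0..} (\<lambda>t. t powr (\<alpha> - 1) * (1 / (t + \<mu>)))"
    unfolding U f_def[symmetric] by (intro set_integrable_Un low high) auto
  have "(LINT t:{0..}|lborel. f t) = (LINT t:{0..T}|lborel. f t) + (LINT t:{T..}|lborel. f t)"
    unfolding U by (intro set_integral_Un_AE low high ae) auto
  then show "\<mu> * (LINT t:{0..}|lborel. t powr (\<alpha> - 1) * (1 / (t + \<mu>))) =
     (LINT t:{0..T}|lborel. t powr (\<alpha> - 1) * (\<mu> / (t + \<mu>))) +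
     \<mu> * (LINT t:{T..}|lborel. t powr (\<alpha> - 1) * (1 / (t + \<mu>)))"
    unfolding eq f_def[symmetric] by (simp add: distrib_left)
qed

definition balakrishnan_const :: real where
  "balakrishnan_const = (LINT t:{0..}|lborel. t powr (\<alpha> - 1) * (1 / (t + 1)))"

text \<open>Needed in order to divide by the constant; the integrand is bounded below on the
  interval from 1 to 2.\<close>

lemma balakrishnan_const_pos: "0 < balakrishnan_const"
proof -
  define f where "f t = t powr (\<alpha> - 1) * (1 / (t + 1))" for t :: real
  have int: "set_integrable lborel {0..} f"
    unfolding f_def using resolvent_integral_split(1)[of 1 1] by simp
  have "0 < (2 powr (\<alpha> - 1) * (1 / 3)) * measure lborel {1..2::real}"
    by simp
  also have "\<dots> = (LINT t:{1..2::real}|lborel. 2 powr (\<alpha> - 1) * (1 / 3))"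
    by (simp add: set_lebesgue_integral_def)
  also have "\<dots> \<le> (LINT t:{1..2}|lborel. f t)"
  proof (rule set_integral_mono)
    show "set_integrable lborel {1..2::real} (\<lambda>t. 2 powr (\<alpha> - 1) * (1 / 3))"
      unfolding set_integrable_def by simp
    show "set_integrable lborel {1..2} f"
      by (rule set_integrable_subset[OF int]) auto
    show "2 powr (\<alpha> - 1) * (1 / 3) \<le> f t" if "t \<in> {1..2}" for t
      unfolding f_def using that \<alpha>
      by (intro mult_mono powr_mono2' divide_left_mono) auto
  qed
  also have "\<dots> \<le> (LINT t:{0..}|lborel. f t)"
    unfolding set_lebesgue_integral_def
  proof (rule integral_mono)
    show "integrable lborel (\<lambda>t. indicator {1..2} t *\<^sub>R f t)"
      using set_integrable_subset[OF int, of "{1..2}"] by (auto simp: set_integrable_def)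
    show "integrable lborel (\<lambda>t. indicator {0..} t *\<^sub>R f t)"
      using int by (simp add: set_integrable_def)
    show "indicator {1..2} t *\<^sub>R f t \<le> indicator {0..} t *\<^sub>R f t" for t
      by (auto simp: indicator_def f_def)
  qed
  finally show ?thesis
    by (simp add: balakrishnan_const_def f_def)
qed

text \<open>The substitution t = \<mu> x extracts \<mu>^(\<alpha>-1) and leaves the integral at
  \<mu> = 1.\<close>

lemma balakrishnan_scalar:
  assumes \<mu>: "0 < \<mu>"
  shows "\<mu> * (LINT t:{0..}|lborel. t powr (\<alpha> - 1) * (1 / (t + \<mu>))) = balakrishnan_const * \<mu> powr \<alpha>"
proof -
  have "(LINT t:{0..}|lborel. t powr (\<alpha> - 1) * (1 / (t + \<mu>))) =
      \<bar>\<mu>\<bar> *\<^sub>R (\<integral>x. indicator {0..} (0 + \<mu> * x) *\<^sub>R ((0 + \<mu> * x) powr (\<alpha> - 1) * (1 / ((0 +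
          \<mu> * x) + \<mu>))) \<partial>lborel)"
    unfolding set_lebesgue_integral_def using \<mu> by (intro lborel_integral_real_affine) simp
  also have "\<dots> = \<mu> * (\<integral>x. \<mu> powr (\<alpha> - 2) * (indicator {0..} x *\<^sub>R (x powr (\<alpha> - 1) * (1 / (x +
      1)))) \<partial>lborel)"
  proof -
    have "indicator {0..} (0 + \<mu> * x) *\<^sub>R ((0 + \<mu> * x) powr (\<alpha> - 1) * (1 / ((0 + \<mu> * x) + \<mu>))) =
        \<mu> powr (\<alpha> - 2) * (indicator {0..} x *\<^sub>R (x powr (\<alpha> - 1) * (1 / (x + 1))))" for x
    proof (cases "0 \<le> x")
      case True
      have "\<mu> powr (\<alpha> - 2) = \<mu> powr (\<alpha> - 1) / \<mu>"
        using \<mu> powr_diff[of \<mu> "\<alpha> - 1" 1] by simp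
      moreover have "\<mu> * x + \<mu> = \<mu> * (x + 1)"
        by (simp add: algebra_simps)
      ultimately show ?thesis
        using True \<mu> by (simp add: powr_mult)
    next
      case False
      then show ?thesis
        using \<mu> by (simp add: zero_le_mult_iff)
    qed
    then show ?thesis
      using \<mu> by simp
  qed
  also have "\<dots> = \<mu> * \<mu> powr (\<alpha> - 2) * balakrishnan_const"
    unfolding balakrishnan_const_def set_lebesgue_integral_def integral_mult_right_zero
    by (simp only: mult.assoc)
  finally have "\<mu> * (LINT t:{0..}|lborel. t powr (\<alpha> - 1) * (1 / (t + \<mu>))) =
      (\<mu> powr 2 * \<mu> powr (\<alpha> - 2)) * balakrishnan_const"
    using \<mu> by (simp add: power2_eq_square)
  then show ?thesis
    by (simp add: powr_add[symmetric] mult.commute)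
qed

text \<open>The integrand is integrable near 0 because \<open>\<alpha> > 0\<close>, with the factor
  \<mu> / (t + \<mu>) bounded uniformly in \<open>t\<close>. This part acts on
  \<open>U\<close>.\<close>

definition low_part :: "real \<Rightarrow> real \<Rightarrow> real" where
  "low_part T \<mu> = (LINT t:{0..T}|lborel. t powr (\<alpha> - 1) * (\<mu> / (t + \<mu>)))"

text \<open>Without the factor \<open>\<mu>\<close> the resolvent decays like 1/t, and the integral
  converges at infinity because \<open>\<alpha> < 1\<close>. The missing factor is supplied by
  applying this part to \<open>W\<close>.\<close>

definition high_part :: "real \<Rightarrow> real \<Rightarrow> real" where
  "high_part T \<mu> = (LINT t:{T..}|lborel. t powr (\<alpha> - 1) * (1 / (t + \<mu>)))"

lemma powr_eq_parts:
  assumes "0 < T" "0 < \<mu>"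
  shows "balakrishnan_const * \<mu> powr \<alpha> = low_part T \<mu> + \<mu> * high_part T \<mu>"
  using resolvent_integral_split(2)[OF assms] balakrishnan_scalar[OF assms(2)]
  by (simp add: low_part_def high_part_def)

lemma sup_bounded_low_part:
  assumes "0 < T"
  shows "sup_bounded TYPE('a::euclidean_space) (low_part T) (2 * (T powr \<alpha> / \<alpha>))"
proof -
  have "sup_bounded TYPE('a) (\<lambda>\<mu>. LINT t:{0..T}|lborel. t powr (\<alpha> - 1) * (\<mu> / (t + \<mu>)))
      (LINT t:{0..T}|lborel. t powr (\<alpha> - 1) * 2)"
    using powr_integral_low(1)[OF assms]
    by (intro sup_bounded_integral sup_bounded_cmult sup_bounded_complement_resolvent
        resolvent_integrable_low assms set_integrable_mult_left) auto
  then show ?thesis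
    using powr_integral_low[OF assms] by (simp add: low_part_def[abs_def] mult.commute)
qed

lemma sup_bounded_high_part:
  assumes "0 < T"
  shows "sup_bounded TYPE('a::euclidean_space) (high_part T) (T powr (\<alpha> - 1) / (1 - \<alpha>))"
proof -
  have "sup_bounded TYPE('a) (\<lambda>\<mu>. LINT t:{T..}|lborel. t powr (\<alpha> - 1) * (1 / (t + \<mu>)))
      (LINT t:{T..}|lborel. t powr (\<alpha> - 2))"
  proof (rule sup_bounded_integral)
    fix t assume "t \<in> {T..}"
    then have t: "0 < t"
      using assms by auto
    have "t powr (\<alpha> - 1) * (1 / (1 + t)) \<le> t powr (\<alpha> - 1) * (1 / t)"
      using t by (intro mult_left_mono divide_left_mono) auto
    also have "\<dots> = t powr (\<alpha> - 2)"
      using t powr_diff[of t "\<alpha> - 1" 1] by simp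
    finally show "sup_bounded TYPE('a) (\<lambda>\<mu>. t powr (\<alpha> - 1) * (1 / (t + \<mu>))) (t powr (\<alpha> - 2))"
      using t by (intro sup_bounded_mono[OF sup_bounded_cmult[OF sup_bounded_resolvent]]) auto
  next
    show "set_integrable lborel {T..} (\<lambda>t. t powr (\<alpha> - 1) * (1 / (t + \<mu>)))" if "1 \<le> \<mu>" for \<mu>
      using that by (intro resolvent_integrable_high assms) simp
  qed (rule powr_integral_high(1)[OF assms])
  then show ?thesis
    using powr_integral_high[OF assms] by (simp add: high_part_def[abs_def])
qed

text \<open>The threshold \<open>T\<close> stays free so that it can be matched to the scale of
  \<open>U\<close>, while \<open>C\<close> must be chosen before it: otherwise the final constant
  would depend on the radius.\<close>

lemma fractional_power_exists:
  obtains C where "C > 0"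
    "\<And>U W :: 'a::euclidean_space \<Rightarrow> real. \<And>T. \<lbrakk>continuous_on (sphere 0 1) U; continuous_on (sphere
        0 1) W;
       \<And>l h. h \<in> solid_harmonics l \<Longrightarrow> sphere_inner h W = ev TYPE('a) l * sphere_inner h U; 0 < T\<rbrakk> \<Longrightarrow>
       \<exists>G. fractional_power \<alpha> C T U W G"
proof -
  define b where "b = balakrishnan_const"
  have b: "b > 0"
    by (simp add: b_def balakrishnan_const_pos)
  define c where "c = 2 / \<alpha> + 1 / (1 - \<alpha>)"
  have c: "2 / \<alpha> \<le> c" "1 / (1 - \<alpha>) \<le> c" "c > 0"
    using \<alpha> by (auto simp: c_def intro!: add_pos_pos)
  show thesis
  proof (rule that[of "c / b"])
    show "c / b > 0"
      using b c by simp
    fix U W :: "'a \<Rightarrow> real" and T :: real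
    assume U: "continuous_on (sphere 0 1) U" and W: "continuous_on (sphere 0 1) W"
      and UW: "\<And>l h. h \<in> solid_harmonics l \<Longrightarrow> sphere_inner h W = ev TYPE('a) l * sphere_inner h U"
      and T: "0 < T"
    define K0 where "K0 = 2 * (T powr \<alpha> / \<alpha>)"
    define K1 where "K1 = T powr (\<alpha> - 1) / (1 - \<alpha>)"
    have K: "K0 > 0" "K1 > 0" "K0 \<le> c * T powr \<alpha>" "K1 \<le> c * T powr (\<alpha> - 1)"
      using \<alpha> T mult_right_mono[OF c(1), of "T powr \<alpha>"] mult_right_mono[OF c(2), of "T powr (\<alpha> -
          1)"]
      by (auto simp: K0_def K1_def)
    obtain V0 where V0: "continuous_on (sphere 0 1) V0"
      "\<And>l h. h \<in> solid_harmonics l \<Longrightarrow>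
          sphere_inner h V0 = low_part T (ev TYPE('a) l) * sphere_inner h U"
      "\<And>B x. \<lbrakk>\<And>y. y \<in> sphere 0 1 \<Longrightarrow> \<bar>U y\<bar> \<le> B; x \<in> sphere 0 1\<rbrakk> \<Longrightarrow> \<bar>V0 x\<bar> \<le> K0 * B"
      "(\<integral>x. \<bar>V0 x\<bar> \<partial>sphere_measure) \<le> K0 * (\<integral>x. \<bar>U x\<bar> \<partial>sphere_measure)"
      using sup_bounded_extension[OF sup_bounded_low_part[OF T] K(1)[unfolded K0_def] U]
      unfolding K0_def by blast
    obtain V1 where V1: "continuous_on (sphere 0 1) V1"
      "\<And>l h. h \<in> solid_harmonics l \<Longrightarrow>
          sphere_inner h V1 = high_part T (ev TYPE('a) l) * sphere_inner h W"
      "\<And>B x. \<lbrakk>\<And>y. y \<in> sphere 0 1 \<Longrightarrow> \<bar>W y\<bar> \<le> B; x \<in> sphere 0 1\<rbrakk> \<Longrightarrow> \<bar>V1 x\<bar> \<le> K1 * B"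
      "(\<integral>x. \<bar>V1 x\<bar> \<partial>sphere_measure) \<le> K1 * (\<integral>x. \<bar>W x\<bar> \<partial>sphere_measure)"
      using sup_bounded_extension[OF sup_bounded_high_part[OF T] K(2)[unfolded K1_def] W]
      unfolding K1_def by blast
    define G where "G x = 1 / b * (V0 x + V1 x)" for x
    have Gc: "continuous_on (sphere 0 1) G"
      unfolding G_def by (intro continuous_intros V0 V1)
    have G_le: "\<bar>G x\<bar> \<le> 1 / b * (\<bar>V0 x\<bar> + \<bar>V1 x\<bar>)" for x
      using b by (simp add: G_def abs_mult divide_right_mono abs_triangle_ineq)
    have final: "1 / b * (K0 * B0 + K1 * B1) \<le> c / b * (T powr \<alpha> * B0 + T powr (\<alpha> - 1) * B1)"
      if "0 \<le> B0" "0 \<le> B1" for B0 B1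
    proof -
      have "K0 * B0 + K1 * B1 \<le> (c * T powr \<alpha>) * B0 + (c * T powr (\<alpha> - 1)) * B1"
        using that K by (intro add_mono mult_right_mono) auto
      then have "1 / b * (K0 * B0 + K1 * B1) \<le> 1 / b * ((c * T powr \<alpha>) * B0 + (c * T powr (\<alpha> -
          1)) * B1)"
        using b by (intro mult_left_mono) auto
      then show ?thesis
        by (simp add: algebra_simps)
    qed
    show "\<exists>G. fractional_power \<alpha> (c / b) T U W G"
      unfolding fractional_power_def
    proof (intro exI[of _ G] conjI Gc allI ballI impI)
      fix l and h :: "'a \<Rightarrow> real" assume h: "h \<in> solid_harmonics l"
      have "sphere_inner h G = 1 / b * (sphere_inner h V0 + sphere_inner h V1)"
        unfolding G_def sphere_inner_cmult_right
        using sphere_inner_add_right[OF solid_harmonics_continuous[OF h]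
            sphere_integrable_continuous[OF V0(1)] sphere_integrable_continuous[OF V1(1)]] by simp
      also have "\<dots> = 1 / b * (low_part T (ev TYPE('a) l) +
          ev TYPE('a) l * high_part T (ev TYPE('a) l)) * sphere_inner h U"
        unfolding V0(2)[OF h] V1(2)[OF h] UW[OF h] by (simp add: algebra_simps add_divide_distrib)
      also have "\<dots> = ev TYPE('a) l powr \<alpha> * sphere_inner h U"
      proof -
        have "low_part T (ev TYPE('a) l) + ev TYPE('a) l * high_part T (ev TYPE('a) l) =
            b * ev TYPE('a) l powr \<alpha>"
          using powr_eq_parts[OF T, of "ev TYPE('a) l"] ev_ge_1[where ?'a='a, of l]
          by (simp flip: b_def)
        then show ?thesis
          using b by simp
      qed
      finally show "sphere_inner h G = ev TYPE('a) l powr \<alpha> * sphere_inner h U" .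
    next
      fix B0 B1 and x :: 'a
      assume B: "\<forall>x\<in>sphere 0 1. \<bar>U x\<bar> \<le> B0" "\<forall>x\<in>sphere 0 1. \<bar>W x\<bar> \<le> B1" and x: "x \<in> sphere 0 1"
      have "\<bar>G x\<bar> \<le> 1 / b * (K0 * B0 + K1 * B1)"
        using G_le[of x] V0(3)[of B0 x] V1(3)[of B1 x] B x b
        by (intro order_trans[OF G_le] mult_left_mono add_mono) auto
      also have "\<dots> \<le> c / b * (T powr \<alpha> * B0 + T powr (\<alpha> - 1) * B1)"
        using B x by (intro final) (auto dest!: bspec intro: order_trans[OF abs_ge_zero])
      finally show "\<bar>G x\<bar> \<le> c / b * (T powr \<alpha> * B0 + T powr (\<alpha> - 1) * B1)" .
    next
      have "(\<integral>x. \<bar>G x\<bar> \<partial>sphere_measure) \<le> (\<integral>x. 1 / b * (\<bar>V0 x\<bar> + \<bar>V1 x\<bar>) \<partial>sphere_measure)"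
        by (intro sphere_integral_mono G_le continuous_intros Gc V0 V1)
      also have "\<dots> = 1 / b * ((\<integral>x. \<bar>V0 x\<bar> \<partial>sphere_measure) + (\<integral>x. \<bar>V1 x\<bar> \<partial>sphere_measure))"
        using sphere_integrable_continuous[OF V0(1)] sphere_integrable_continuous[OF V1(1)] by simp
      also have "\<dots> \<le> 1 / b * (K0 * (\<integral>x. \<bar>U x\<bar> \<partial>sphere_measure) + K1 * (\<integral>x. \<bar>W x\<bar> \<partial>sphere_measure))"
        using b by (intro mult_left_mono add_mono V0 V1) auto
      also have "\<dots> \<le> c / b * (T powr \<alpha> * (\<integral>x. \<bar>U x\<bar> \<partial>sphere_measure) + T powr (\<alpha> -
          1) * (\<integral>x. \<bar>W x\<bar> \<partial>sphere_measure))"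
        by (intro final) auto
      finally show "(\<integral>x. \<bar>G x\<bar> \<partial>sphere_measure) \<le>
           c / b * (T powr \<alpha> * (\<integral>x. \<bar>U x\<bar> \<partial>sphere_measure) + T powr (\<alpha> -
               1) * (\<integral>x. \<bar>W x\<bar> \<partial>sphere_measure))" .
    qed
  qed
qed

end

section \<open>Zonal bumps and their images under 1 - \<Delta>*\<close>

definition bump :: "nat \<Rightarrow> real \<Rightarrow> 'a::euclidean_space \<Rightarrow> 'a \<Rightarrow> real" where
  "bump a h z x = (max 0 (x \<bullet> z - (1 - h)) / h) ^ a"

lemma bump_continuous: "h \<noteq> 0 \<Longrightarrow> continuous_on A (bump a h z)"
  unfolding bump_def by (intro continuous_intros) auto

lemma bump_bounds:
  assumes "0 < h" "norm z = 1" "x \<in> sphere 0 1"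
  shows "0 \<le> bump a h z x" "bump a h z x \<le> 1"
proof -
  have "x \<bullet> z \<le> 1"
    using norm_cauchy_schwarz[of x z] assms by simp
  then show "0 \<le> bump a h z x" "bump a h z x \<le> 1"
    unfolding bump_def using assms(1) by (auto intro!: power_le_one)
qed

lemma bump_outside:
  assumes "0 < a" "x \<in> sphere 0 1" "x \<notin> cap z h"
  shows "bump a h z x = 0"
  using assms by (auto simp: bump_def cap_def inner_commute)

text \<open>From exponent 2 on, the two pieces meet at 0 with the same slope; the difference
  quotient there is itself a truncated power, one degree lower.\<close>

lemma max_0_power_derivative:
  "((\<lambda>t::real. max 0 t ^ Suc (Suc a)) has_real_derivative real (Suc (Suc a)) * max 0 t ^ Suc a)
  (at t)"
proof (cases t "0::real" rule: linorder_cases)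
  case greater
  have "((\<lambda>t::real. t ^ Suc (Suc a)) has_real_derivative real (Suc (Suc a)) * max 0 t ^ Suc a)
      (at t)"
    using greater DERIV_pow[of "Suc (Suc a)" t] by simp
  moreover have "\<forall>\<^sub>F x in nhds t. max 0 x ^ Suc (Suc a) = x ^ Suc (Suc a)"
    using greater by (auto simp: eventually_nhds intro!: exI[of _ "{0<..}"])
  ultimately show ?thesis
    by (subst DERIV_cong_ev[OF refl _ refl])
next
  case less
  have "\<forall>\<^sub>F x in nhds t. max 0 x ^ Suc (Suc a) = 0"
    using less by (auto simp: eventually_nhds intro!: exI[of _ "{..<0}"])
  then have "((\<lambda>t. max 0 t ^ Suc (Suc a)) has_real_derivative 0) (at t) \<longleftrightarrow>
      ((\<lambda>t. 0) has_real_derivative 0) (at t)"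
    by (rule DERIV_cong_ev[OF refl _ refl])
  then show ?thesis
    using less by simp
next
  case equal
  have "((\<lambda>h. max 0 h ^ Suc a) \<longlongrightarrow> max 0 (0::real) ^ Suc a) (at 0)"
    by (intro tendsto_intros)
  moreover have "\<forall>\<^sub>F h::real in at 0. max 0 h ^ Suc a = (max 0 (0 + h) ^ Suc (Suc a) -
      max 0 0 ^ Suc (Suc a)) / h"
    by (auto simp: eventually_at_filter max_def)
  ultimately have "((\<lambda>h. (max 0 (0 + h) ^ Suc (Suc a) -
      max 0 0 ^ Suc (Suc a)) / h) \<longlongrightarrow> 0) (at (0::real))"
    using Lim_transform_eventually by fastforce
  then show ?thesis
    using equal by (simp add: DERIV_def)
qed

text \<open>
  With \<open>t = 1 - h + s\<close> one has \<open>1 - t\<^sup>2 = h (2 - h) - 2 (1 - h) s - s\<^sup>2\<close>, so the operator only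
  produces powers of \<open>s\<close>.
\<close>

lemma is_LB_bump:
  fixes z :: "'a::euclidean_space" and a :: nat
  assumes h: "h \<noteq> 0" and z: "norm z = 1"
  defines "A \<equiv> real (Suc (Suc (Suc a)))" and "d \<equiv> real DIM('a) - 1"
  shows "is_LB (bump (Suc (Suc (Suc a))) h z)
    (\<lambda>x. A * (A - 1) * (2 - h) / h * bump (Suc a) h z x
       - A * (2 * (A - 1) + d) * (1 - h) / h * bump (Suc (Suc a)) h z x
       - A * (A - 1 + d) * bump (Suc (Suc (Suc a))) h z x)"
proof -
  define m where "m t = max 0 (t - (1 - h))" for t :: real
  define u where "u t = (1 / h ^ Suc (Suc (Suc a))) * m t ^ Suc (Suc (Suc a))" for t
  define u1 where "u1 t = (1 / h ^ Suc (Suc (Suc a))) * (A * m t ^ Suc (Suc a))" for t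
  define u2 where "u2 t = (1 / h ^ Suc (Suc (Suc a))) * (A * ((A - 1) * m t ^ Suc a))" for t
  have der: "((\<lambda>t. m t ^ Suc (Suc k)) has_real_derivative real (Suc (Suc k)) * m t ^ Suc k) (at
      t)" for k t
  proof -
    have "((\<lambda>t. t - (1 - h)) has_real_derivative 1) (at t)"
      by (auto intro!: derivative_eq_intros)
    from DERIV_chain2[OF max_0_power_derivative this, of k] show ?thesis
      by (simp only: m_def mult_1_right)
  qed
  have "(u has_real_derivative u1 t) (at t)" for t
    unfolding u_def u1_def A_def by (intro DERIV_cmult der)
  moreover have "(u1 has_real_derivative u2 t) (at t)" for t
  proof -
    have "A - 1 = real (Suc (Suc a))"
      by (simp add: A_def)
    then show ?thesis
      unfolding u1_def u2_def by (simp only:) (intro DERIV_cmult der)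
  qed
  moreover have "continuous_on UNIV u2"
    unfolding u2_def m_def by (intro continuous_intros)
  ultimately have LB: "is_LB (\<lambda>x. u (x \<bullet> z))
    (\<lambda>x. (1 - (x \<bullet> z)\<^sup>2) * u2 (x \<bullet> z) - (DIM('a) - 1) * (x \<bullet> z) * u1 (x \<bullet> z))"
    by (intro is_LB_zonal[OF z])
  have bump_eq: "bump k h z x = (1 / h ^ k) * m (x \<bullet> z) ^ k" for k x
    by (simp add: bump_def m_def power_divide)
  have "(\<lambda>x. u (x \<bullet> z)) = bump (Suc (Suc (Suc a))) h z"
    by (simp add: fun_eq_iff u_def bump_eq)
  moreover have "(1 - (x \<bullet> z)\<^sup>2) * u2 (x \<bullet> z) - (DIM('a) - 1) * (x \<bullet> z) * u1 (x \<bullet> z) =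
      A * (A - 1) * (2 - h) / h * bump (Suc a) h z x
       - A * (2 * (A - 1) + d) * (1 - h) / h * bump (Suc (Suc a)) h z x
       - A * (A - 1 + d) * bump (Suc (Suc (Suc a))) h z x" for x
  proof -
    define t where "t = x \<bullet> z"
    define p where "p = m t ^ Suc a"
    have d: "real (DIM('a) - 1) = d"
      by (simp add: d_def of_nat_diff DIM_positive Suc_leI)
    have tm: "(t - (1 - h)) * m t ^ Suc k = m t ^ Suc (Suc k)" for k
      by (simp add: m_def max_def)
    have s1: "m t ^ Suc (Suc a) = (t - (1 - h)) * p"
      by (simp only: p_def tm)
    have s2: "m t ^ Suc (Suc (Suc a)) = (t - (1 - h)) * ((t - (1 - h)) * p)"
      by (simp only: p_def tm)
    define r where "r = 1 / h ^ Suc (Suc (Suc a))"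
    have h1: "1 / h ^ Suc (Suc a) = r * h" and h2: "1 / h ^ Suc a = r * h * h"
      using h by (simp_all add: r_def)
    have "A * (A - 1) * (2 - h) / h * ((r * h * h) * p)
       - A * (2 * (A - 1) + d) * (1 - h) / h * ((r * h) * ((t - (1 - h)) * p))
       - A * (A - 1 + d) * (r * ((t - (1 - h)) * ((t - (1 - h)) * p))) =
       A * (A - 1) * (2 - h) * (r * h * p)
       - A * (2 * (A - 1) + d) * (1 - h) * (r * ((t - (1 - h)) * p))
       - A * (A - 1 + d) * (r * ((t - (1 - h)) * ((t - (1 - h)) * p)))"
      using h by simp
    also have "\<dots> = (1 - t\<^sup>2) * (r * (A * ((A - 1) * p))) - d * t * (r * (A * ((t - (1 - h)) * p)))"
      by algebra
    finally show ?thesis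
      unfolding bump_eq u1_def u2_def t_def[symmetric] s1 s2 p_def[symmetric] h1 h2
          r_def[symmetric] d
      by simp
  qed
  ultimately show ?thesis
    using LB by simp
qed

lemma cap_Int_sphere [simp]: "cap z h \<inter> sphere 0 1 = cap z h"
  by (auto simp: cap_def)

text \<open>The centre is left as an argument and the coefficients do not depend on it, so that one
  computation serves all the caps.\<close>

definition zonal_comb :: "nat \<Rightarrow> nat \<Rightarrow> real \<Rightarrow> real \<Rightarrow> ('a::euclidean_space \<Rightarrow> 'a \<Rightarrow> real) \<Rightarrow> bool" where
  "zonal_comb M a h B f \<longleftrightarrow>
     (\<exists>c. (\<forall>k. \<bar>c k\<bar> \<le> B) \<and> f = (\<lambda>z x. \<Sum>k=a..M. c k * bump k h z x))"

lemma zonal_comb_single: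
  assumes "a \<le> k" "k \<le> M" "\<bar>b\<bar> \<le> B"
  shows "zonal_comb M a h B (\<lambda>z x. b * bump k h z x)"
  unfolding zonal_comb_def
proof (intro exI[of _ "\<lambda>j. if j = k then b else 0"] conjI allI ext)
  fix z x :: 'a
  have "(\<Sum>j=a..M. (if j = k then b else 0) * bump j h z x) = (\<Sum>j=a..M. if j =
      k then b * bump j h z x else 0)"
    by (intro sum.cong) auto
  then show "b * bump k h z x = (\<Sum>j=a..M. (if j = k then b else 0) * bump j h z x)"
    using assms by simp
qed (use assms(3) in auto)

lemma zonal_comb_add:
  assumes "zonal_comb M a h B f" "zonal_comb M a h B' g"
  shows "zonal_comb M a h (B + B') (\<lambda>z x. f z x + g z x)"
proof -
  obtain c c' where "\<forall>k. \<bar>c k\<bar> \<le> B" "f = (\<lambda>z x. \<Sum>k=a..M. c k * bump k h z x)"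
    "\<forall>k. \<bar>c' k\<bar> \<le> B'" "g = (\<lambda>z x. \<Sum>k=a..M. c' k * bump k h z x)"
    using assms unfolding zonal_comb_def by blast
  then show ?thesis
    unfolding zonal_comb_def
    by (intro exI[of _ "\<lambda>k. c k + c' k"])
      (auto simp: distrib_right sum.distrib intro!: order_trans[OF abs_triangle_ineq] add_mono)
qed

lemma zonal_comb_sum:
  assumes "finite I" "\<And>i. i \<in> I \<Longrightarrow> zonal_comb M a h B (f i)"
  shows "zonal_comb M a h (real (card I) * B) (\<lambda>z x. \<Sum>i\<in>I. f i z x)"
  using assms
proof (induction I rule: finite_induct)
  case empty
  then show ?case
    unfolding zonal_comb_def by (intro exI[of _ "\<lambda>_. 0"]) auto
next
  case (insert i I)
  then show ?case
    using zonal_comb_add[of M a h B "f i" "real (card I) * B" "\<lambda>z x. \<Sum>i\<in>I. f i z x"]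
    by (simp add: algebra_simps)
qed

lemma zonal_comb_mono: "zonal_comb M a h B f \<Longrightarrow> B \<le> B' \<Longrightarrow> zonal_comb M a h B' f"
  unfolding zonal_comb_def by (elim exE conjE) (rule exI, auto intro: order_trans)

lemma zonal_comb_continuous:
  assumes "zonal_comb M a h B f" "h \<noteq> 0"
  shows "continuous_on A (f z)"
  using assms unfolding zonal_comb_def
  by (auto intro!: continuous_on_sum continuous_on_mult_left bump_continuous)

text \<open>A positive lowest exponent is essential: the zeroth power is 1 everywhere, whereas the
  others vanish off the cap. The factor \<open>Suc M\<close> bounds the number of terms.\<close>

lemma zonal_comb_bound:
  assumes f: "zonal_comb M a h B f" and a: "0 < a" and h: "0 < h"
    and z: "norm z = 1" and x: "x \<in> sphere 0 1"
  shows "\<bar>f z x\<bar> \<le> real (Suc M) * B * indicator (cap z h) x"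
proof -
  obtain c where c: "\<And>k. \<bar>c k\<bar> \<le> B" "f = (\<lambda>z x. \<Sum>k=a..M. c k * bump k h z x)"
    using f unfolding zonal_comb_def by blast
  have B: "0 \<le> B"
    using c(1)[of 0] by linarith
  have "\<bar>c k * bump k h z x\<bar> \<le> B * indicator (cap z h) x" if "a \<le> k" for k
  proof (cases "x \<in> cap z h")
    case True
    have "\<bar>c k\<bar> * \<bar>bump k h z x\<bar> \<le> B * 1"
      using bump_bounds[OF h z x, of k] c(1)[of k] B by (intro mult_mono) auto
    then show ?thesis
      using True by (simp add: abs_mult)
  next
    case False
    then show ?thesis
      using bump_outside[of k x z h] a that x by simp
  qed
  then have sum: "(\<Sum>k=a..M. \<bar>c k * bump k h z x\<bar>) \<le> (\<Sum>k=a..M. B * indicator (cap z h) x)"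
    by (intro sum_mono) auto
  have "\<bar>f z x\<bar> \<le> (\<Sum>k=a..M. \<bar>c k * bump k h z x\<bar>)"
    unfolding c(2) by (rule sum_abs)
  also have "\<dots> \<le> (\<Sum>k=a..M. B * indicator (cap z h) x)"
    by (rule sum)
  also have "\<dots> = real (card {a..M}) * (B * indicator (cap z h) x)"
    by simp
  also have "\<dots> \<le> real (Suc M) * (B * indicator (cap z h) x)"
    using B by (intro mult_right_mono) auto
  finally show ?thesis
    by (simp add: mult.assoc)
qed

lemma zonal_comb_step:
  fixes f :: "'a::euclidean_space \<Rightarrow> 'a \<Rightarrow> real" and M :: nat
  defines "d \<equiv> real DIM('a) - 1"
  defines "K \<equiv> 6 * real (Suc M) * (1 + real M * (2 * real M + d))"
  assumes f: "zonal_comb M a h B f" and a: "3 \<le> a" and h: "0 < h" "h \<le> 2"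
  shows "\<exists>g. zonal_comb M (a - 2) h (K * B / h) g \<and>
    (\<forall>z. norm z = 1 \<longrightarrow> is_LB (f z) (\<lambda>x. f z x - g z x))"
proof -
  obtain c where c: "\<And>k. \<bar>c k\<bar> \<le> B" "f = (\<lambda>z x. \<Sum>k=a..M. c k * bump k h z x)"
    using f unfolding zonal_comb_def by blast
  have B: "0 \<le> B"
    using c(1)[of 0] by linarith
  have d: "0 \<le> d"
    using DIM_positive[where ?'a='a] by (simp add: d_def Suc_leI)
  define Q where "Q = 2 * (1 + real M * (2 * real M + d))"
  define p where "p k = 1 + real k * (real k - 1 + d)" for k
  define q where "q k = real k * (2 * (real k - 1) + d) * (1 - h) / h" for k
  define r where "r k = - (real k * (real k - 1) * (2 - h) / h)" for k
  define G where "G k z x = c k * p k * bump k h z x + c k * q k * bump (k - 1) h z x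
    + c k * r k * bump (k - 2) h z x" for k and z x :: 'a
  have bounds: "\<bar>p k\<bar> \<le> Q / h" "\<bar>q k\<bar> \<le> Q / h" "\<bar>r k\<bar> \<le> Q / h" if k: "a \<le> k" "k \<le> M" for k
  proof -
    have k1: "1 \<le> real k" "real k \<le> real M"
      using a k by auto
    have "0 \<le> real k * (real k - 1 + d)"
      using k1 d by (intro mult_nonneg_nonneg) auto
    moreover have "real k * (real k - 1 + d) \<le> real M * (2 * real M + d)"
      using k1 d by (intro mult_mono) auto
    ultimately have p: "0 \<le> p k" "p k \<le> Q / 2"
      by (simp_all add: p_def Q_def)
    then have "p k * h \<le> Q / 2 * 2"
      using h by (intro mult_mono) auto
    with p show "\<bar>p k\<bar> \<le> Q / h"
      using h by (simp add: pos_le_divide_eq)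
    have "0 \<le> real k * (2 * (real k - 1) + d)"
      using k1 d by (intro mult_nonneg_nonneg) auto
    moreover have "real k * (2 * (real k - 1) + d) \<le> real M * (2 * real M + d)"
      using k1 d by (intro mult_mono) auto
    ultimately have "\<bar>real k * (2 * (real k - 1) + d)\<bar> * \<bar>1 - h\<bar> \<le> Q * 1"
      unfolding Q_def using h by (intro mult_mono) auto
    then show "\<bar>q k\<bar> \<le> Q / h"
      unfolding q_def using h by (simp add: abs_mult divide_right_mono)
    have "0 \<le> real k * (real k - 1)"
      using k1 by (intro mult_nonneg_nonneg) auto
    moreover have "real k * (real k - 1) \<le> real M * (2 * real M + d)"
      using k1 d by (intro mult_mono) auto
    ultimately have "\<bar>real k * (real k - 1)\<bar> * \<bar>2 - h\<bar> \<le> Q / 2 * 2"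
      unfolding Q_def using h by (intro mult_mono) auto
    then show "\<bar>r k\<bar> \<le> Q / h"
      unfolding r_def using h by (simp add: abs_mult divide_right_mono)
  qed
  have coeff: "\<bar>c k * y\<bar> \<le> B * (Q / h)" if "\<bar>y\<bar> \<le> Q / h" for k y
    unfolding abs_mult using that c(1)[of k] B by (intro mult_mono) auto
  have "zonal_comb M (a - 2) h (B * (Q / h) + B * (Q / h) + B * (Q / h)) (G k)" if k: "a \<le> k"
      "k \<le> M" for k
    unfolding G_def using k a bounds[OF k] by (intro zonal_comb_add zonal_comb_single coeff) auto
  then have "zonal_comb M (a - 2) h (real (card {a..M}) * (B * (Q / h) + B * (Q / h) + B * (Q / h)))
      (\<lambda>z x. \<Sum>k=a..M. G k z x)"
    by (intro zonal_comb_sum) auto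
  moreover have "real (card {a..M}) * (B * (Q / h) + B * (Q / h) + B * (Q / h)) \<le> K * B / h"
  proof -
    have "real (card {a..M}) * (B * (Q / h) + B * (Q / h) + B * (Q / h)) \<le>
        real (Suc M) * (B * (Q / h) + B * (Q / h) + B * (Q / h))"
      using B h d by (intro mult_right_mono) (auto simp: Q_def
          intro!: add_nonneg_nonneg mult_nonneg_nonneg divide_nonneg_nonneg)
    also have "\<dots> = K * B / h"
    proof -
      have "K = 3 * real (Suc M) * Q"
        by (simp add: K_def Q_def algebra_simps)
      then show ?thesis
        by simp
    qed
    finally show ?thesis .
  qed
  ultimately have "zonal_comb M (a - 2) h (K * B / h) (\<lambda>z x. \<Sum>k=a..M. G k z x)"
    by (rule zonal_comb_mono)
  moreover have "is_LB (f z) (\<lambda>x. f z x - (\<Sum>k=a..M. G k z x))" if z: "norm z = 1" for z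
  proof -
    have LB: "is_LB (bump k h z) (\<lambda>x. bump k h z x - (p k * bump k h z x + q k * bump (k - 1) h z x
        + r k * bump (k - 2) h z x))" if k: "a \<le> k" for k
    proof -
      obtain b where b: "k = Suc (Suc (Suc b))"
        using a k that[of "k - 3"] by simp
      have "is_LB (bump k h z) (\<lambda>x. real k * (real k - 1) * (2 - h) / h * bump (k - 2) h z x
         - real k * (2 * (real k - 1) + d) * (1 - h) / h * bump (k - 1) h z x
         - real k * (real k - 1 + d) * bump k h z x)"
        using is_LB_bump[OF _ z, of h b] h(1) by (simp add: b d_def)
      then show ?thesis
        by (rule is_LB_cong) (simp add: p_def q_def r_def algebra_simps)
    qed
    have "is_LB (\<lambda>x. \<Sum>k=a..M. c k * bump k h z x) (\<lambda>x. \<Sum>k=a..M. c k * (bump k h z x -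
        (p k * bump k h z x + q k * bump (k - 1) h z x + r k * bump (k - 2) h z x)))"
      by (intro is_LB_sum is_LB_cmult LB) auto
    then show ?thesis
      unfolding c(2)
      by (rule is_LB_cong) (simp add: G_def sum_subtractf[symmetric] algebra_simps)
  qed
  ultimately show ?thesis
    by blast
qed

text \<open>
  Each application of \<open>1 - \<Delta>\<^sup>*\<close> costs a factor \<open>1 / h\<close> and two powers; exponents at least 3
  keep the functions twice continuously differentiable.
\<close>

lemma bump_powers:
  fixes m :: nat
  defines "M \<equiv> 2 * m + 3"
  assumes "j \<le> Suc m"
  shows "\<exists>K>0. \<forall>h. 0 < h \<longrightarrow> h \<le> 2 \<longrightarrow>
    (\<exists>F :: nat \<Rightarrow> 'a::euclidean_space \<Rightarrow> 'a \<Rightarrow> real. F 0 = bump M h \<and>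
      (\<forall>i\<le>j. zonal_comb M (M - 2 * i) h (K / h ^ i) (F i)) \<and>
      (\<forall>i<j. \<forall>z. norm z = 1 \<longrightarrow> is_LB (F i z) (\<lambda>x. F i z x - F (Suc i) z x)))"
  using assms(2)
proof (induction j)
  case 0
  have "zonal_comb M M h 1 (bump M h)" for h
    using zonal_comb_single[of M M M 1 1 h] by simp
  then show ?case
    by (intro exI[of _ 1]) (auto intro!: exI[of _ "\<lambda>_. bump M _"])
next
  case (Suc j)
  then obtain K where K: "K > 0"
    "\<And>h. 0 < h \<Longrightarrow> h \<le> 2 \<Longrightarrow> \<exists>F :: nat \<Rightarrow> 'a \<Rightarrow> 'a \<Rightarrow> real. F 0 = bump M h \<and>
      (\<forall>i\<le>j. zonal_comb M (M - 2 * i) h (K / h ^ i) (F i)) \<and>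
      (\<forall>i<j. \<forall>z. norm z = 1 \<longrightarrow> is_LB (F i z) (\<lambda>x. F i z x - F (Suc i) z x))"
    by auto
  define K1 where "K1 = 6 * real (Suc M) * (1 + real M * (2 * real M + (real DIM('a) - 1)))"
  define K' where "K' = max K (K1 * K)"
  have K': "K' > 0" "K \<le> K'" "K1 * K \<le> K'"
    using K(1) by (auto simp: K'_def)
  show ?case
  proof (intro exI[of _ K'] conjI allI impI K'(1))
    fix h :: real assume h: "0 < h" "h \<le> 2"
    obtain F :: "nat \<Rightarrow> 'a \<Rightarrow> 'a \<Rightarrow> real" where F: "F 0 = bump M h"
      "\<And>i. i \<le> j \<Longrightarrow> zonal_comb M (M - 2 * i) h (K / h ^ i) (F i)"
      "\<And>i z. i < j \<Longrightarrow> norm z = 1 \<Longrightarrow> is_LB (F i z) (\<lambda>x. F i z x - F (Suc i) z x)"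
      using K(2)[OF h] by blast
    have "3 \<le> M - 2 * j"
      using Suc.prems by (simp add: M_def)
    from zonal_comb_step[OF F(2)[OF order_refl] this h]
    obtain g where g: "zonal_comb M (M - 2 * j - 2) h (K1 * (K / h ^ j) / h) g"
      "\<And>z. norm z = 1 \<Longrightarrow> is_LB (F j z) (\<lambda>x. F j z x - g z x)"
      unfolding K1_def by blast
    define F' where "F' i = (if i \<le> j then F i else g)" for i
    have "zonal_comb M (M - 2 * i) h (K' / h ^ i) (F' i)" if i: "i \<le> Suc j" for i
    proof (cases "i \<le> j")
      case True
      have "K / h ^ i \<le> K' / h ^ i"
        using K' h by (intro divide_right_mono) auto
      then show ?thesis
        using zonal_comb_mono[OF F(2)[OF True]] True by (simp add: F'_def)
    next
      case False
      then have i: "i = Suc j"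
        using i by simp
      have "K1 * (K / h ^ j) / h \<le> K' / h ^ i"
        using K' h by (simp add: i divide_right_mono mult.commute[of h])
      moreover have "M - 2 * j - 2 = M - 2 * i"
        by (simp add: i)
      ultimately show ?thesis
        using zonal_comb_mono[OF g(1)] i by (simp add: F'_def)
    qed
    moreover have "is_LB (F' i z) (\<lambda>x. F' i z x - F' (Suc i) z x)" if "i < Suc j"
        "norm z = 1" for i z
    proof (cases "i < j")
      case True
      then show ?thesis
        using F(3)[OF True that(2)] by (simp add: F'_def)
    next
      case False
      then have "i = j"
        using that by simp
      then show ?thesis
        using g(2)[OF that(2)] by (simp add: F'_def)
    qed
    ultimately show "\<exists>F :: nat \<Rightarrow> 'a \<Rightarrow> 'a \<Rightarrow> real. F 0 = bump M h \<and>
      (\<forall>i\<le>Suc j. zonal_comb M (M - 2 * i) h (K' / h ^ i) (F i)) \<and>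
      (\<forall>i<Suc j. \<forall>z. norm z = 1 \<longrightarrow> is_LB (F i z) (\<lambda>x. F i z x - F (Suc i) z x))"
      using F(1) by (intro exI[of _ F']) (auto simp: F'_def)
  qed
qed

lemma sum_indicator_cap_le_1:
  assumes "finite I" "disjoint_family_on (\<lambda>k. cap (z k) h) I"
  shows "(\<Sum>k\<in>I. indicator (cap (z k) h) x) \<le> (1::real)"
proof -
  have "(\<Sum>k\<in>I. indicator (cap (z k) h) x) = (indicator (\<Union>k\<in>I. cap (z k) h) x :: real)"
    by (rule indicator_UN_disjoint[OF assms, symmetric])
  also have "\<dots> \<le> 1"
    by (simp add: indicator_def)
  finally show ?thesis .
qed

text \<open>At most one summand is nonzero at any point, so the supremum does not grow with the
  number of caps, while the \<open>L\<^sub>1\<close> norm is at most proportional to it.\<close>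

lemma continuous_zonal_sum_bounds:
  fixes z :: "nat \<Rightarrow> 'a::euclidean_space"
  assumes f: "zonal_comb M a h B f" "0 < a" "0 < h"
    and I: "finite I" "\<And>k. k \<in> I \<Longrightarrow> norm (z k) = 1" "disjoint_family_on (\<lambda>k. cap (z k) h) I"
    and v: "\<And>k. k \<in> I \<Longrightarrow> measure sphere_measure (cap (z k) h) \<le> v"
  shows "\<And>x. x \<in> sphere 0 1 \<Longrightarrow> \<bar>\<Sum>k\<in>I. f (z k) x\<bar> \<le> real (Suc M) * B"
    "(\<integral>x. \<bar>\<Sum>k\<in>I. f (z k) x\<bar> \<partial>sphere_measure) \<le> real (Suc M) * B * (real (card I) * v)"
proof -
  have "0 \<le> B"
  proof -
    obtain c :: "nat \<Rightarrow> real" where "\<And>k. \<bar>c k\<bar> \<le> B"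
      using f(1) unfolding zonal_comb_def by blast
    from this[of "0::nat"] show ?thesis by linarith
  qed
  define b where "b = real (Suc M) * B"
  have b: "0 \<le> b"
    using \<open>0 \<le> B\<close> by (simp add: b_def)
  have le: "\<bar>\<Sum>k\<in>I. f (z k) x\<bar> \<le> b * (\<Sum>k\<in>I. indicator (cap (z k) h) x)" if "x \<in> sphere 0 1" for x
  proof -
    have "\<bar>\<Sum>k\<in>I. f (z k) x\<bar> \<le> (\<Sum>k\<in>I. \<bar>f (z k) x\<bar>)"
      by (rule sum_abs)
    also have "\<dots> \<le> (\<Sum>k\<in>I. b * indicator (cap (z k) h) x)"
      unfolding b_def using I(2) that by (intro sum_mono zonal_comb_bound[OF f]) auto
    finally show ?thesis
      by (simp add: sum_distrib_left)
  qed
  show "\<bar>\<Sum>k\<in>I. f (z k) x\<bar> \<le> real (Suc M) * B" if "x \<in> sphere 0 1" for x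
    using le[OF that] mult_left_mono[OF sum_indicator_cap_le_1[OF I(1,3), of x] b]
    unfolding b_def[symmetric] by linarith
  have int: "integrable sphere_measure (\<lambda>x. indicator (cap w h) x :: real)" for w :: 'a
    by (intro integrable_real_indicator cap_sets)
      (simp add: sphere.emeasure_finite less_top[symmetric])
  have m: "(\<integral>x. indicator (cap w h) x \<partial>sphere_measure) =
      measure sphere_measure (cap w h)" for w :: 'a
    by simp
  have "(\<integral>x. \<bar>\<Sum>k\<in>I. f (z k) x\<bar> \<partial>sphere_measure) \<le>
      (\<integral>x. b * (\<Sum>k\<in>I. indicator (cap (z k) h) x) \<partial>sphere_measure)"
  proof (rule integral_mono)
    show "integrable sphere_measure (\<lambda>x. \<bar>\<Sum>k\<in>I. f (z k) x\<bar>)"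
      using f(3) by (intro sphere_integrable_continuous continuous_on_rabs continuous_on_sum
          zonal_comb_continuous[OF f(1)]) auto
    show "integrable sphere_measure (\<lambda>x. b * (\<Sum>k\<in>I. indicator (cap (z k) h) x))"
      by (intro integrable_mult_right Bochner_Integration.integrable_sum int)
  qed (use le in simp)
  also have "\<dots> = b * (\<Sum>k\<in>I. measure sphere_measure (cap (z k) h))"
    using int by (simp add: Bochner_Integration.integral_sum m)
  also have "\<dots> \<le> b * (real (card I) * v)"
    using sum_mono[OF v] b by (intro mult_left_mono) auto
  finally show "(\<integral>x. \<bar>\<Sum>k\<in>I. f (z k) x\<bar> \<partial>sphere_measure) \<le> real (Suc M) * B * (real (card I) * v)"
    by (simp add: b_def)
qed

text \<open>On the concentric cap of half the height, the base of the power is at least 1/2.\<close>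

lemma bump_integral_lower:
  fixes z :: "'a::euclidean_space"
  assumes z: "norm z = 1" and h: "0 < h"
  shows "(1/2) ^ M * measure sphere_measure (cap z (h / 2)) \<le> (\<integral>x. bump M h z x \<partial>sphere_measure)"
proof -
  have "(1/2) ^ M * measure sphere_measure (cap z (h / 2)) =
      (\<integral>x. (1/2) ^ M * indicator (cap z (h / 2)) x \<partial>sphere_measure)"
    by simp
  also have "\<dots> \<le> (\<integral>x. bump M h z x \<partial>sphere_measure)"
  proof (rule integral_mono)
    show "integrable sphere_measure (\<lambda>x. (1/2) ^ M * indicator (cap z (h / 2)) x :: real)"
      by (intro integrable_mult_right integrable_real_indicator cap_sets)
        (simp add: sphere.emeasure_finite less_top[symmetric])
    show "integrable sphere_measure (bump M h z)"
      using h by (intro sphere_integrable_continuous bump_continuous) simp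
    show "(1/2) ^ M * indicator (cap z (h / 2)) x \<le>
        bump M h z x" if "x \<in> space sphere_measure" for x
    proof (cases "x \<in> cap z (h / 2)")
      case True
      then have "h / 2 \<le> x \<bullet> z - (1 - h)"
        by (simp add: cap_def inner_commute)
      then have "1 / 2 * h \<le> max 0 (x \<bullet> z - (1 - h))"
        by (intro order_trans[OF _ max.cobounded2]) simp
      then have "1 / 2 \<le> max 0 (x \<bullet> z - (1 - h)) / h"
        by (simp only: pos_le_divide_eq[OF h])
      then have "(1/2) ^ M \<le> bump M h z x"
        unfolding bump_def by (rule power_mono) simp
      then show ?thesis
        using True by simp
    next
      case False
      then show ?thesis
        using bump_bounds[OF h z] that by simp
    qed
  qed
  finally show ?thesis .
qed

subsection \<open>Lower bound for the worst-case error\<close>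

text \<open>The quantity \<open>card I * h powr (d / 2)\<close> is the order of the total measure of
  the caps. Both bounds on \<open>g\<close> are stated with the same factor
  \<open>K * h powr (- s / 2)\<close>, so that they interpolate without loss. The constants precede
  \<open>h\<close>, \<open>I\<close> and \<open>z\<close>.\<close>

lemma test_function_exists:
  assumes s: "0 < s"
  obtains a K where "a > 0" "K > 0"
    "\<And>h I (z :: nat \<Rightarrow> 'a::euclidean_space). \<lbrakk>0 < h; h \<le> 2; finite I; \<And>k. k \<in> I \<Longrightarrow> norm (z k) = 1;
        disjoint_family_on (\<lambda>k. cap (z k) h) I\<rbrakk> \<Longrightarrow>
      \<exists>f g. continuous_on (sphere 0 1) f \<and> continuous_on (sphere 0 1) g \<and> bessel_image s f g \<and>
        (\<forall>x\<in>sphere 0 1 - (\<Union>k\<in>I. cap (z k) h). f x = 0) \<and>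
        a * (real (card I) * h powr (real (DIM('a) - 1) / 2)) \<le> (\<integral>x. f x \<partial>sphere_measure) \<and>
        (\<forall>x\<in>sphere 0 1. \<bar>g x\<bar> \<le> K * h powr (- s / 2)) \<and>
        (\<integral>x. \<bar>g x\<bar> \<partial>sphere_measure) \<le>
          K * h powr (- s / 2) * (real (card I) * h powr (real (DIM('a) - 1) / 2))"
proof -
  define \<kappa> where "\<kappa> = real (DIM('a) - 1) / 2"
  define j where "j = nat \<lfloor>s / 2\<rfloor>"
  define \<alpha> where "\<alpha> = s / 2 - real j"
  have \<alpha>: "0 \<le> \<alpha>" "\<alpha> < 1" and s2: "s / 2 = real j + \<alpha>"
    using s by (auto simp: \<alpha>_def j_def) linarith+
  \<comment> \<open>Applying 1 - \<Delta>* \<open>j + 1\<close> times lowers exponents by at most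
    \<open>2 * j + 2\<close>, so all remain at least 1 and the last function is still continuous and
    supported in the caps.\<close>
  define M where "M = 2 * j + 3"
  obtain K0 where K0: "K0 > 0" "\<And>h. 0 < h \<Longrightarrow> h \<le> 2 \<Longrightarrow>
      \<exists>F :: nat \<Rightarrow> 'a \<Rightarrow> 'a \<Rightarrow> real. F 0 = bump M h \<and>
      (\<forall>i\<le>Suc j. zonal_comb M (M - 2 * i) h (K0 / h ^ i) (F i)) \<and>
      (\<forall>i<Suc j. \<forall>z. norm z = 1 \<longrightarrow> is_LB (F i z) (\<lambda>x. F i z x - F (Suc i) z x))"
    using bump_powers[OF order_refl, of j, where ?'a='a] unfolding M_def by auto
  obtain a0 c0 where ac: "a0 > 0" "c0 > 0"
    "\<And>(z::'a) h. \<lbrakk>norm z = 1; 0 < h; h \<le> 2\<rbrakk> \<Longrightarrow> a0 * h powr \<kappa> \<le> measure sphere_measure (cap z h)"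
    "\<And>(z::'a) h. \<lbrakk>norm z = 1; 0 < h; h \<le> 2\<rbrakk> \<Longrightarrow> measure sphere_measure (cap z h) \<le> c0 * h powr \<kappa>"
    unfolding \<kappa>_def using measure_cap_bounds[where ?'a='a] by blast
  \<comment> \<open>The implication yields a single positive constant also when \<open>s / 2\<close>
    is an integer, where no fractional step is taken.\<close>
  have "\<exists>C>0. 0 < \<alpha> \<longrightarrow> (\<forall>(U :: 'a \<Rightarrow> real) W T.
      continuous_on (sphere 0 1) U \<longrightarrow> continuous_on (sphere 0 1) W \<longrightarrow>
      (\<forall>l. \<forall>h\<in>solid_harmonics l. sphere_inner h W = ev TYPE('a) l * sphere_inner h U) \<longrightarrow> 0 < T \<longrightarrow>
      (\<exists>G. fractional_power \<alpha> C T U W G))"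
  proof (cases "0 < \<alpha>")
    case True
    show ?thesis
    proof (rule fractional_power_exists[OF True \<alpha>(2), where ?'a='a])
      fix C assume C: "C > 0"
          "\<And>U W :: 'a \<Rightarrow> real. \<And>T. \<lbrakk>continuous_on (sphere 0 1) U; continuous_on (sphere 0 1) W;
       \<And>l h. h \<in> solid_harmonics l \<Longrightarrow> sphere_inner h W = ev TYPE('a) l * sphere_inner h U; 0 < T\<rbrakk> \<Longrightarrow>
       \<exists>G. fractional_power \<alpha> C T U W G"
      show ?thesis
        by (intro exI[of _ C] conjI impI allI C(1)) (rule C(2); simp)
    qed
  qed (auto intro!: exI[of _ 1])
  then obtain C where C: "C > 0" and frac: "\<And>(U :: 'a \<Rightarrow> real) W T. \<lbrakk>0 < \<alpha>; continuous_on (sphere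
      0 1) U;
      continuous_on (sphere 0 1) W;
      \<forall>l. \<forall>h\<in>solid_harmonics l. sphere_inner h W = ev TYPE('a) l * sphere_inner h U; 0 < T\<rbrakk> \<Longrightarrow>
      \<exists>G. fractional_power \<alpha> C T U W G"
    by blast
  define a where "a = (1/2) ^ M * (a0 * (1/2) powr \<kappa>)"
  define b where "b = real (Suc M) * K0"
  \<comment> \<open>The factor \<open>2 * C + 1\<close> serves both the fractional and the integer
    case; \<open>c0 + 1\<close> serves both the \<open>L\<^sub>1\<close> and the supremum
    bound.\<close>
  define K where "K = (2 * C + 1) * b * (c0 + 1)"
  have b: "b > 0"
    using K0(1) by (simp add: b_def)
  show thesis
  proof (rule that[of a K])
    show "a > 0"
      using ac by (simp add: a_def)
    show "K > 0"
      using ac C b by (simp add: K_def add_pos_pos)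
    fix h I and z :: "nat \<Rightarrow> 'a"
    assume h: "0 < h" "h \<le> 2" and I: "finite I" "\<And>k. k \<in> I \<Longrightarrow> norm (z k) = 1"
      "disjoint_family_on (\<lambda>k. cap (z k) h) I"
    define v where "v = real (card I) * h powr \<kappa>"
    have v: "0 \<le> v"
      by (simp add: v_def)
    obtain F :: "nat \<Rightarrow> 'a \<Rightarrow> 'a \<Rightarrow> real" where F: "F 0 = bump M h"
      "\<And>i. i \<le> Suc j \<Longrightarrow> zonal_comb M (M - 2 * i) h (K0 / h ^ i) (F i)"
      "\<And>i z. i < Suc j \<Longrightarrow> norm z = 1 \<Longrightarrow> is_LB (F i z) (\<lambda>x. F i z x - F (Suc i) z x)"
      using K0(2)[OF h] by blast
    define U where "U i x = (\<Sum>k\<in>I. F i (z k) x)" for i x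
    have Uc: "continuous_on (sphere 0 1) (U i)" if "i \<le> Suc j" for i
      unfolding U_def using h zonal_comb_continuous[OF F(2)[OF that]]
      by (intro continuous_on_sum) auto
    have LB: "is_LB (U i) (\<lambda>x. U i x - U (Suc i) x)" if "i < Suc j" for i
    proof -
      have "is_LB (U i) (\<lambda>x. \<Sum>k\<in>I. F i (z k) x - F (Suc i) (z k) x)"
        unfolding U_def using F(3)[OF that I(2)] by (intro is_LB_sum I(1))
      then show ?thesis
        by (rule is_LB_cong) (simp add: U_def sum_subtractf)
    qed
    have next_coeff: "sphere_inner y (U (Suc i)) = ev TYPE('a) l * sphere_inner y (U i)"
      if i: "i < Suc j" and y: "y \<in> solid_harmonics l" for i l y
    proof -
      have "sphere_inner y (\<lambda>x. U i x - U (Suc i) x) =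
          sphere_inner y (U i) - sphere_inner y (U (Suc i))"
        using i by (intro sphere_inner_diff_right sphere_integrable_continuous Uc
            solid_harmonics_continuous[OF y]) auto
      then show ?thesis
        using is_LB_harmonic_coefficients[OF LB[OF i] y] by (simp add: ev_def algebra_simps)
    qed
    have coeff: "sphere_inner y (U i) = ev TYPE('a) l ^ i * sphere_inner y (U 0)"
      if "i \<le> Suc j" and y: "y \<in> solid_harmonics l" for i l y
      using that(1) by (induction i) (auto simp: next_coeff[OF _ y])
    have sup: "\<bar>U i x\<bar> \<le> b / h ^ i" if "i \<le> Suc j" "x \<in> sphere 0 1" for i x
    proof -
      have "0 < M - 2 * i"
        using that(1) by (simp add: M_def)
      from continuous_zonal_sum_bounds(1)[OF F(2)[OF that(1)] this h(1) I ac(4)[OF I(2) h] that(2)]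
      show ?thesis
        by (simp add: U_def b_def)
    qed
    have L1: "(\<integral>x. \<bar>U i x\<bar> \<partial>sphere_measure) \<le> b / h ^ i * (c0 * v)" if "i \<le> Suc j" for i
    proof -
      have "0 < M - 2 * i"
        using that(1) by (simp add: M_def)
      from continuous_zonal_sum_bounds(2)[OF F(2)[OF that(1)] this h(1) I ac(4)[OF I(2) h]]
      show ?thesis
        by (simp add: U_def b_def v_def mult_ac)
    qed
    have hpow: "h powr (- s / 2) = h powr (- \<alpha>) / h ^ j"
    proof -
      have "- s / 2 = - \<alpha> - real j"
        using s2 by linarith
      then show ?thesis
        using h(1) by (simp only:) (simp add: powr_diff powr_realpow)
    qed
    have "\<exists>g. continuous_on (sphere 0 1) g \<and>
        (\<forall>l. \<forall>y\<in>solid_harmonics l. sphere_inner y g =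
            ev TYPE('a) l powr (s / 2) * sphere_inner y (U 0)) \<and>
        (\<forall>x\<in>sphere 0 1. \<bar>g x\<bar> \<le> K * h powr (- s / 2)) \<and>
        (\<integral>x. \<bar>g x\<bar> \<partial>sphere_measure) \<le> K * h powr (- s / 2) * v"
    proof (cases "0 < \<alpha>")
      case False
      then have \<alpha>0: "\<alpha> = 0"
        using \<alpha>(1) by simp
      have hj: "h powr (- s / 2) = 1 / h ^ j"
        using hpow h by (simp add: \<alpha>0)
      have "1 * b * 1 \<le> K" "1 * b * c0 \<le> K"
        unfolding K_def using C b ac(2) by (intro mult_mono; simp)+
      then have K: "b \<le> K" "b * c0 \<le> K"
        by simp_all
      show ?thesis
      proof (intro exI[of _ "U j"] conjI allI ballI)
        show "continuous_on (sphere 0 1) (U j)"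
          by (rule Uc) simp
        fix l and y :: "'a \<Rightarrow> real" assume "y \<in> solid_harmonics l"
        from coeff[OF _ this, of j]
        show "sphere_inner y (U j) = ev TYPE('a) l powr (s / 2) * sphere_inner y (U 0)"
          using ev_ge_1[where ?'a='a, of l] by (simp add: s2 \<alpha>0 powr_realpow)
      next
        fix x :: 'a assume "x \<in> sphere 0 1"
        then have "\<bar>U j x\<bar> \<le> b / h ^ j"
          by (intro sup) auto
        also have "\<dots> \<le> K / h ^ j"
          using K h by (intro divide_right_mono) auto
        finally show "\<bar>U j x\<bar> \<le> K * h powr (- s / 2)"
          unfolding hj by simp
      next
        have "(\<integral>x. \<bar>U j x\<bar> \<partial>sphere_measure) \<le> (b * c0) / h ^ j * v"
          using L1[of j] by (simp add: mult_ac)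
        also have "\<dots> \<le> K / h ^ j * v"
          using K h v by (intro mult_right_mono divide_right_mono) auto
        finally show "(\<integral>x. \<bar>U j x\<bar> \<partial>sphere_measure) \<le> K * h powr (- s / 2) * v"
          unfolding hj by simp
      qed
    next
      case True
      have step: "\<forall>l. \<forall>y\<in>solid_harmonics l. sphere_inner y (U (Suc j)) =
          ev TYPE('a) l * sphere_inner y (U j)"
        by (simp add: next_coeff)
      \<comment> \<open>The choice T = 1 / h: the bound on \<open>U (Suc j)\<close> exceeds that on
        \<open>U j\<close> by the factor 1 / h, which T^(\<alpha>-1) compensates exactly.\<close>
      obtain G where G: "continuous_on (sphere 0 1) G"
        "\<And>l y. y \<in> solid_harmonics l \<Longrightarrow>
            sphere_inner y G = ev TYPE('a) l powr \<alpha> * sphere_inner y (U j)"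
        "\<And>B0 B1 x. \<forall>x\<in>sphere 0 1. \<bar>U j x\<bar> \<le> B0 \<Longrightarrow> \<forall>x\<in>sphere 0 1. \<bar>U (Suc j) x\<bar> \<le> B1 \<Longrightarrow>
            x \<in> sphere 0 1 \<Longrightarrow>
           \<bar>G x\<bar> \<le> C * ((1 / h) powr \<alpha> * B0 + (1 / h) powr (\<alpha> - 1) * B1)"
        "(\<integral>x. \<bar>G x\<bar> \<partial>sphere_measure) \<le>
           C * ((1 / h) powr \<alpha> * (\<integral>x. \<bar>U j x\<bar> \<partial>sphere_measure) + (1 / h) powr (\<alpha> -
               1) * (\<integral>x. \<bar>U (Suc j) x\<bar> \<partial>sphere_measure))"
        using frac[OF True Uc Uc step, of "1 / h"] h unfolding fractional_power_def by auto
      have p1: "(1 / h) powr \<alpha> * (y / h ^ j) = h powr (- s / 2) * y"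
        and p2: "(1 / h) powr (\<alpha> - 1) * (y / h ^ Suc j) = h powr (- s / 2) * y" for y
      proof -
        have e: "(1 / h) powr \<alpha> = h powr (- \<alpha>)" "(1 / h) powr (\<alpha> - 1) = h powr (- \<alpha>) * h"
          using h powr_add[of h "- \<alpha>" 1] by (simp_all add: powr_divide powr_minus_divide powr_diff)
        show "(1 / h) powr \<alpha> * (y / h ^ j) = h powr (- s / 2) * y"
          unfolding hpow e by simp
        show "(1 / h) powr (\<alpha> - 1) * (y / h ^ Suc j) = h powr (- s / 2) * y"
          unfolding hpow e using h by simp
      qed
      have "2 * C * b * 1 \<le> K" "2 * C * b * c0 \<le> K"
        unfolding K_def using C b ac(2) by (intro mult_mono; simp)+
      then have K: "2 * C * b \<le> K" "2 * C * b * c0 \<le> K"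
        by simp_all
      show ?thesis
      proof (intro exI[of _ G] conjI allI ballI G(1))
        fix l and y :: "'a \<Rightarrow> real" assume y: "y \<in> solid_harmonics l"
        have "ev TYPE('a) l powr (s / 2) = ev TYPE('a) l powr \<alpha> * ev TYPE('a) l ^ j"
          using ev_ge_1[where ?'a='a, of l] by (simp add: s2 powr_add powr_realpow)
        then show "sphere_inner y G = ev TYPE('a) l powr (s / 2) * sphere_inner y (U 0)"
          using G(2)[OF y] coeff[OF _ y, of j] by simp
      next
        fix x :: 'a assume x: "x \<in> sphere 0 1"
        have "\<bar>G x\<bar> \<le> C * ((1 / h) powr \<alpha> * (b / h ^ j) + (1 / h) powr (\<alpha> - 1) * (b / h ^ Suc j))"
          using sup[of j] sup[of "Suc j"] by (intro G(3) x) auto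
        also have "\<dots> = (2 * C * b) * h powr (- s / 2)"
          unfolding p1 p2 by simp
        also have "\<dots> \<le> K * h powr (- s / 2)"
          using K(1) by (intro mult_right_mono) auto
        finally show "\<bar>G x\<bar> \<le> K * h powr (- s / 2)" .
      next
        have "(\<integral>x. \<bar>G x\<bar> \<partial>sphere_measure) \<le>
          C * ((1 / h) powr \<alpha> * (b * (c0 * v) / h ^ j) + (1 / h) powr (\<alpha> -
              1) * (b * (c0 * v) / h ^ Suc j))"
          using L1[of j] L1[of "Suc j"] C
          by (intro order_trans[OF G(4)] mult_left_mono add_mono) auto
        also have "\<dots> = (2 * C * b * c0) * (h powr (- s / 2) * v)"
          unfolding p1 p2 by simp
        also have "\<dots> \<le> K * (h powr (- s / 2) * v)"
          using K(2) v by (intro mult_right_mono) auto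
        finally show "(\<integral>x. \<bar>G x\<bar> \<partial>sphere_measure) \<le> K * h powr (- s / 2) * v"
          by (simp add: mult.assoc)
      qed
    qed
    then obtain g where g: "continuous_on (sphere 0 1) g"
      "\<And>l y. y \<in> solid_harmonics l \<Longrightarrow>
          sphere_inner y g = ev TYPE('a) l powr (s / 2) * sphere_inner y (U 0)"
      "\<forall>x\<in>sphere 0 1. \<bar>g x\<bar> \<le> K * h powr (- s / 2)"
      "(\<integral>x. \<bar>g x\<bar> \<partial>sphere_measure) \<le> K * h powr (- s / 2) * v"
      by blast
    have U0c: "continuous_on (sphere 0 1) (U 0)"
      by (rule Uc) simp
    have "bessel_image s (U 0) g"
      unfolding bessel_image_def
    proof (intro allI ballI)
      fix l and x :: 'a assume "x \<in> sphere 0 1"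
      then show "harmonic_proj l g x =
          (1 + lb_eigenvalue (DIM('a) - 1) l) powr (s / 2) * harmonic_proj l (U 0) x"
        using g(2) unfolding ev_def
        by (intro harmonic_proj_scaled sphere_integrable_continuous g(1) U0c)
    qed
    moreover have "U 0 x = 0" if "x \<in> sphere 0 1 - (\<Union>k\<in>I. cap (z k) h)" for x
      unfolding U_def F(1) using that by (intro sum.neutral ballI bump_outside) (auto simp: M_def)
    moreover have "a * v \<le> (\<integral>x. U 0 x \<partial>sphere_measure)"
    proof -
      have "a * h powr \<kappa> \<le> (\<integral>x. bump M h (z k) x \<partial>sphere_measure)" if "k \<in> I" for k
      proof -
        have "a * h powr \<kappa> = (1/2) ^ M * (a0 * (h / 2) powr \<kappa>)"
          using h(1) by (simp add: a_def powr_divide)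
        also have "\<dots> \<le> (1/2) ^ M * measure sphere_measure (cap (z k) (h / 2))"
          using h I(2)[OF that] by (intro mult_left_mono ac(3)) auto
        also have "\<dots> \<le> (\<integral>x. bump M h (z k) x \<partial>sphere_measure)"
          by (rule bump_integral_lower[OF I(2)[OF that] h(1)])
        finally show ?thesis .
      qed
      then have "(\<Sum>k\<in>I. a * h powr \<kappa>) \<le> (\<Sum>k\<in>I. \<integral>x. bump M h (z k) x \<partial>sphere_measure)"
        by (rule sum_mono)
      also have "\<dots> = (\<integral>x. U 0 x \<partial>sphere_measure)"
        unfolding U_def F(1) using h(1)
        by (intro Bochner_Integration.integral_sum[symmetric] sphere_integrable_continuous
            bump_continuous) simp
      finally show ?thesis
        by (simp add: v_def mult_ac)
    qed
    ultimately show "\<exists>f g. continuous_on (sphere 0 1) f \<and> continuous_on (sphere 0 1) g \<and>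
        bessel_image s f g \<and>
        (\<forall>x\<in>sphere 0 1 - (\<Union>k\<in>I. cap (z k) h). f x = 0) \<and>
        a * (real (card I) * h powr (real (DIM('a) - 1) / 2)) \<le> (\<integral>x. f x \<partial>sphere_measure) \<and>
        (\<forall>x\<in>sphere 0 1. \<bar>g x\<bar> \<le> K * h powr (- s / 2)) \<and>
        (\<integral>x. \<bar>g x\<bar> \<partial>sphere_measure) \<le>
          K * h powr (- s / 2) * (real (card I) * h powr (real (DIM('a) - 1) / 2))"
      using g U0c unfolding v_def \<kappa>_def by (intro exI[of _ "U 0"] exI[of _ g]) simp
  qed
qed

text \<open>For finite \<open>p\<close>, |g|^p is at most \<Lambda>^(p-1) |g|, and the p-th root of
  the integrated bound has no constant depending on \<open>p\<close>. For infinite \<open>p\<close>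
  the power of \<open>v\<close> is 1.\<close>

lemma Lp_norm_bound:
  fixes g :: "'a::euclidean_space \<Rightarrow> real"
  assumes g: "continuous_on (sphere 0 1) g" and \<Lambda>: "0 < \<Lambda>" and v: "0 < v" and p: "1 \<le> p"
    and sup: "\<And>x. x \<in> sphere 0 1 \<Longrightarrow> \<bar>g x\<bar> \<le> \<Lambda>"
    and L1: "(\<integral>x. \<bar>g x\<bar> \<partial>sphere_measure) \<le> \<Lambda> * v"
  shows "g \<in> Lp_space p sphere_measure"
    and "Lp_norm p sphere_measure g \<le> \<Lambda> * v powr real_of_ereal (1 / p)"
proof -
  have meas: "g \<in> borel_measurable sphere_measure"
    by (rule sphere_borel_measurable_continuous[OF g])
  have "g \<in> Lp_space p sphere_measure \<and> Lp_norm p sphere_measure g \<le>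
      \<Lambda> * v powr real_of_ereal (1 / p)"
  proof (cases p)
    case (real P)
    then have P: "1 \<le> P"
      using p by simp
    have pc: "continuous_on (sphere 0 1) (\<lambda>x. \<bar>g x\<bar> powr P)"
      using P by (intro continuous_on_powr' continuous_intros g) auto
    have "(\<integral>x. \<bar>g x\<bar> powr P \<partial>sphere_measure) \<le> (\<integral>x. \<Lambda> powr (P - 1) * \<bar>g x\<bar> \<partial>sphere_measure)"
    proof (rule sphere_integral_mono[OF pc])
      show "\<bar>g x\<bar> powr P \<le> \<Lambda> powr (P - 1) * \<bar>g x\<bar>" if "x \<in> sphere 0 1" for x
      proof -
        have "\<bar>g x\<bar> powr P = \<bar>g x\<bar> powr (P - 1) * \<bar>g x\<bar>"
          using powr_add[of "\<bar>g x\<bar>" "P - 1" 1] by simp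
        also have "\<dots> \<le> \<Lambda> powr (P - 1) * \<bar>g x\<bar>"
          using sup[OF that] P by (intro mult_right_mono powr_mono2) auto
        finally show ?thesis .
      qed
    qed (intro continuous_intros g)
    also have "\<dots> = \<Lambda> powr (P - 1) * (\<integral>x. \<bar>g x\<bar> \<partial>sphere_measure)"
      by simp
    also have "\<dots> \<le> \<Lambda> powr (P - 1) * (\<Lambda> * v)"
      by (intro mult_left_mono L1) auto
    also have "\<dots> = \<Lambda> powr P * v"
      using \<Lambda> powr_add[of \<Lambda> "P - 1" 1] by simp
    finally have "(\<integral>x. \<bar>g x\<bar> powr P \<partial>sphere_measure) powr (1 / P) \<le> (\<Lambda> powr P * v) powr (1 / P)"
      using P by (intro powr_mono2) auto
    also have "\<dots> = \<Lambda> * v powr (1 / P)"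
      using \<Lambda> v P by (simp add: powr_mult powr_powr)
    finally have "Lp_norm p sphere_measure g \<le> \<Lambda> * v powr (1 / P)"
      by (simp add: Lp_norm_def real)
    moreover have "real_of_ereal (1 / p) = 1 / P"
      using P by (simp add: real one_ereal_def)
    moreover have "g \<in> Lp_space p sphere_measure"
      using meas sphere_integrable_continuous[OF pc] by (simp add: Lp_space_def real)
    ultimately show ?thesis
      by simp
  next
    case PInf
    have le: "esssup sphere_measure (\<lambda>x. ereal \<bar>g x\<bar>) \<le> ereal \<Lambda>"
      using meas sup by (intro esssup_I) (auto intro!: AE_I2)
    then have "real_of_ereal (esssup sphere_measure (\<lambda>x. ereal \<bar>g x\<bar>)) \<le> \<Lambda>"
      using \<Lambda> by (cases "esssup sphere_measure (\<lambda>x. ereal \<bar>g x\<bar>)") auto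
    moreover have "esssup sphere_measure (\<lambda>x. ereal \<bar>g x\<bar>) < \<infinity>"
      using le by (rule order.strict_trans1) simp
    ultimately show ?thesis
      using meas v by (simp add: Lp_norm_def Lp_space_def PInf)
  next
    case MInf
    then show ?thesis using p by simp
  qed
  then show "g \<in> Lp_space p sphere_measure"
      "Lp_norm p sphere_measure g \<le> \<Lambda> * v powr real_of_ereal (1 / p)"
    by auto
qed

text \<open>The measure is finite and |g| is at most 1 + |g|^p.\<close>

lemma Lp_space_integrable:
  fixes g :: "'a::euclidean_space \<Rightarrow> real"
  assumes g: "g \<in> Lp_space p sphere_measure" and p: "1 \<le> p"
  shows "integrable sphere_measure g"
proof (cases p)
  case (real P)
  then have P: "1 \<le> P"
    using p by simp
  have meas: "g \<in> borel_measurable sphere_measure" and int: "integrable sphere_measure (\<lambda>x. \<bar>g x\<bar>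
      powr P)"
    using g by (auto simp: Lp_space_def real)
  show ?thesis
  proof (rule Bochner_Integration.integrable_bound[OF _ meas])
    show "integrable sphere_measure (\<lambda>x. 1 + \<bar>g x\<bar> powr P)"
      using int by simp
    have "\<bar>g x\<bar> \<le> 1 + \<bar>g x\<bar> powr P" for x
    proof (cases "\<bar>g x\<bar> \<le> 1")
      case True
      then show ?thesis by (simp add: add_increasing2)
    next
      case False
      then have "\<bar>g x\<bar> powr 1 \<le> \<bar>g x\<bar> powr P"
        using P by (intro powr_mono) auto
      then show ?thesis by simp
    qed
    then show "AE x in sphere_measure. norm (g x) \<le> norm (1 + \<bar>g x\<bar> powr P)"
      by (intro AE_I2) simp
  qed
next
  case PInf
  then have meas: "g \<in> borel_measurable sphere_measure"
    and fin: "esssup sphere_measure (\<lambda>x. ereal \<bar>g x\<bar>) < \<infinity>"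
    using g by (auto simp: Lp_space_def)
  obtain B where B: "esssup sphere_measure (\<lambda>x. ereal \<bar>g x\<bar>) \<le> ereal B"
    using fin by (cases "esssup sphere_measure (\<lambda>x. ereal \<bar>g x\<bar>)") auto
  have "AE x in sphere_measure. norm (g x) \<le> B"
    using esssup_AE[of "\<lambda>x. ereal \<bar>g x\<bar>" sphere_measure]
    by eventually_elim (use B in \<open>force dest: order_trans\<close>)
  then show ?thesis
    by (rule sphere.integrable_const_bound) (rule meas)
next
  case MInf
  then show ?thesis using p by simp
qed

lemma Lp_norm_cong_AE:
  assumes "f \<in> borel_measurable M" "g \<in> borel_measurable M" "AE x in M. f x = g x"
  shows "Lp_norm p M f = Lp_norm p M g"
proof -
  have "esssup M (\<lambda>x. ereal \<bar>f x\<bar>) = esssup M (\<lambda>x. ereal \<bar>g x\<bar>)"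
    using assms by (intro esssup_AE_cong) auto
  moreover have "(\<integral>x. \<bar>f x\<bar> powr real_of_ereal p \<partial>M) = (\<integral>x. \<bar>g x\<bar> powr real_of_ereal p \<partial>M)"
    using assms by (intro integral_cong_AE) auto
  ultimately show ?thesis
    by (simp add: Lp_norm_def)
qed

text \<open>The function selected by \<open>SOME\<close> has the same harmonic coefficients as
  \<open>g\<close>, hence agrees with it almost everywhere.\<close>

lemma sobolev_norm_eq:
  fixes f g :: "'a::euclidean_space \<Rightarrow> real"
  assumes g: "g \<in> Lp_space p sphere_measure" and fg: "bessel_image s f g" and p: "1 \<le> p"
  shows "sobolev_norm s p f = Lp_norm p sphere_measure g"
proof -
  define g' where "g' = (SOME g. g \<in> Lp_space p sphere_measure \<and> bessel_image s f g)"
  have g': "g' \<in> Lp_space p sphere_measure" "bessel_image s f g'"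
    using someI[of "\<lambda>g. g \<in> Lp_space p sphere_measure \<and> bessel_image s f g" g] g fg
    by (simp_all add: g'_def)
  have "AE x in sphere_measure. g' x = g x"
    using g' fg unfolding bessel_image_def
    by (intro AE_eq_if_harmonic_proj_eq Lp_space_integrable[OF g p] Lp_space_integrable[OF g'(1)
        p]) simp
  then have "Lp_norm p sphere_measure g' = Lp_norm p sphere_measure g"
    using g g' by (intro Lp_norm_cong_AE) (auto simp: Lp_space_def)
  then show ?thesis
    by (simp add: sobolev_norm_def g'_def)
qed

lemma harmonic_proj_cmult: "harmonic_proj l (\<lambda>x. c * f x) x = c * harmonic_proj l f x"
  by (simp add: harmonic_proj_def mult.left_commute)

text \<open>Division by the bound \<open>N\<close> on the Sobolev norm makes the function
  admissible. The quadrature sum vanishes, so the error is the integral alone.\<close>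

lemma wce_lower_bound:
  fixes f g :: "'a::euclidean_space \<Rightarrow> real"
  assumes f: "continuous_on (sphere 0 1) f" and g: "continuous_on (sphere 0 1) g"
    and fg: "bessel_image s f g" and \<Lambda>: "0 < \<Lambda>" and v: "0 < v" and p: "1 \<le> p"
    and sup: "\<And>x. x \<in> sphere 0 1 \<Longrightarrow> \<bar>g x\<bar> \<le> \<Lambda>"
    and L1: "(\<integral>x. \<bar>g x\<bar> \<partial>sphere_measure) \<le> \<Lambda> * v"
    and X: "\<And>x. x \<in> X \<Longrightarrow> f x = 0"
  shows "ennreal ((\<integral>x. f x \<partial>sphere_measure) / (\<Lambda> * v powr real_of_ereal (1 / p))) \<le> wce X s p"
proof -
  define N where "N = \<Lambda> * v powr real_of_ereal (1 / p)"
  have N: "N > 0"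
    using \<Lambda> v by (simp add: N_def)
  define f' g' where "f' x = 1 / N * f x" and "g' x = 1 / N * g x" for x
  have f'c: "continuous_on (sphere 0 1) f'" and g'c: "continuous_on (sphere 0 1) g'"
    unfolding f'_def g'_def by (intro continuous_intros f g)+
  have fg': "bessel_image s f' g'"
    using fg unfolding bessel_image_def f'_def g'_def harmonic_proj_cmult by simp
  have f'L: "f' \<in> Lp_space p sphere_measure"
  proof -
    obtain B where B: "B > 0" "\<And>x. x \<in> sphere 0 1 \<Longrightarrow> \<bar>f' x\<bar> \<le> B"
      using sphere_bounded_continuous[OF f'c] by blast
    have "(\<integral>x. \<bar>f' x\<bar> \<partial>sphere_measure) \<le> (\<integral>x. B \<partial>(sphere_measure :: 'a measure))"
      by (intro sphere_integral_mono continuous_intros f'c B)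
    then show ?thesis
      using Lp_norm_bound(1)[OF f'c B(1) zero_less_one p B(2)] by simp
  qed
  have "\<bar>g' x\<bar> \<le> \<Lambda> / N" if "x \<in> sphere 0 1" for x
    using sup[OF that] N by (simp add: g'_def abs_mult divide_right_mono)
  moreover have "(\<integral>x. \<bar>g' x\<bar> \<partial>sphere_measure) \<le> \<Lambda> / N * v"
    using L1 N by (simp add: g'_def abs_mult divide_right_mono)
  moreover have "0 < \<Lambda> / N"
    using \<Lambda> N by simp
  ultimately have g'L: "g' \<in> Lp_space p sphere_measure"
    and "Lp_norm p sphere_measure g' \<le> \<Lambda> / N * v powr real_of_ereal (1 / p)"
    using Lp_norm_bound[OF g'c _ v p] by blast+
  have "sobolev_norm s p f' \<le> 1"
  proof -
    note \<open>Lp_norm p sphere_measure g' \<le> \<Lambda> / N * v powr real_of_ereal (1 / p)\<close>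
    also have "\<Lambda> / N * v powr real_of_ereal (1 / p) = 1"
      using \<Lambda> v by (simp add: N_def)
    finally show ?thesis
      by (simp only: sobolev_norm_eq[OF g'L fg' p])
  qed
  moreover have "f' \<in> sobolev_space s p"
    using f'L g'L fg' by (auto simp: sobolev_space_def)
  ultimately have "ennreal \<bar>quadrature X f' - (\<integral>x. f' x \<partial>sphere_measure)\<bar> \<le> wce X s p"
    unfolding wce_def using f'c by (intro SUP_upper) auto
  moreover have "quadrature X f' = 0"
    using X by (simp add: quadrature_def f'_def)
  moreover have "(\<integral>x. f' x \<partial>sphere_measure) = (\<integral>x. f x \<partial>sphere_measure) / N"
    by (simp add: f'_def)
  ultimately show ?thesis
    by (metis N_def abs_ge_self abs_minus_commute diff_zero ennreal_leI order_trans)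
qed

text \<open>Puts all extended exponents in terms of the real number \<theta> = 1/q. For infinite
  \<open>q\<close> the conventions of \<open>ereal\<close> give \<theta> = 0 and the exponent 0 of
  \<open>n\<close>; both exponents infinite would contradict the conjugacy relation.\<close>

lemma conjugate_exponents:
  fixes p q :: ereal and s :: real and d :: nat
  assumes "1 \<le> p" "1 \<le> q" "1 / p + 1 / q = 1" and s: "0 < s"
  defines "\<theta> \<equiv> real_of_ereal (1 / q)"
  shows "0 \<le> \<theta>" "real_of_ereal (1 / p) = 1 - \<theta>"
    "real_of_ereal (- 1 / (q * ereal s + ereal (real d))) = - (\<theta> / (s + real d * \<theta>))"
    "real_of_ereal (1 / (ereal s + ereal (real d) / q)) = 1 / (s + real d * \<theta>)"
proof -
  consider (real) P Q where "p = ereal P" "q = ereal Q" "1 \<le> P" "1 \<le> Q"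
    | (p_inf) Q where "p = \<infinity>" "q = ereal Q" "1 \<le> Q"
    | (q_inf) P where "p = ereal P" "q = \<infinity>" "1 \<le> P"
    | (both) "p = \<infinity>" "q = \<infinity>"
    using assms(1,2) by (cases p; cases q) auto
  then have "0 \<le> \<theta> \<and> real_of_ereal (1 / p) = 1 - \<theta> \<and>
    real_of_ereal (- 1 / (q * ereal s + ereal (real d))) = - (\<theta> / (s + real d * \<theta>)) \<and>
    real_of_ereal (1 / (ereal s + ereal (real d) / q)) = 1 / (s + real d * \<theta>)"
  proof cases
    case real
    then have 1: "1 / P + 1 / Q = 1" and \<theta>: "\<theta> = 1 / Q"
      using assms(3) by (auto simp: \<theta>_def one_ereal_def)
    have "0 < Q * s"
      using real s by simp
    then have "Q * s + real d \<noteq> 0" "s + real d / Q \<noteq> 0"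
      using real s by (auto simp: add_nonneg_eq_0_iff)
    moreover have "- 1 / (Q * s + real d) = - (1 / Q / (s + real d * (1 / Q)))"
      using real \<open>Q * s + real d \<noteq> 0\<close> by (simp add: field_simps)
    ultimately show ?thesis
      using real 1 \<theta> by (simp add: one_ereal_def)
  next
    case p_inf
    then have "\<theta> = 1" "Q = 1"
      using assms(3) by (auto simp: \<theta>_def one_ereal_def)
    moreover have "s + real d \<noteq> 0"
      using s by linarith
    ultimately show ?thesis
      using p_inf by (simp add: one_ereal_def)
  next
    case q_inf
    then have \<theta>: "\<theta> = 0" and "P = 1"
      using assms(3) by (auto simp: \<theta>_def one_ereal_def)
    moreover have "q * ereal s + ereal (real d) = \<infinity>"
      using q_inf s by simp
    ultimately show ?thesis
      using q_inf s by (simp add: one_ereal_def)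
  next
    case both
    then show ?thesis using assms(3) by simp
  qed
  then show "0 \<le> \<theta>" "real_of_ereal (1 / p) = 1 - \<theta>"
    "real_of_ereal (- 1 / (q * ereal s + ereal (real d))) = - (\<theta> / (s + real d * \<theta>))"
    "real_of_ereal (1 / (ereal s + ereal (real d) / q)) = 1 / (s + real d * \<theta>)"
    by auto
qed

text \<open>The powers of \<open>h\<close> combine to \<open>e / 2\<close> with
  \<open>e = s + d * \<theta>\<close>, and the inequality is solved for \<open>sqrt h\<close>. Since
  \<open>e \<ge> s\<close>, replacing the base by \<open>max 1 (1 / \<kappa>)\<close> allows the
  exponent 1/e to be raised to 1/s, which removes \<theta> from the constant.\<close>

lemma radius_estimate:
  fixes h w \<kappa> n :: real
  assumes h: "0 < h" and \<kappa>: "0 < \<kappa>" and n: "0 < n" and s: "0 < s" and \<theta>: "0 \<le> \<theta>"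
    and w: "\<kappa> * h powr (s / 2) * (n * h powr (real d / 2)) powr \<theta> \<le> w"
  shows "sqrt h \<le> max 1 (1 / \<kappa>) powr (1 / s) * n powr (- (\<theta> / (s + real d * \<theta>))) *
    w powr (1 / (s + real d * \<theta>))"
proof -
  define e where "e = s + real d * \<theta>"
  have e: "s \<le> e" "0 < e"
    using s \<theta> by (auto simp: e_def add_pos_nonneg)
  have "h powr (s / 2) * (n * h powr (real d / 2)) powr \<theta> = n powr \<theta> * h powr (e / 2)"
    using h n by (simp add: powr_mult powr_powr e_def add_divide_distrib powr_add mult_ac)
  then have "\<kappa> * (n powr \<theta> * h powr (e / 2)) \<le> w"
    using w by (simp add: mult.assoc)
  then have "h powr (e / 2) \<le> 1 / \<kappa> * n powr (- \<theta>) * w"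
    using \<kappa> n by (simp add: field_simps powr_minus)
  then have "(h powr (e / 2)) powr (1 / e) \<le> (1 / \<kappa> * n powr (- \<theta>) * w) powr (1 / e)"
    using e by (intro powr_mono2) auto
  moreover have "(h powr (e / 2)) powr (1 / e) = sqrt h"
    using h e by (simp add: powr_powr powr_half_sqrt)
  moreover have "0 \<le> w"
    by (rule order_trans[OF _ w]) (use \<kappa> in simp)
  then have "(1 / \<kappa> * n powr (- \<theta>) * w) powr (1 / e) =
      (1 / \<kappa>) powr (1 / e) * n powr (- (\<theta> / e)) * w powr (1 / e)"
    using \<kappa> by (simp add: powr_mult powr_powr del: times_divide_eq_left)
  moreover have "(1 / \<kappa>) powr (1 / e) \<le> max 1 (1 / \<kappa>) powr (1 / s)"
  proof -
    have "(1 / \<kappa>) powr (1 / e) \<le> max 1 (1 / \<kappa>) powr (1 / e)"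
      using \<kappa> e by (intro powr_mono2) auto
    also have "\<dots> \<le> max 1 (1 / \<kappa>) powr (1 / s)"
      using s e by (intro powr_mono divide_left_mono) auto
    finally show ?thesis .
  qed
  then have "(1 / \<kappa>) powr (1 / e) * n powr (- (\<theta> / e)) * w powr (1 / e) \<le>
      max 1 (1 / \<kappa>) powr (1 / s) * n powr (- (\<theta> / e)) * w powr (1 / e)"
    by (intro mult_right_mono) auto
  ultimately show ?thesis
    unfolding e_def[symmetric] by linarith
qed

text \<open>Passes from heights to angles and at the same time shrinks the cap, because all caps
  will receive the smallest radius.\<close>

lemma cap_subset_spherical_cap:
  assumes z: "z \<in> sphere 0 1" and r: "0 < r" "r \<le> r'" "r' \<le> pi"
  shows "cap z (1 - cos r) \<subseteq> spherical_cap z r'"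
proof
  fix y assume y: "y \<in> cap z (1 - cos r)"
  then have "norm y = 1" "cos r < z \<bullet> y"
    by (auto simp: cap_def)
  moreover have "\<bar>z \<bullet> y\<bar> \<le> 1"
    using Cauchy_Schwarz_ineq2[of z y] z \<open>norm y = 1\<close> by simp
  ultimately have "arccos (z \<bullet> y) < arccos (cos r)"
    by (subst arccos_less_mono) auto
  also have "\<dots> = r"
    using r by (intro arccos_cos) auto
  finally show "y \<in> spherical_cap z r'"
    using \<open>norm y = 1\<close> r by (simp add: spherical_cap_def)
qed

text \<open>Below a right angle, 1 - cos r = 2 sin^2 t with t = r/2, and sin t is at least t cos t
  with cos^2 t at least 1/2. Beyond it, 1 - cos r is at least 1 and \<open>pi\<close> bounds the
  radius.\<close>

lemma radius_le_sqrt: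
  assumes "0 \<le> r" "r \<le> pi"
  shows "r \<le> pi * sqrt (1 - cos r)"
proof (cases "r < pi / 2")
  case True
  define t where "t = r / 2"
  have t: "0 \<le> t" "t < pi / 4"
    using True assms by (auto simp: t_def)
  have "t \<le> tan t"
    using abs_tan_ge[of t] t tan_pos_pi2_le[of t] by simp
  have cos: "0 < cos t" "1/2 \<le> (cos t)\<^sup>2"
  proof -
    have "cos (pi / 4) \<le> cos t"
      using t by (intro cos_monotone_0_pi_le) auto
    then show "0 < cos t" "1/2 \<le> (cos t)\<^sup>2"
      using power_mono[of "sqrt 2 / 2" "cos t" 2]
      by (auto simp: cos_45 power_divide intro: less_le_trans[of _ "sqrt 2 / 2"])
  qed
  have "t * cos t \<le> sin t"
    using \<open>t \<le> tan t\<close> cos(1) by (simp add: tan_def pos_le_divide_eq)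
  then have "(t * cos t)\<^sup>2 \<le> (sin t)\<^sup>2"
    using t cos by (intro power_mono) auto
  moreover have "t\<^sup>2 * (1/2) \<le> t\<^sup>2 * (cos t)\<^sup>2"
    using cos by (intro mult_left_mono) auto
  moreover have "1 - cos r = 2 * (sin t)\<^sup>2"
    using cos_double_sin[of t] by (simp add: t_def)
  ultimately have "t\<^sup>2 \<le> 1 - cos r"
    by (simp add: power_mult_distrib)
  then have "t \<le> sqrt (1 - cos r)"
    by (rule real_le_rsqrt)
  then have "2 * t \<le> pi * sqrt (1 - cos r)"
    using t pi_ge_two by (intro mult_mono) auto
  then show ?thesis
    by (simp add: t_def)
next
  case False
  then have "cos r \<le> cos (pi / 2)"
    using assms by (intro cos_monotone_0_pi_le) auto
  then have "pi * 1 \<le> pi * sqrt (1 - cos r)"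
    by (intro mult_left_mono) auto
  then show ?thesis
    using assms(2) by linarith
qed

theorem theorem2p3:
  fixes d :: nat and s :: real
  assumes "CARD('n::finite) = d + 1" and "d \<ge> 1"
  shows "\<exists>c>0. \<forall>(p::ereal) (q::ereal) (N::nat) (X::(real ^ 'n) set)
            (J::nat set) (z::nat \<Rightarrow> real ^ 'n) (\<rho>::nat \<Rightarrow> real) (n::nat).
           1 \<le> p \<longrightarrow> 1 \<le> q \<longrightarrow> 1 / p + 1 / q = 1 \<longrightarrow> s > real d / p \<longrightarrow>
           N \<ge> 1 \<longrightarrow> finite X \<longrightarrow> card X = N \<longrightarrow> X \<subseteq> sphere 0 1 \<longrightarrow>
           ordered_avoiding_packing X J z \<rho> \<longrightarrow> n \<in> J \<longrightarrow>
           ennreal (\<rho> n) \<le>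
             ennreal (c * real n powr real_of_ereal (- 1 / (q * s + d))) *
             ennreal_powr (wce X s p) (real_of_ereal (1 / (s + d / q)))"
proof (cases "0 < s")
  case False
  \<comment> \<open>For \<open>s \<le> 0\<close> the hypothesis \<open>s > d / p\<close> cannot
    hold, and any constant will do.\<close>
  have "\<not> ereal s > ereal (real d) / p" if "1 \<le> p" for p :: ereal
  proof -
    have "0 \<le> ereal (real d) / p"
      using that by (intro zero_le_divide_ereal) (auto intro: order_trans[of 0 1])
    then show ?thesis
      using False by (metis ereal_less(2) not_le order.strict_trans1 zero_ereal_def)
  qed
  then show ?thesis
    by (intro exI[of _ 1]) auto
next
  case s: True
  have dim: "DIM(real ^ 'n) - 1 = d"
    using assms(1) by simp
  show ?thesis
  proof (rule test_function_exists[OF s, where ?'a="real ^ 'n", unfolded dim])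
    fix a K :: real
    assume a: "a > 0" and K: "K > 0" and test:
      "\<And>h I (z :: nat \<Rightarrow> real ^ 'n). \<lbrakk>0 < h; h \<le> 2; finite I; \<And>k. k \<in> I \<Longrightarrow> norm (z k) = 1;
          disjoint_family_on (\<lambda>k. cap (z k) h) I\<rbrakk> \<Longrightarrow>
        \<exists>f g. continuous_on (sphere 0 1) f \<and> continuous_on (sphere 0 1) g \<and> bessel_image s f g \<and>
          (\<forall>x\<in>sphere 0 1 - (\<Union>k\<in>I. cap (z k) h). f x = 0) \<and>
          a * (real (card I) * h powr (real d / 2)) \<le> (\<integral>x. f x \<partial>sphere_measure) \<and>
          (\<forall>x\<in>sphere 0 1. \<bar>g x\<bar> \<le> K * h powr (- s / 2)) \<and>
          (\<integral>x. \<bar>g x\<bar> \<partial>sphere_measure) \<le>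
              K * h powr (- s / 2) * (real (card I) * h powr (real d / 2))"
    \<comment> \<open>The constant of \<open>radius_estimate\<close> for \<kappa> = a / K; the
      factor \<open>pi\<close> in \<open>c\<close> comes from \<open>radius_le_sqrt\<close>.\<close>
    define D where "D = max 1 (1 / (a / K)) powr (1 / s)"
    define c where "c = pi * D"
    have c: "c > 0"
      by (simp add: c_def D_def)
    show ?thesis
    proof (intro exI[of _ c] conjI c allI impI)
      fix p q :: ereal and N :: nat and X :: "(real ^ 'n) set" and J :: "nat set"
        and z :: "nat \<Rightarrow> real ^ 'n" and \<rho> :: "nat \<Rightarrow> real" and n :: nat
      assume p: "1 \<le> p" and q: "1 \<le> q" and pq: "1 / p + 1 / q = 1"
        and X: "finite X" "X \<subseteq> sphere 0 1"
        and packing: "ordered_avoiding_packing X J z \<rho>" and n: "n \<in> J"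
      define \<theta> where "\<theta> = real_of_ereal (1 / q)"
      note exponents = conjugate_exponents[OF p q pq s, folded \<theta>_def]
      have J: "J = {1..} \<or> (\<exists>m. J = {1..m})"
        and caps: "\<And>k. k \<in> J \<Longrightarrow> z k \<in> sphere 0 1 \<and> 0 < \<rho> k \<and> \<rho> k \<le> pi"
        and disj: "disjoint_family_on (\<lambda>n. spherical_cap (z n) (\<rho> n)) J"
        and mono: "\<And>k. k \<in> J \<Longrightarrow> k \<le> n \<Longrightarrow> \<rho> n \<le> \<rho> k"
        and avoid: "\<And>k. k \<in> J \<Longrightarrow> spherical_cap (z k) (\<rho> k) \<inter> X = {}"
        using packing n unfolding ordered_avoiding_packing_def by blast+
      \<comment> \<open>The first \<open>n\<close> caps, whose radii are all at least
        \<open>\<rho> n\<close>.\<close>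
      define I where "I = {1..n}"
      have IJ: "I \<subseteq> J" and n1: "1 \<le> n"
        using J n by (auto simp: I_def)
      define h where "h = 1 - cos (\<rho> n)"
      have \<rho>: "0 < \<rho> n" "\<rho> n \<le> pi"
        using caps[OF n] by auto
      have h: "0 < h" "h \<le> 2"
        using cos_monotone_0_pi[of 0 "\<rho> n"] \<rho> by (auto simp: h_def)
      have sub: "cap (z k) h \<subseteq> spherical_cap (z k) (\<rho> k)" if "k \<in> I" for k
        using that IJ caps[of k] \<rho> mono[of k]
        unfolding h_def by (intro cap_subset_spherical_cap) (auto simp: I_def)
      have disjI: "disjoint_family_on (\<lambda>k. cap (z k) h) I"
        using disj sub IJ unfolding disjoint_family_on_def by blast
      have normI: "norm (z k) = 1" if "k \<in> I" for k
        using caps IJ that by auto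
      have finI: "finite I" and cardI: "card I = n"
        by (simp_all add: I_def)
      obtain f g where f: "continuous_on (sphere 0 1) f" and g: "continuous_on (sphere 0 1) g"
        and fg: "bessel_image s f g"
        and f0: "\<And>x. x \<in> sphere 0 1 - (\<Union>k\<in>I. cap (z k) h) \<Longrightarrow> f x = 0"
        and fint: "a * (real n * h powr (real d / 2)) \<le> (\<integral>x. f x \<partial>sphere_measure)"
        and gsup: "\<And>x. x \<in> sphere 0 1 \<Longrightarrow> \<bar>g x\<bar> \<le> K * h powr (- s / 2)"
        and gint: "(\<integral>x. \<bar>g x\<bar> \<partial>sphere_measure) \<le>
            K * h powr (- s / 2) * (real n * h powr (real d / 2))"
        using test[OF h finI normI disjI] unfolding cardI by blast
      define v where "v = real n * h powr (real d / 2)"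
      define \<Lambda> where "\<Lambda> = K * h powr (- s / 2)"
      have v: "0 < v" and \<Lambda>: "0 < \<Lambda>"
        using h n1 K by (auto simp: v_def \<Lambda>_def)
      have "f x = 0" if "x \<in> X" for x
        using that X avoid sub IJ by (intro f0) blast
      then have lower: "ennreal ((\<integral>x. f x \<partial>sphere_measure) / (\<Lambda> * v powr (1 - \<theta>))) \<le> wce X s p"
        using wce_lower_bound[OF f g fg \<Lambda> v p gsup[folded \<Lambda>_def] gint[folded \<Lambda>_def v_def], of X]
        by (simp add: exponents(2))
      \<comment> \<open>The integral bound divided by the norm bound, with \<open>v\<close> split as
        \<open>v powr \<theta> * v powr (1 - \<theta>)\<close>; this is the form required by
        \<open>radius_estimate\<close>.\<close>
      have "a / K * h powr (s / 2) * v powr \<theta> = a * v / (\<Lambda> * v powr (1 - \<theta>))"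
        using h v K by (simp add: \<Lambda>_def powr_diff powr_minus field_simps)
      also have "\<dots> \<le> (\<integral>x. f x \<partial>sphere_measure) / (\<Lambda> * v powr (1 - \<theta>))"
        using fint v \<Lambda> by (intro divide_right_mono) (auto simp: v_def)
      finally have w: "ennreal (a / K * h powr (s / 2) * v powr \<theta>) \<le> wce X s p"
        using lower by (meson ennreal_leI order_trans)
      define A where "A = c * real n powr real_of_ereal (- 1 / (q * ereal s + ereal (real d)))"
      have A: "0 < A"
        using c n1 by (simp add: A_def)
      show "ennreal (\<rho> n) \<le> ennreal (c * real n powr real_of_ereal (- 1 / (q * s + d))) *
               ennreal_powr (wce X s p) (real_of_ereal (1 / (s + d / q)))"
      \<comment> \<open>When the error is infinite, so is the right-hand side, its real factor being
        positive.\<close>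
      proof (cases "wce X s p = \<infinity>")
        case True
        then show ?thesis
          using c n1 by (simp add: ennreal_powr_def ennreal_mult_top)
      next
        case False
        define w where "w = enn2real (wce X s p)"
        have w_eq: "wce X s p = ennreal w"
          using False by (simp add: w_def less_top)
        have "a / K * h powr (s / 2) * (real n * h powr (real d / 2)) powr \<theta> \<le> w"
          using w a K unfolding w_eq v_def by (simp add: w_def)
        then have sq: "sqrt h \<le> D * real n powr (- (\<theta> / (s + real d * \<theta>))) * w powr (1 / (s +
            real d * \<theta>))"
          unfolding D_def using a K n1 by (intro radius_estimate h s exponents(1)) auto
        have "\<rho> n \<le> pi * sqrt h"
          unfolding h_def using \<rho> by (intro radius_le_sqrt) auto
        also have "\<dots> \<le> pi * (D * real n powr (- (\<theta> / (s + real d * \<theta>))) * w powr (1 / (s +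
            real d * \<theta>)))"
          using sq by (intro mult_left_mono) auto
        also have "\<dots> = c * real n powr real_of_ereal (- 1 / (q * ereal s + ereal (real d))) *
            w powr real_of_ereal (1 / (ereal s + ereal (real d) / q))"
          by (simp only: exponents c_def mult.assoc)
        finally have "ennreal (\<rho> n) \<le>
            ennreal (c * real n powr real_of_ereal (- 1 / (q * ereal s + ereal (real d))) *
            w powr real_of_ereal (1 / (ereal s + ereal (real d) / q)))"
          by (rule ennreal_leI)
        then show ?thesis
          using A False unfolding ennreal_powr_def by (simp add: ennreal_mult A_def w_def)
      qed
    qed
  qed
qed

end
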